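(* The minimum order of a barnacle-free Harris graph is $13$: there exists a barnacle-free Harris graph on $13$ vertices, and every barnacle-free Harris graph has at least $13$ vertices.
   Context: All graphs are finite, simple and undirected. A graph $G$ is tough if it is connected and for every nonempty set $S$ of vertices, the number of connected components of $G-S$ is at most $|S|$. A graph is Eulerian if it is connected and every vertex has even degree. A graph is Hamiltonian if it contains a spanning cycle. A Harris graph is a graph that is tough, Eulerian, and not Hamiltonian. For $k\ge 2$, a $k$-barnacle in a graph is a path of length $k$ between two distinct vertices $x$ and $y$ all of whose internal vertices have degree $2$ in the graph. A graph is barnacle-free if it contains no $k$-barnacle for any $k\ge 2$, equivalently if it has no vertex of degree $2$.
   Formalization: The one-vertex graph is counted as Hamiltonian; read literally it has no spanning cycle, so it would be a barnacle-free Harris graph of order 1 and the claimed minimum 13 would be false. *)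

theory Defs
  imports "Graph_Theory.Graph_Theory"
begin

text \<open>
  A finite simple undirected graph is a digraph satisfying the locale predicate \<^const>\<open>graph\<close>
  (finite, loop-free, symmetric, no parallel arcs): an edge \<open>{u, v}\<close> is the pair of arcs
  \<open>(u, v)\<close>, \<open>(v, u)\<close>.  By symmetry the degree of a vertex is its out-degree, and the connected
  components are the strongly connected components.
\<close>

abbreviation degree :: "('a, 'b) pre_digraph \<Rightarrow> 'a \<Rightarrow> nat" where
  "degree G v \<equiv> out_degree G v"

abbreviation components :: "('a, 'b) pre_digraph \<Rightarrow> ('a, 'b) pre_digraph set" where
  "components G \<equiv> pre_digraph.sccs G"

lemma components_eq_maximal_connected:
  assumes "graph G"
  shows "components G = {H. induced_subgraph H G \<and> connected H \<and>
    \<not> (\<exists>H'. induced_subgraph H' G \<and> connected H' \<and> verts H \<subset> verts H')}"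
proof -
  interpret graph G by fact
  have "connected H \<longleftrightarrow> strongly_connected H" if "induced_subgraph H G" for H
  proof -
    have "symmetric H"
      using that induced_graph_imp_symmetric sym_arcs by blast
    moreover have "wf_digraph H"
      using that by (auto simp: induced_subgraph_def)
    ultimately show ?thesis
      by (simp add: connected_def strongly_connected_def wf_digraph.reachable_mk_symmetric_eq)
  qed
  then show ?thesis
    unfolding sccs_def by blast
qed

definition tough :: "('a, 'b) pre_digraph \<Rightarrow> bool" where
  "tough G \<longleftrightarrow> connected G \<and>
    (\<forall>S. S \<subseteq> verts G \<and> S \<noteq> {} \<longrightarrow> card (components (G \<restriction> (verts G - S))) \<le> card S)"

definition eulerian :: "('a, 'b) pre_digraph \<Rightarrow> bool" where
  "eulerian G \<longleftrightarrow> connected G \<and> (\<forall>v \<in> verts G. even (degree G v))"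

text \<open>
  \<^const>\<open>pre_digraph.cycle\<close> also accepts the closed walk \<open>u, v, u\<close> along a single edge, which is
  not a cycle of an undirected graph; hence the bound on the length.  Every vertex of a cycle is
  the tail of one of its arcs.

  The one-vertex graph counts as Hamiltonian, by the usual convention.  It is connected and tough
  and its only degree is \<open>0\<close>, so without the convention it would be a Harris graph.
\<close>

definition hamiltonian :: "('a, 'b) pre_digraph \<Rightarrow> bool" where
  "hamiltonian G \<longleftrightarrow> card (verts G) = 1 \<or>
    (\<exists>p. pre_digraph.cycle G p \<and> 3 \<le> length p \<and> tail G ` set p = verts G)"

definition harris_graph :: "('a, 'b) pre_digraph \<Rightarrow> bool" where
  "harris_graph G \<longleftrightarrow> graph G \<and> tough G \<and> eulerian G \<and> \<not> hamiltonian G"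

definition barnacle :: "('a, 'b) pre_digraph \<Rightarrow> nat \<Rightarrow> 'a \<Rightarrow> 'b awalk \<Rightarrow> 'a \<Rightarrow> bool" where
  "barnacle G k x p y \<longleftrightarrow> x \<noteq> y \<and> pre_digraph.apath G x p y \<and> length p = k \<and>
    (\<forall>v \<in> set (pre_digraph.inner_verts G p). degree G v = 2)"

definition barnacle_free :: "('a, 'b) pre_digraph \<Rightarrow> bool" where
  "barnacle_free G \<longleftrightarrow> \<not> (\<exists>k\<ge>2. \<exists>x p y. barnacle G k x p y)"

lemma barnacle_free_iff_no_degree_2:
  assumes "graph G"
  shows "barnacle_free G \<longleftrightarrow> (\<forall>v\<in>verts G. degree G v \<noteq> 2)"
proof -
  interpret graph G by fact
  have "False" if bf: "barnacle_free G" and v: "v \<in> verts G" and d: "out_degree G v = 2" for v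
  proof -
    from d obtain e f where ef: "out_arcs G v = {e,f}" "e \<noteq> f"
      unfolding out_degree_def by (meson card_2_iff)
    then have *: "e \<in> arcs G" "f \<in> arcs G" "tail G e = v" "tail G f = v" by auto
    then obtain e' where e': "e' \<in> arcs G" "head G e' = v" "tail G e' = head G e"
      using sym_arcs by (metis symmetric_conv)
    have ne: "head G e \<noteq> head G f" using no_multi_arcs * ef(2) by (metis arc_to_ends_def)
    have "barnacle G 2 (head G e) [e', f] (head G f)"
      unfolding barnacle_def using * e' ne d no_loops[of e] no_loops[of f]
      by (auto simp: apath_def awalk_def inner_verts_def)
    then show False using bf unfolding barnacle_free_def by blast
  qed
  moreover have "\<exists>v\<in>verts G. out_degree G v = 2" if "barnacle G k x p y" "k \<ge> 2" for k x p y
  proof -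
    from that obtain a b q where p: "p = a # b # q" unfolding barnacle_def
      by (cases p; cases "tl p") auto
    have "tail G b \<in> verts G" using that p unfolding barnacle_def by (auto simp: apath_def awalk_def)
    moreover have "out_degree G (tail G b) = 2" using that p unfolding barnacle_def by (auto simp: inner_verts_def)
    ultimately show ?thesis by blast
  qed
  ultimately show ?thesis unfolding barnacle_free_def by blast
qed

end

theory Submission
  imports Defs
begin

text \<open>Lower bound: degrees are even and not 2, so it suffices that a tough graph of order \<open>n \<le> 12\<close> with
  minimum degree 4 has a Hamiltonian cycle. If not, add edges until every further edge would create
  one; the resulting graph still has the other two properties, and now it has a Hamiltonian path.
  Among all Hamiltonian paths \<open>q\<close> and all chords from \<open>q 0\<close> to \<open>q (l - 1)\<close> choose one with \<open>l\<close>
  maximal, so \<open>5 \<le> l < n\<close>. Maximality forbids so many further edges, in particular at the ends of the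
  paths obtained by rotating within the cycle \<open>q 0, \<dots>, q (l - 1)\<close>, that a short case distinction for
  each pair \<open>(n, l)\<close> always ends at a vertex of degree at most 3 or at a set violating toughness.

  Existence: join three universal vertices to a net (a triangle with a pendant vertex at each corner)
  and two single edges. Deleting the universal vertices from a Hamiltonian cycle would leave at most
  three paths covering the rest, but the net needs two of
  them and each edge one.\<close>

section \<open>Saturated graphs and maximal lollipops\<close>

text \<open>Graphs of order up to 12 are too many to be listed inside the logic. Fixing a labelled
  Hamiltonian path and one chord leaves only the other pairs open, and most of these are settled
  without branching: an edge that, together with known ones, would give a longer chord is excluded
  outright. The few real case distinctions fit into a stored tree. How the tree was found is
  irrelevant to the proof, because it is replayed by a checker that is proved correct. Saturation is
  harmless since degrees only grow and toughness is inherited when edges are added.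

  Parity shapes the extremal graph. A vertex whose only neighbours are the three universal ones
  would have the odd degree 3, so single edges stand where isolated vertices would be simpler; each
  of their ends has degree 3 + 1. The net is needed because toughness permits only three components
  after the deletion of three vertices: to defeat three covering paths, one of these components must
  itself have no Hamiltonian path.\<close>

definition hamilton_path :: "('a \<Rightarrow> 'a \<Rightarrow> bool) \<Rightarrow> 'a set \<Rightarrow> 'a list \<Rightarrow> bool" where
  "hamilton_path R V q \<longleftrightarrow> distinct q \<and> set q = V \<and> successively R q"

text \<open>Components are counted through labellings: for finite \<open>V\<close>, the number of
  components left on \<open>V - S\<close> is the largest number of values of a function that is
  constant along the edges there. In this form the condition passes to graphs with more edges and
  transports along a renaming of the vertices.\<close>

definition tough_on :: "('a \<Rightarrow> 'a \<Rightarrow> bool) \<Rightarrow> 'a set \<Rightarrow> bool" where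
  "tough_on R V \<longleftrightarrow> (\<forall>S (f :: 'a \<Rightarrow> nat). S \<subseteq> V \<and> S \<noteq> {} \<and>
     (\<forall>a \<in> V - S. \<forall>b \<in> V - S. R a b \<longrightarrow> f a = f b) \<longrightarrow> card (f ` (V - S)) \<le> card S)"

text \<open>More edges leave fewer functions that are constant along all of them.\<close>

lemma tough_on_mono:
  assumes "tough_on Q V" "\<And>a b. a \<in> V \<Longrightarrow> b \<in> V \<Longrightarrow> Q a b \<Longrightarrow> R a b"
  shows "tough_on R V"
  unfolding tough_on_def
proof (intro allI impI, elim conjE)
  fix S and f :: "'a \<Rightarrow> nat"
  assume S: "S \<subseteq> V" "S \<noteq> {}" "\<forall>a\<in>V - S. \<forall>b\<in>V - S. R a b \<longrightarrow> f a = f b"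
  then have "\<forall>a\<in>V - S. \<forall>b\<in>V - S. Q a b \<longrightarrow> f a = f b" using assms(2) by blast
  then show "card (f ` (V - S)) \<le> card S" using assms(1) S(1,2) unfolding tough_on_def by blast
qed

lemma not_successively:
  assumes "\<not> successively R q"
  obtains xs a b ys where "q = xs @ a # b # ys" "\<not> R a b"
  using assms
proof (induction q arbitrary: thesis rule: induct_list012)
  case (3 x y zs)
  show ?case
  proof (cases "R x y")
    case True
    then have "\<not> successively R (y # zs)" using 3 by simp
    with 3(2) obtain xs a b ys where "y # zs = xs @ a # b # ys" "\<not> R a b" by blast
    then show ?thesis using 3(3)[of "x # xs"] by auto
  next
    case False
    then show ?thesis using 3(3)[of "[]" x y zs] by auto
  qed
qed auto

text \<open>A cycle is given as a list whose last entry is joined to its first. If the extra edge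
  between \<open>u\<close> and \<open>v\<close> occurs inside the list, rotating the list makes it
  the closing pair, and a list without its closing pair is a path.\<close>

lemma hamilton_path_without_edge:
  assumes "hamilton_path R' V q" "3 \<le> card V" "R' (last q) (hd q)"
    and R': "\<And>a b. R' a b \<Longrightarrow> R a b \<or> {a, b} = {u, v}"
  obtains p where "hamilton_path R V p"
proof -
  note traceable = that
  \<comment> \<open>Once the extra edge is the closing pair, the list cannot use it a second time: a
    consecutive pair equal to \<open>{last q, hd q}\<close> occurs only in a list of two entries,
    which \<open>3 \<le> card V\<close> excludes.\<close>
  have closing: thesis if q: "hamilton_path R' V q" "{last q, hd q} = {u, v}" for q
  proof (cases "successively R q")
    case True
    then show ?thesis using q(1) traceable[of q] by (simp add: hamilton_path_def)
  next
    case False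
    then obtain xs a b ys where split: "q = xs @ a # b # ys" "\<not> R a b"
      by (rule not_successively)
    have "R' a b" using q(1) split by (auto simp: hamilton_path_def successively_append_iff)
    then have "{a, b} = {last q, hd q}" using R' split(2) q(2) by blast
    moreover have "distinct q" "length q = card V"
      using q(1) by (auto simp: hamilton_path_def distinct_card)
    ultimately have False
      using split(1) \<open>3 \<le> card V\<close>
      by (cases xs; cases ys rule: rev_cases) (auto simp: doubleton_eq_iff)
    then show ?thesis ..
  qed
  show thesis
  proof (cases "successively R q")
    case True
    then show ?thesis using assms(1) that by (auto simp: hamilton_path_def)
  next
    case False
    then obtain xs a b ys where split: "q = xs @ a # b # ys" "\<not> R a b"
      by (rule not_successively)
    have "R' a b" using assms(1) split by (auto simp: hamilton_path_def successively_append_iff)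
    then have ab: "{a, b} = {u, v}" using R' split(2) by blast
    \<comment> \<open>The cycle is cut between \<open>a\<close> and \<open>b\<close>; the old
      closing pair becomes a consecutive pair of the rotated list.\<close>
    have "successively R' ((xs @ [a]) @ b # ys)"
      using assms(1) split(1) by (simp add: hamilton_path_def)
    then have "successively R' (xs @ [a])" "successively R' (b # ys)"
      unfolding successively_append_iff by blast+
    moreover have "R' (last (b # ys)) (hd (xs @ [a]))"
      using assms(3) split(1) by (cases xs) auto
    ultimately have "successively R' ((b # ys) @ xs @ [a])"
      by (subst successively_append_iff) blast
    then have "hamilton_path R' V ((b # ys) @ xs @ [a])"
      using assms(1) split(1) by (auto simp: hamilton_path_def)
    moreover have "{last ((b # ys) @ xs @ [a]), hd ((b # ys) @ xs @ [a])} = {u, v}"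
      using ab by simp
    ultimately show ?thesis by (rule closing)
  qed
qed

text \<open>An edge-maximal non-Hamiltonian graph is traceable: adding a missing edge creates a
  Hamiltonian cycle, and deleting that edge from the cycle leaves a Hamiltonian path.\<close>

lemma ex_saturated_supergraph:
  fixes E :: "'a \<Rightarrow> 'a \<Rightarrow> bool"
  assumes V: "finite V" "3 \<le> card V" and "symp E"
    and nonham: "\<nexists>q. hamilton_path E V q \<and> E (last q) (hd q)"
  obtains R p where "symp R" "\<And>a b. a \<in> V \<Longrightarrow> b \<in> V \<Longrightarrow> E a b \<Longrightarrow> R a b"
    "\<nexists>q. hamilton_path R V q \<and> R (last q) (hd q)" "hamilton_path R V p"
proof -
  \<comment> \<open>Edges are kept as subsets of \<open>V \<times> V\<close>, of which there are
    finitely many, so that a maximal one exists; relations on the whole type could be infinite in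
    number.\<close>
  define rel where "rel X = (\<lambda>a b. (a, b) \<in> X)" for X :: "('a \<times> 'a) set"
  define nonham where "nonham R \<longleftrightarrow> (\<nexists>q. hamilton_path R V q \<and> R (last q) (hd q))" for R
  define A where "A = {X. X \<subseteq> V \<times> V \<and> sym X \<and> {(a, b) \<in> V \<times> V. E a b} \<subseteq> X \<and> nonham (rel X)}"
  define X0 where "X0 = {(a, b) \<in> V \<times> V. E a b}"
  have "hamilton_path E V q \<and> E (last q) (hd q)"
    if "hamilton_path (rel X0) V q \<and> rel X0 (last q) (hd q)" for q
    using that unfolding hamilton_path_def X0_def rel_def by (auto elim: successively_mono)
  then have "nonham (rel X0)" using nonham unfolding nonham_def by blast
  then have "X0 \<in> A" using \<open>symp E\<close> by (auto simp: A_def X0_def sym_def symp_def)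
  moreover have "finite A" by (rule finite_subset[of _ "Pow (V \<times> V)"]) (auto simp: A_def V)
  ultimately obtain X where X: "X \<in> A" "\<forall>Y\<in>A. X \<subseteq> Y \<longrightarrow> X = Y"
    using finite_has_maximal[of A] by blast
  obtain p where "hamilton_path (rel X) V p"
  proof (cases "\<exists>u\<in>V. \<exists>v\<in>V. u \<noteq> v \<and> (u, v) \<notin> X")
    case True
    then obtain u v where uv: "u \<in> V" "v \<in> V" "(u, v) \<notin> X" by blast
    define Y where "Y = X \<union> {(u, v), (v, u)}"
    then have "X \<subseteq> Y" "X \<noteq> Y" using uv(3) by auto
    then have "Y \<notin> A" using X(2) by blast
    then have "\<not> nonham (rel Y)" using X(1) uv by (auto simp: A_def Y_def sym_def)
    then obtain q where "hamilton_path (rel Y) V q" "rel Y (last q) (hd q)"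
      unfolding nonham_def by blast
    then show ?thesis
      by (rule hamilton_path_without_edge[OF _ V(2), of _ _ "rel X" u v])
        (auto simp: rel_def Y_def intro: that)
  next
    case False
    \<comment> \<open>No pair of distinct vertices is missing, so any listing of \<open>V\<close> is
      a path.\<close>
    obtain p where p: "set p = V" "distinct p" using V(1) finite_distinct_list by blast
    have "successively (rel X) p"
    proof (rule ccontr)
      assume "\<not> successively (rel X) p"
      then obtain xs a b ys where "p = xs @ a # b # ys" "(a, b) \<notin> X"
        by (auto simp: rel_def elim: not_successively)
      then show False using False p by auto
    qed
    then show ?thesis using p that by (auto simp: hamilton_path_def)
  qed
  moreover have "symp (rel X)" "\<nexists>q. hamilton_path (rel X) V q \<and> rel X (last q) (hd q)"
    "\<And>a b. a \<in> V \<Longrightarrow> b \<in> V \<Longrightarrow> E a b \<Longrightarrow> rel X a b"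
    using X(1) by (auto simp: A_def rel_def nonham_def sym_def symp_def)
  ultimately show ?thesis using that by blast
qed

section \<open>Hamiltonian paths with a longest chord at their head\<close>

text \<open>The vertices are renamed by their positions on one Hamiltonian path. The edge from
  \<open>0\<close> to \<open>l - 1\<close>, which closes the cycle of the lollipop, is supplied
  separately. Positions count from 0, so a chord from the head to position \<open>j\<close> closes a
  cycle of \<open>j + 1\<close> vertices; \<open>maximal\<close> thus forbids every cycle longer
  than \<open>l\<close> that arises in this way from any Hamiltonian path. The relation may contain
  loops, hence \<open>w \<noteq> v\<close> in the degree bound.\<close>

locale maximal_lollipop =
  fixes n l :: nat and E :: "nat \<Rightarrow> nat \<Rightarrow> bool"
  assumes sym: "symp E"
    and path: "Suc a < n \<Longrightarrow> E a (Suc a)"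
    and min_degree: "v < n \<Longrightarrow> 4 \<le> card {w. w < n \<and> w \<noteq> v \<and> E v w}"
    and tough: "tough_on E {..<n}"
    and maximal: "hamilton_path E {..<n} q \<Longrightarrow> l \<le> j \<Longrightarrow> j < n \<Longrightarrow> \<not> E (hd q) (q ! j)"

text \<open>Four neighbours of the head of a path cannot all lie at positions 1 to 3, whence
  \<open>5 \<le> l\<close>; a chord to the last position would close a Hamiltonian cycle, whence
  \<open>l < card V\<close>. Passing from vertices to positions turns the relation into one on
  numbers, so that one finite computation serves graphs over every vertex type.\<close>

lemma ex_maximal_lollipop:
  fixes E :: "'a \<Rightarrow> 'a \<Rightarrow> bool"
  assumes V: "finite V" "V \<noteq> {}" and "symp E"
    and min_degree: "\<And>v. v \<in> V \<Longrightarrow> 4 \<le> card {w \<in> V. w \<noteq> v \<and> E v w}"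
    and tough: "tough_on E V"
    and nonham: "\<nexists>q. hamilton_path E V q \<and> E (last q) (hd q)"
  obtains l D where "5 \<le> l" "l < card V" "maximal_lollipop (card V) l D" "D 0 (l - 1)"
proof -
  define n where "n = card V"
  obtain v where "v \<in> V" using V by blast
  then have "{w \<in> V. w \<noteq> v \<and> E v w} \<subset> V" by blast
  then have "card {w \<in> V. w \<noteq> v \<and> E v w} < card V" by (rule psubset_card_mono[OF V(1)])
  then have "4 < n" using min_degree[OF \<open>v \<in> V\<close>] unfolding n_def by linarith
  then have "3 \<le> card V" by (simp add: n_def)
  then obtain R p where R: "symp R" "\<And>a b. a \<in> V \<Longrightarrow> b \<in> V \<Longrightarrow> E a b \<Longrightarrow> R a b"
    "\<nexists>q. hamilton_path R V q \<and> R (last q) (hd q)" and p: "hamilton_path R V p"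
    by (rule ex_saturated_supergraph[OF V(1) _ \<open>symp E\<close> nonham]) blast+
  have deg: "4 \<le> card {w \<in> V. w \<noteq> v \<and> R v w}" if "v \<in> V" for v
    using min_degree[OF that] by (rule order.trans) (use V that R in \<open>auto intro: card_mono\<close>)
  have len: "length q = n" if "hamilton_path R V q" for q
    using that by (auto simp: hamilton_path_def n_def distinct_card)
  define chord where "chord q j \<longleftrightarrow> hamilton_path R V q \<and> j < n \<and> R (hd q) (q ! j)" for q j
  have "\<exists>j\<ge>4. chord p j"
  proof (rule ccontr)
    assume *: "\<not> ?thesis"
    have "{w \<in> V. w \<noteq> hd p \<and> R (hd p) w} \<subseteq> nth p ` {1..3}"
    proof
      fix w assume w: "w \<in> {w \<in> V. w \<noteq> hd p \<and> R (hd p) w}"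
      then obtain j where j: "j < n" "w = p ! j"
        using p len[OF p] by (auto simp: hamilton_path_def in_set_conv_nth)
      then have "j \<noteq> 0" using w len[OF p] by (cases j; cases p) auto
      moreover have "j < 4" using * w j p by (force simp: chord_def)
      ultimately show "w \<in> nth p ` {1..3}" using j by auto
    qed
    then have "card {w \<in> V. w \<noteq> hd p \<and> R (hd p) w} \<le> card (nth p ` {1..3})"
      by (intro card_mono) auto
    also have "\<dots> \<le> 3" using card_image_le[of "{1..3}" "nth p"] by simp
    finally show False
      using deg[of "hd p"] p \<open>4 < n\<close> len[OF p] hd_in_set[of p]
      by (force simp: hamilton_path_def)
  qed
  then obtain j0 where j0: "4 \<le> j0" "chord p j0" by blast
  define P where "P j \<longleftrightarrow> (\<exists>q. chord q j)" for j
  have "P j0" using j0 by (auto simp: P_def)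
  moreover have bound: "\<forall>j. P j \<longrightarrow> j \<le> n" by (auto simp: P_def chord_def)
  ultimately have "P (GREATEST j. P j)" "j0 \<le> (GREATEST j. P j)"
    by (auto intro: GreatestI_nat Greatest_le_nat)
  then obtain j q where j: "j = (GREATEST j. P j)" "4 \<le> j" and q: "chord q j"
    using j0(1) by (auto simp: P_def)
  have max: "i \<le> j" if "chord q' i" for q' i
    unfolding j(1) by (rule Greatest_le_nat[of P _ n]) (use that bound P_def in auto)
  have hq: "distinct q" "set q = V" "successively R q" "length q = n"
    using q len by (auto simp: chord_def hamilton_path_def)
  have "j \<noteq> n - 1"
  proof
    assume "j = n - 1"
    then have "R (hd q) (last q)"
      using q hq(4) \<open>4 < n\<close> last_conv_nth[of q] by (cases q) (auto simp: chord_def)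
    then show False using R(1,3) q by (auto simp: chord_def symp_def)
  qed
  then have "Suc j < n" using q by (auto simp: chord_def)
  define D where "D a b = R (q ! a) (q ! b)" for a b
  have bij: "bij_betw (nth q) {..<n} V" using bij_betw_nth[OF hq(1), of "{..<n}" V] hq by simp
  have "maximal_lollipop n (Suc j) D"
  proof
    show "symp D" using R(1) by (auto simp: D_def symp_def)
    show "D a (Suc a)" if "Suc a < n" for a
      using hq(3,4) that by (auto simp: D_def successively_conv_nth)
    show "4 \<le> card {w. w < n \<and> w \<noteq> v \<and> D v w}" if "v < n" for v
    proof -
      have "4 \<le> card {w \<in> V. w \<noteq> q ! v \<and> R (q ! v) w}" using deg hq that by auto
      also have "{w \<in> V. w \<noteq> q ! v \<and> R (q ! v) w} \<subseteq> nth q ` {w. w < n \<and> w \<noteq> v \<and> D v w}"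
      proof
        fix w assume w: "w \<in> {w \<in> V. w \<noteq> q ! v \<and> R (q ! v) w}"
        then obtain k where "k < n" "w = q ! k" using hq by (auto simp: in_set_conv_nth)
        then show "w \<in> nth q ` {w. w < n \<and> w \<noteq> v \<and> D v w}" using w by (auto simp: D_def)
      qed
      then have "card {w \<in> V. w \<noteq> q ! v \<and> R (q ! v) w} \<le> card {w. w < n \<and> w \<noteq> v \<and> D v w}"
        by (intro surj_card_le) auto
      finally show ?thesis .
    qed
    show "tough_on D {..<n}"
      unfolding tough_on_def
    proof (intro allI impI, elim conjE)
      fix S :: "nat set" and f :: "nat \<Rightarrow> nat"
      assume S: "S \<subseteq> {..<n}" "S \<noteq> {}"
        and f: "\<forall>a\<in>{..<n} - S. \<forall>b\<in>{..<n} - S. D a b \<longrightarrow> f a = f b"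
      \<comment> \<open>A labelling of positions is read as a labelling of the vertices of
        \<open>V\<close>, where toughness is available.\<close>
      define g where "g = f \<circ> inv_into {..<n} (nth q)"
      have inv: "inv_into {..<n} (nth q) (q ! i) = i" if "i < n" for i
        using bij that by (simp add: bij_betw_def inv_into_f_f)
      have diff: "V - nth q ` S = nth q ` ({..<n} - S)"
        using bij S by (auto simp: bij_betw_def inj_on_image_set_diff[of "nth q" "{..<n}"])
      have "tough_on R V" using tough R(2) by (rule tough_on_mono)
      moreover have "\<forall>a\<in>V - nth q ` S. \<forall>b\<in>V - nth q ` S. R a b \<longrightarrow> g a = g b"
        unfolding diff using f by (auto simp: g_def inv D_def)
      moreover have "nth q ` S \<subseteq> V" "nth q ` S \<noteq> {}" using S bij by (auto simp: bij_betw_def)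
      ultimately have "card (g ` (V - nth q ` S)) \<le> card (nth q ` S)"
        unfolding tough_on_def by blast
      moreover have "g ` (V - nth q ` S) = f ` ({..<n} - S)"
        unfolding diff image_image by (rule image_cong) (auto simp: g_def inv)
      moreover have "card (nth q ` S) \<le> card S"
        using S(1) finite_subset by (intro card_image_le) blast
      ultimately show "card (f ` ({..<n} - S)) \<le> card S" by simp
    qed
    show "\<not> D (hd p) (p ! i)" if p: "hamilton_path D {..<n} p" and i: "Suc j \<le> i" "i < n" for p i
    proof
      \<comment> \<open>A Hamiltonian path of \<open>D\<close> lists positions on \<open>q\<close>;
        \<open>map (nth q)\<close> turns it into a Hamiltonian path of \<open>R\<close> whose head
        has a chord to the same place \<open>i > j\<close>.\<close>
      assume D: "D (hd p) (p ! i)"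
      have "length p = n" using p by (metis hamilton_path_def card_lessThan distinct_card)
      have "distinct (map (nth q) p)"
        using p bij by (auto simp: hamilton_path_def distinct_map bij_betw_def)
      moreover have "set (map (nth q) p) = V"
        using p bij by (simp add: hamilton_path_def bij_betw_def)
      moreover have "successively R (map (nth q) p)"
        using p unfolding hamilton_path_def successively_map D_def by blast
      moreover have "R (hd (map (nth q) p)) (map (nth q) p ! i)"
        using D i \<open>length p = n\<close> by (cases p) (auto simp: D_def)
      ultimately have "chord (map (nth q) p) i"
        using i by (simp add: chord_def hamilton_path_def)
      then show False using max i by fastforce
    qed
  qed
  moreover have "D 0 j" using q hq(4) \<open>4 < n\<close> by (cases q) (auto simp: D_def chord_def)
  ultimately show ?thesis using \<open>Suc j < n\<close> j(2) by (intro that[of "Suc j" D]) (auto simp: n_def)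
qed

section \<open>Certificates for the case distinction\<close>

text \<open>A certificate refutes a maximal lollipop, given lists \<open>P\<close> of edges and \<open>N\<close> of non-edges. \<open>Case a b\<close>
  branches on the pair \<open>a b\<close>; \<open>Forb a b q\<close> excludes the edge \<open>a b\<close>, because with it \<open>q\<close> would be a
  Hamiltonian path with a longer chord; \<open>Deg v\<close> and \<open>Cut S Cs\<close> close a branch, the latter
  because \<open>S\<close> leaves the mutually non-adjacent parts \<open>Cs\<close>, of which there are more than \<open>|S|\<close>.\<close>

datatype certificate =
    Case nat nat certificate certificate
  | Forb nat nat "nat list" certificate
  | Deg nat
  | Cut "nat list" "nat list list"

text \<open>The edges between consecutive numbers belong to the path and are known in every branch,
  so \<open>P\<close> has to record only the others.\<close>

definition linked :: "(nat \<times> nat) list \<Rightarrow> nat \<Rightarrow> nat \<Rightarrow> bool" where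
  "linked P a b \<longleftrightarrow> Suc a = b \<or> Suc b = a \<or> (a, b) \<in> set P \<or> (b, a) \<in> set P"

definition unlinked :: "(nat \<times> nat) list \<Rightarrow> nat \<Rightarrow> nat \<Rightarrow> bool" where
  "unlinked N a b \<longleftrightarrow> (a, b) \<in> set N \<or> (b, a) \<in> set N"

primrec separated :: "(nat \<times> nat) list \<Rightarrow> nat list list \<Rightarrow> bool" where
  "separated N [] \<longleftrightarrow> True"
| "separated N (C # Cs) \<longleftrightarrow>
     (\<forall>a \<in> set C. \<forall>b \<in> set (concat Cs). unlinked N a b) \<and> separated N Cs"

definition enumerates :: "nat \<Rightarrow> nat list \<Rightarrow> bool" where
  "enumerates n q \<longleftrightarrow> length q = n \<and> distinct q \<and> (\<forall>a \<in> set q. a < n)"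

text \<open>\<open>Forb\<close> is a \<open>Case\<close> whose first branch is refuted on the spot;
  the tentative edge may serve as an edge of \<open>q\<close> or as the chord from its head, and
  \<open>drop l q\<close> holds the entries at positions \<open>l\<close> and beyond.
  \<open>Deg\<close> counts the vertices not yet excluded as neighbours, an upper bound for the
  degree. In \<open>Cut\<close> a part may be a union of several components, since merging
  components only lowers the count.\<close>

primrec check :: "nat \<Rightarrow> nat \<Rightarrow> (nat \<times> nat) list \<Rightarrow> (nat \<times> nat) list \<Rightarrow> certificate \<Rightarrow> bool" where
  "check n l P N (Case a b s t) \<longleftrightarrow> check n l ((a, b) # P) N s \<and> check n l P ((a, b) # N) t"
| "check n l P N (Forb a b q t) \<longleftrightarrow>
     enumerates n q \<and> successively (linked ((a, b) # P)) q \<and>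
     (\<exists>c \<in> set (drop l q). linked ((a, b) # P) (hd q) c) \<and> check n l P ((a, b) # N) t"
| "check n l P N (Deg v) \<longleftrightarrow>
     v < n \<and> length (filter (\<lambda>w. w \<noteq> v \<and> \<not> unlinked N v w) [0..<n]) < 4"
| "check n l P N (Cut S Cs) \<longleftrightarrow>
     S \<noteq> [] \<and> length S < length Cs \<and> enumerates n (S @ concat Cs) \<and> [] \<notin> set Cs \<and> separated N Cs"

section \<open>Soundness of the checker\<close>

lemma enumerates_set:
  assumes "enumerates n q"
  shows "distinct q \<and> set q = {..<n}"
proof -
  have "set q \<subseteq> {..<n}" "card (set q) = card {..<n}"
    using assms by (auto simp: enumerates_def distinct_card)
  then show ?thesis using assms card_subset_eq[of "{..<n}" "set q"] by (simp add: enumerates_def)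
qed

lemma separated_nth:
  assumes "separated N Cs" "i < j" "j < length Cs" "a \<in> set (Cs ! i)" "b \<in> set (Cs ! j)"
  shows "unlinked N a b"
  using assms
proof (induction Cs arbitrary: i j)
  case (Cons C Cs)
  then obtain j' where j: "j = Suc j'" by (cases j) auto
  show ?case
  proof (cases i)
    case 0
    then show ?thesis using Cons.prems j nth_mem[of j' Cs] by fastforce
  next
    case (Suc i')
    then show ?thesis using Cons.prems Cons.IH[of i' j'] j by auto
  qed
qed simp

context maximal_lollipop
begin

text \<open>Each vertex outside \<open>S\<close> is labelled by the index of its part. No edge joins
  different parts, so the label is constant along edges; the parts are disjoint and nonempty, so all
  \<open>length Cs\<close> labels occur, more than toughness allows.\<close>

lemma check_unsound_Cut:
  assumes "check n l P N (Cut S Cs)" "\<And>a b. (a, b) \<in> set N \<Longrightarrow> \<not> E a b"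
  shows False
proof -
  have S: "S \<noteq> []" "length S < length Cs" "[] \<notin> set Cs" "separated N Cs"
    and V: "distinct (S @ concat Cs)" "set (S @ concat Cs) = {..<n}"
    using assms(1) enumerates_set[of n "S @ concat Cs"] by auto
  have nE: "\<not> E a b" if "unlinked N a b" for a b
    using that assms(2) sym by (auto simp: unlinked_def symp_def)
  define f where "f a = (LEAST i. i < length Cs \<and> a \<in> set (Cs ! i))" for a
  have diff: "{..<n} - set S = set (concat Cs)" using V by auto
  have f: "f a < length Cs \<and> a \<in> set (Cs ! f a)" if "a \<in> set (concat Cs)" for a
  proof -
    from that obtain C where "C \<in> set Cs" "a \<in> set C" by auto
    then have "\<exists>i. i < length Cs \<and> a \<in> set (Cs ! i)" by (metis in_set_conv_nth)
    then show ?thesis unfolding f_def by (rule LeastI_ex)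
  qed
  have "f a = f b" if "a \<in> {..<n} - set S" "b \<in> {..<n} - set S" "E a b" for a b
  proof (rule ccontr)
    assume "f a \<noteq> f b"
    then consider "f a < f b" | "f b < f a" by linarith
    then have "unlinked N a b \<or> unlinked N b a"
      using f[of a] f[of b] that(1,2) unfolding diff by cases (blast intro: separated_nth[OF S(4)])+
    then show False using nE that(3) sym by (auto simp: symp_def)
  qed
  moreover have "set S \<subseteq> {..<n}" "set S \<noteq> {}" using S(1) V(2) by auto
  ultimately have "card (f ` ({..<n} - set S)) \<le> card (set S)"
    using tough unfolding tough_on_def by blast
  moreover have "{..<length Cs} \<subseteq> f ` ({..<n} - set S)"
  proof
    fix i assume "i \<in> {..<length Cs}"
    then have i: "i < length Cs" by simp
    then obtain a where a: "a \<in> set (Cs ! i)"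
      using S(3) by (metis list.set_intros(1) neq_Nil_conv nth_mem)
    then have ac: "a \<in> set (concat Cs)" using nth_mem[OF i] by auto
    have "f a = i"
    proof (rule ccontr)
      assume "f a \<noteq> i"
      \<comment> \<open>The same part cannot be listed twice: it would be nonempty, and the
        concatenation has no repeated entries. So the index of the part containing \<open>a\<close>
        is unique.\<close>
      moreover have "distinct Cs"
        "\<And>C D. C \<in> set Cs \<Longrightarrow> D \<in> set Cs \<Longrightarrow> C \<noteq> D \<Longrightarrow> set C \<inter> set D = {}"
        using V(1) S(3) by (auto simp: distinct_concat_iff)
      ultimately show False
        using f[OF ac] a i nth_eq_iff_index_eq[of Cs "f a" i] nth_mem[of _ Cs] by blast
    qed
    then show "i \<in> f ` ({..<n} - set S)" using ac diff by blast
  qed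
  then have "length Cs \<le> card (f ` ({..<n} - set S))"
    using card_mono[of "f ` ({..<n} - set S)" "{..<length Cs}"] by simp
  ultimately show False using S(2) card_length[of S] by linarith
qed

text \<open>\<open>P\<close> and \<open>N\<close> are what the branch taken so far asserts about
  \<open>E\<close>; they vary in the induction because each node adds a pair to one of them. An
  accepted certificate is a refutation, which is why the conclusion is \<open>False\<close>.\<close>

lemma check_unsound:
  assumes "check n l P N t"
    and "\<And>a b. (a, b) \<in> set P \<Longrightarrow> E a b" "\<And>a b. (a, b) \<in> set N \<Longrightarrow> \<not> E a b"
  shows False
  using assms
proof (induction t arbitrary: P N)
  case (Case a b s t)
  show ?case
  proof (cases "E a b")
    case True
    show ?thesis by (rule Case.IH(1)[of "(a, b) # P" N]) (use Case.prems True in auto)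
  next
    case False
    show ?thesis by (rule Case.IH(2)[of P "(a, b) # N"]) (use Case.prems False in auto)
  qed
next
  case (Forb a b q t)
  let ?P = "(a, b) # P"
  have nE: "\<not> E a b"
  proof
    assume "E a b"
    \<comment> \<open>Under the tentative edge everything that counts as \<open>linked\<close> is a
      true edge, so \<open>q\<close> really is a Hamiltonian path.\<close>
    have link: "E c d" if "linked ?P c d" "c < n" "d < n" for c d
      using that path Forb.prems(2) \<open>E a b\<close> sym by (auto simp: linked_def symp_def)
    have chk: "enumerates n q" "successively (linked ?P) q"
      "\<exists>c \<in> set (drop l q). linked ?P (hd q) c"
      using Forb.prems(1) by (simp_all only: check.simps)
    have q: "distinct q" "set q = {..<n}" "length q = n"
      using enumerates_set[OF chk(1)] chk(1) by (simp_all add: enumerates_def)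
    have "successively E q"
      by (rule successively_mono[OF chk(2)]) (use q(2) link in blast)
    then have "hamilton_path E {..<n} q" using q by (simp add: hamilton_path_def)
    moreover obtain c where c: "c \<in> set (drop l q)" "linked ?P (hd q) c"
      using chk(3) by blast
    \<comment> \<open>Place \<open>i\<close> of \<open>drop l q\<close> is position
      \<open>l + i\<close> of \<open>q\<close>, to which \<open>maximal\<close> forbids a chord from
      the head.\<close>
    then obtain i where i: "i < n - l" "linked ?P (hd q) (drop l q ! i)"
      using q(3) by (auto simp: in_set_conv_nth[of c])
    moreover have "drop l q ! i = q ! (l + i)" using i(1) q(3) by (intro nth_drop) auto
    moreover have "hd q < n" "q ! (l + i) < n"
      using i(1) q(2,3) hd_in_set[of q] nth_mem[of "l + i" q] by force+
    ultimately show False using maximal[of q "l + i"] link[of "hd q" "q ! (l + i)"] i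
      by (auto simp: less_diff_conv add.commute)
  qed
  show ?case
    by (rule Forb.IH[of P "(a, b) # N"]) (use Forb.prems nE in auto)
next
  case (Deg v)
  let ?W = "filter (\<lambda>w. w \<noteq> v \<and> \<not> unlinked N v w) [0..<n]"
  have "{w. w < n \<and> w \<noteq> v \<and> E v w} \<subseteq> set ?W"
    using Deg.prems(3) sym by (auto simp: unlinked_def symp_def)
  then have "card {w. w < n \<and> w \<noteq> v \<and> E v w} \<le> card (set ?W)" by (intro card_mono) auto
  also have "\<dots> \<le> length ?W" by (rule card_length)
  finally show ?case using min_degree[of v] Deg.prems(1) by simp
next
  case (Cut S Cs)
  then show ?case using check_unsound_Cut by blast
qed

end

text \<open>Found by a computer search. Rows are indexed by \<open>n = 6, \<dots>, 12\<close>, entries of a row by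
  \<open>l = 5, \<dots>, n - 1\<close>.\<close>

definition certificates :: "certificate list list" where
  "certificates = [
   [
     Forb 3 5 [0,1,2,3,5,4] (Forb 0 5 [0,1,2,3,4,5] (Deg 5))],
   [
     Forb 2 6 [0,1,2,6,5,4,3] (Forb 1 6 [2,3,4,5,6,1,0] (Forb 0 6 [0,1,2,3,4,5,6] (Deg 6))),
     Forb 4 6 [0,1,2,3,4,6,5] (Forb 0 6 [0,1,2,3,4,5,6] (Case 2 6 (Forb 3 6 [0,1,2,6,3,4,5]
     (Forb 1 6 [0,1,6,2,3,4,5] (Deg 6))) (Deg 6)))],
   [
     Forb 3 7 [0,1,2,3,7,6,5,4] (Forb 2 7 [0,1,2,7,6,5,4,3] (Forb 1 7 [0,1,7,6,5,4,3,2] (Forb 0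
     7 [0,1,2,3,4,5,6,7] (Deg 7)))),
     Forb 4 7 [0,1,2,3,4,7,6,5] (Forb 3 7 [0,1,2,3,7,6,5,4] (Forb 1 7 [2,3,4,5,6,7,1,0] (Forb 0
     7 [0,1,2,3,4,5,6,7] (Deg 7)))),
     Forb 5 7 [0,1,2,3,4,5,7,6] (Forb 0 7 [0,1,2,3,4,5,6,7] (Case 2 7 (Forb 3 7
     [0,1,2,7,3,4,5,6] (Forb 1 7 [0,1,7,2,3,4,5,6] (Deg 7))) (Case 3 7 (Forb 4 7
     [0,1,2,3,7,4,5,6] (Forb 2 7 [0,1,2,7,3,4,5,6] (Deg 7))) (Deg 7))))],
   [
     Forb 3 8 [0,1,2,3,8,7,6,5,4] (Forb 3 7 [3,2,1,0,4,5,6,7,8] (Forb 3 6 [3,2,1,0,4,5,6,7,8]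
     (Forb 3 5 [3,2,1,0,4,5,6,7,8] (Forb 2 8 [0,1,2,8,7,6,5,4,3] (Forb 1 8 [0,1,8,7,6,5,4,3,2]
     (Forb 0 8 [0,1,2,3,4,5,6,7,8] (Forb 0 7 [0,1,2,3,4,5,6,7,8] (Forb 0 6 [0,1,2,3,4,5,6,7,8]
     (Forb 0 5 [0,1,2,3,4,5,6,7,8] (Case 0 3 (Forb 2 7 [2,1,0,3,4,5,6,7,8] (Forb 2 6
     [2,1,0,3,4,5,6,7,8] (Forb 2 5 [2,1,0,3,4,5,6,7,8] (Forb 1 7 [1,2,3,0,4,5,6,7,8] (Forb 1 6
     [1,2,3,0,4,5,6,7,8] (Forb 1 5 [1,2,3,0,4,5,6,7,8] (Cut [4] [[0,1,2,3],[5,6,7,8]])))))))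
     (Deg 0))))))))))),
     Forb 4 8 [0,1,2,3,4,8,7,6,5] (Forb 3 8 [0,1,2,3,8,7,6,5,4] (Forb 2 8 [0,1,2,8,7,6,5,4,3]
     (Forb 1 8 [2,3,4,5,6,7,8,1,0] (Forb 0 8 [0,1,2,3,4,5,6,7,8] (Deg 8))))),
     Forb 5 8 [0,1,2,3,4,5,8,7,6] (Forb 4 8 [0,1,2,3,4,8,7,6,5] (Forb 1 8 [2,3,4,5,6,7,8,1,0]
     (Forb 0 8 [0,1,2,3,4,5,6,7,8] (Forb 0 7 [0,1,2,3,4,5,6,7,8] (Case 2 8 (Forb 0 5
     [3,4,5,0,6,7,8,2,1] (Forb 0 4 [0,1,2,8,7,6,5,4,3] (Forb 0 3 [0,1,2,8,7,6,5,4,3] (Deg 0))))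
     (Deg 8)))))),
     Forb 6 8 [0,1,2,3,4,5,6,8,7] (Forb 0 8 [0,1,2,3,4,5,6,7,8] (Case 2 8 (Forb 3 8
     [0,1,2,8,3,4,5,6,7] (Forb 1 8 [0,1,8,2,3,4,5,6,7] (Forb 0 3 [0,1,2,8,7,6,5,4,3] (Case 4 8
     (Forb 3 6 [0,1,2,3,6,5,4,8,7] (Forb 3 5 [0,1,2,8,4,3,5,6,7] (Forb 1 3 [0,1,3,2,8,4,5,6,7]
     (Deg 3)))) (Deg 8))))) (Case 4 8 (Forb 5 8 [0,1,2,3,4,8,5,6,7] (Forb 3 8
     [0,1,2,3,8,4,5,6,7] (Deg 8))) (Case 1 8 (Forb 2 8 [0,1,8,2,3,4,5,6,7] (Forb 0 6
     [0,6,5,4,3,2,1,8,7] (Forb 0 2 [0,1,8,7,6,5,4,3,2] (Case 3 8 (Forb 4 8 [0,1,2,3,8,4,5,6,7]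
     (Forb 2 6 [0,1,2,6,5,4,3,8,7] (Forb 2 4 [0,1,8,3,2,4,5,6,7] (Forb 0 4 [0,1,2,3,8,7,6,5,4]
     (Case 4 6 (Forb 5 8 [0,1,2,3,4,6,5,8,7] (Deg 8)) (Cut [1,3,5,7] [[0],[2],[4],[6],[8]]))))))
     (Deg 8))))) (Deg 8)))))],
   [
     Forb 3 9 [0,1,2,3,9,8,7,6,5,4] (Forb 3 8 [3,2,1,0,4,5,6,7,8,9] (Forb 3 7
     [3,2,1,0,4,5,6,7,8,9] (Forb 3 6 [3,2,1,0,4,5,6,7,8,9] (Forb 3 5 [3,2,1,0,4,5,6,7,8,9] (Forb
     2 9 [0,1,2,9,8,7,6,5,4,3] (Forb 1 9 [0,1,9,8,7,6,5,4,3,2] (Forb 0 9 [0,1,2,3,4,5,6,7,8,9]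
     (Forb 0 8 [0,1,2,3,4,5,6,7,8,9] (Forb 0 7 [0,1,2,3,4,5,6,7,8,9] (Forb 0 6
     [0,1,2,3,4,5,6,7,8,9] (Forb 0 5 [0,1,2,3,4,5,6,7,8,9] (Case 0 3 (Forb 2 8
     [2,1,0,3,4,5,6,7,8,9] (Forb 2 7 [2,1,0,3,4,5,6,7,8,9] (Forb 2 6 [2,1,0,3,4,5,6,7,8,9] (Forb
     2 5 [2,1,0,3,4,5,6,7,8,9] (Forb 1 8 [1,2,3,0,4,5,6,7,8,9] (Forb 1 7 [1,2,3,0,4,5,6,7,8,9]
     (Forb 1 6 [1,2,3,0,4,5,6,7,8,9] (Forb 1 5 [1,2,3,0,4,5,6,7,8,9] (Cut [4]
     [[0,1,2,3],[5,6,7,8,9]]))))))))) (Deg 0))))))))))))),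
     Forb 4 9 [0,1,2,3,4,9,8,7,6,5] (Forb 4 8 [4,3,2,1,0,5,6,7,8,9] (Forb 4 7
     [4,3,2,1,0,5,6,7,8,9] (Forb 4 6 [4,3,2,1,0,5,6,7,8,9] (Forb 3 9 [0,1,2,3,9,8,7,6,5,4] (Forb
     2 9 [0,1,2,9,8,7,6,5,4,3] (Forb 1 9 [0,1,9,8,7,6,5,4,3,2] (Forb 0 9 [0,1,2,3,4,5,6,7,8,9]
     (Forb 0 8 [0,1,2,3,4,5,6,7,8,9] (Forb 0 7 [0,1,2,3,4,5,6,7,8,9] (Forb 0 6
     [0,1,2,3,4,5,6,7,8,9] (Case 5 9 (Forb 3 6 [0,1,2,3,6,7,8,9,5,4] (Forb 2 6
     [0,1,2,6,7,8,9,5,4,3] (Forb 1 6 [0,1,6,7,8,9,5,4,3,2] (Case 6 9 (Forb 3 8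
     [0,1,2,3,8,7,6,9,5,4] (Forb 3 7 [0,1,2,3,7,8,9,6,5,4] (Forb 2 8 [0,1,2,8,7,6,9,5,4,3] (Forb
     2 7 [0,1,2,7,8,9,6,5,4,3] (Forb 1 8 [0,1,8,7,6,9,5,4,3,2] (Forb 1 7 [0,1,7,8,9,6,5,4,3,2]
     (Cut [5] [[0,1,2,3,4],[6,7,8,9]]))))))) (Deg 6))))) (Deg 9)))))))))))),
     Forb 5 9 [0,1,2,3,4,5,9,8,7,6] (Forb 4 9 [0,1,2,3,4,9,8,7,6,5] (Forb 3 9
     [0,1,2,3,9,8,7,6,5,4] (Forb 2 9 [3,4,5,6,7,8,9,2,1,0] (Forb 1 9 [2,3,4,5,6,7,8,9,1,0] (Forb
     0 9 [0,1,2,3,4,5,6,7,8,9] (Deg 9)))))),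
     Forb 6 9 [0,1,2,3,4,5,6,9,8,7] (Forb 6 8 [6,5,4,3,2,1,0,7,8,9] (Forb 5 9
     [0,1,2,3,4,5,9,8,7,6] (Forb 1 9 [2,3,4,5,6,7,8,9,1,0] (Forb 0 9 [0,1,2,3,4,5,6,7,8,9] (Forb
     0 8 [0,1,2,3,4,5,6,7,8,9] (Case 3 9 (Forb 5 8 [2,1,0,7,6,5,8,9,3,4] (Forb 4 8
     [0,1,2,3,9,8,4,5,6,7] (Forb 2 8 [0,1,2,8,9,3,4,5,6,7] (Forb 1 8 [0,7,6,5,4,3,9,8,1,2] (Deg
     8))))) (Case 2 9 (Forb 3 9 [0,1,2,9,3,4,5,6,7,8] (Forb 3 8 [0,1,2,9,8,3,4,5,6,7] (Forb 1 3
     [2,9,8,7,6,5,4,3,1,0] (Forb 0 6 [3,4,5,6,0,7,8,9,2,1] (Forb 0 4 [0,1,2,9,8,7,6,5,4,3] (Forb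
     0 3 [0,1,2,9,8,7,6,5,4,3] (Case 0 5 (Forb 3 7 [0,1,2,9,8,7,3,4,5,6] (Forb 3 6
     [0,1,2,9,8,7,6,3,4,5] (Deg 3))) (Deg 0)))))))) (Deg 9)))))))),
     Forb 7 9 [0,1,2,3,4,5,6,7,9,8] (Forb 0 9 [0,1,2,3,4,5,6,7,8,9] (Case 2 9 (Forb 3 9
     [0,1,2,9,3,4,5,6,7,8] (Forb 1 9 [0,1,9,2,3,4,5,6,7,8] (Forb 1 7 [0,1,7,6,5,4,3,2,9,8] (Forb
     0 3 [0,1,2,9,8,7,6,5,4,3] (Case 5 9 (Forb 6 9 [0,1,2,3,4,5,9,6,7,8] (Forb 4 9
     [0,1,2,3,4,9,5,6,7,8] (Deg 9))) (Case 4 9 (Forb 5 9 [0,1,2,3,4,9,5,6,7,8] (Forb 3 7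
     [0,1,2,3,7,6,5,4,9,8] (Forb 3 5 [0,1,2,9,4,3,5,6,7,8] (Forb 1 3 [0,1,3,2,9,4,5,6,7,8] (Forb
     0 5 [0,1,2,3,4,9,8,7,6,5] (Case 3 6 (Forb 5 7 [0,1,2,3,6,7,5,4,9,8] (Forb 1 5
     [0,1,5,4,9,2,3,6,7,8] (Forb 0 7 [0,1,2,3,6,5,4,9,8,7] (Cut [2,4,6,8]
     [[0,1],[3],[5],[7],[9]])))) (Deg 3))))))) (Deg 9))))))) (Case 4 9 (Forb 5 9
     [0,1,2,3,4,9,5,6,7,8] (Forb 3 9 [0,1,2,3,9,4,5,6,7,8] (Forb 3 7 [0,1,2,3,7,6,5,4,9,8] (Forb
     0 5 [0,1,2,3,4,9,8,7,6,5] (Case 1 9 (Forb 2 9 [0,1,9,2,3,4,5,6,7,8] (Forb 2 5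
     [0,1,9,4,3,2,5,6,7,8] (Forb 0 7 [0,7,6,5,4,3,2,1,9,8] (Forb 0 3 [0,3,2,1,9,4,5,6,7,8] (Forb
     0 2 [0,1,9,8,7,6,5,4,3,2] (Case 0 6 (Forb 5 7 [0,1,2,3,4,9,8,7,5,6] (Forb 3 5
     [0,1,2,3,5,4,9,8,7,6] (Forb 2 7 [0,1,9,8,7,2,3,4,5,6] (Cut [1,4,6,8]
     [[0],[2,3],[5],[7],[9]])))) (Deg 0))))))) (Deg 9)))))) (Case 5 9 (Forb 6 9
     [0,1,2,3,4,5,9,6,7,8] (Forb 4 9 [0,1,2,3,4,9,5,6,7,8] (Forb 4 7 [0,1,2,3,4,7,6,5,9,8] (Forb
     0 6 [0,1,2,3,4,5,9,8,7,6] (Case 1 9 (Forb 2 9 [0,1,9,2,3,4,5,6,7,8] (Forb 2 6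
     [0,1,9,5,4,3,2,6,7,8] (Forb 0 7 [0,7,6,5,4,3,2,1,9,8] (Forb 0 4 [0,4,3,2,1,9,5,6,7,8] (Forb
     0 2 [0,1,9,8,7,6,5,4,3,2] (Case 0 3 (Forb 4 6 [0,3,2,1,9,5,4,6,7,8] (Forb 2 7
     [0,3,4,5,6,7,2,1,9,8] (Forb 2 4 [0,1,9,8,7,6,5,4,2,3] (Cut [1,3,5,8]
     [[0],[2],[4],[6,7],[9]])))) (Deg 0))))))) (Deg 9)))))) (Case 1 9 (Forb 2 9
     [0,1,9,2,3,4,5,6,7,8] (Forb 0 7 [0,7,6,5,4,3,2,1,9,8] (Forb 0 2 [0,1,9,8,7,6,5,4,3,2] (Case
     3 9 (Forb 4 9 [0,1,2,3,9,4,5,6,7,8] (Forb 2 7 [0,1,2,7,6,5,4,3,9,8] (Forb 2 4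
     [0,1,9,3,2,4,5,6,7,8] (Forb 0 4 [0,1,2,3,9,8,7,6,5,4] (Case 6 9 (Forb 5 9
     [0,1,2,3,4,5,9,6,7,8] (Forb 5 7 [0,1,2,3,4,5,7,6,9,8] (Forb 4 7 [0,1,2,3,9,6,5,4,7,8] (Forb
     2 5 [0,1,2,5,4,3,9,6,7,8] (Forb 0 5 [0,5,4,3,2,1,9,6,7,8] (Cut [1,3,6,8]
     [[0],[2],[4,5],[7],[9]])))))) (Deg 9)))))) (Deg 9))))) (Deg 9))))))],
   [
     Forb 3 10 [0,1,2,3,10,9,8,7,6,5,4] (Forb 3 9 [3,2,1,0,4,5,6,7,8,9,10] (Forb 3 8
     [3,2,1,0,4,5,6,7,8,9,10] (Forb 3 7 [3,2,1,0,4,5,6,7,8,9,10] (Forb 3 6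
     [3,2,1,0,4,5,6,7,8,9,10] (Forb 3 5 [3,2,1,0,4,5,6,7,8,9,10] (Forb 2 10
     [0,1,2,10,9,8,7,6,5,4,3] (Forb 1 10 [0,1,10,9,8,7,6,5,4,3,2] (Forb 0 10
     [0,1,2,3,4,5,6,7,8,9,10] (Forb 0 9 [0,1,2,3,4,5,6,7,8,9,10] (Forb 0 8
     [0,1,2,3,4,5,6,7,8,9,10] (Forb 0 7 [0,1,2,3,4,5,6,7,8,9,10] (Forb 0 6
     [0,1,2,3,4,5,6,7,8,9,10] (Forb 0 5 [0,1,2,3,4,5,6,7,8,9,10] (Case 0 3 (Forb 2 9
     [2,1,0,3,4,5,6,7,8,9,10] (Forb 2 8 [2,1,0,3,4,5,6,7,8,9,10] (Forb 2 7
     [2,1,0,3,4,5,6,7,8,9,10] (Forb 2 6 [2,1,0,3,4,5,6,7,8,9,10] (Forb 2 5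
     [2,1,0,3,4,5,6,7,8,9,10] (Forb 1 9 [1,2,3,0,4,5,6,7,8,9,10] (Forb 1 8
     [1,2,3,0,4,5,6,7,8,9,10] (Forb 1 7 [1,2,3,0,4,5,6,7,8,9,10] (Forb 1 6
     [1,2,3,0,4,5,6,7,8,9,10] (Forb 1 5 [1,2,3,0,4,5,6,7,8,9,10] (Cut [4]
     [[0,1,2,3],[5,6,7,8,9,10]]))))))))))) (Deg 0))))))))))))))),
     Forb 4 10 [0,1,2,3,4,10,9,8,7,6,5] (Forb 4 9 [4,3,2,1,0,5,6,7,8,9,10] (Forb 4 8
     [4,3,2,1,0,5,6,7,8,9,10] (Forb 4 7 [4,3,2,1,0,5,6,7,8,9,10] (Forb 4 6
     [4,3,2,1,0,5,6,7,8,9,10] (Forb 3 10 [0,1,2,3,10,9,8,7,6,5,4] (Forb 2 10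
     [0,1,2,10,9,8,7,6,5,4,3] (Forb 1 10 [0,1,10,9,8,7,6,5,4,3,2] (Forb 0 10
     [0,1,2,3,4,5,6,7,8,9,10] (Forb 0 9 [0,1,2,3,4,5,6,7,8,9,10] (Forb 0 8
     [0,1,2,3,4,5,6,7,8,9,10] (Forb 0 7 [0,1,2,3,4,5,6,7,8,9,10] (Forb 0 6
     [0,1,2,3,4,5,6,7,8,9,10] (Case 0 4 (Forb 3 9 [3,2,1,0,4,5,6,7,8,9,10] (Forb 3 8
     [3,2,1,0,4,5,6,7,8,9,10] (Forb 3 7 [3,2,1,0,4,5,6,7,8,9,10] (Forb 3 6
     [3,2,1,0,4,5,6,7,8,9,10] (Forb 1 9 [1,2,3,4,0,5,6,7,8,9,10] (Forb 1 8
     [1,2,3,4,0,5,6,7,8,9,10] (Forb 1 7 [1,2,3,4,0,5,6,7,8,9,10] (Forb 1 6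
     [1,2,3,4,0,5,6,7,8,9,10] (Case 0 3 (Forb 2 9 [2,1,0,3,4,5,6,7,8,9,10] (Forb 2 8
     [2,1,0,3,4,5,6,7,8,9,10] (Forb 2 7 [2,1,0,3,4,5,6,7,8,9,10] (Forb 2 6
     [2,1,0,3,4,5,6,7,8,9,10] (Cut [5] [[0,1,2,3,4],[6,7,8,9,10]]))))) (Case 1 3 (Forb 2 9
     [2,1,3,4,0,5,6,7,8,9,10] (Forb 2 8 [2,1,3,4,0,5,6,7,8,9,10] (Forb 2 7
     [2,1,3,4,0,5,6,7,8,9,10] (Forb 2 6 [2,1,3,4,0,5,6,7,8,9,10] (Cut [5]
     [[0,1,2,3,4],[6,7,8,9,10]]))))) (Deg 3))))))))))) (Case 0 2 (Forb 1 9
     [1,0,2,3,4,5,6,7,8,9,10] (Forb 1 8 [1,0,2,3,4,5,6,7,8,9,10] (Forb 1 7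
     [1,0,2,3,4,5,6,7,8,9,10] (Forb 1 6 [1,0,2,3,4,5,6,7,8,9,10] (Case 1 4 (Forb 3 9
     [3,2,0,1,4,5,6,7,8,9,10] (Forb 3 8 [3,2,0,1,4,5,6,7,8,9,10] (Forb 3 7
     [3,2,0,1,4,5,6,7,8,9,10] (Forb 3 6 [3,2,0,1,4,5,6,7,8,9,10] (Forb 2 9
     [2,3,4,1,0,5,6,7,8,9,10] (Forb 2 8 [2,3,4,1,0,5,6,7,8,9,10] (Forb 2 7
     [2,3,4,1,0,5,6,7,8,9,10] (Forb 2 6 [2,3,4,1,0,5,6,7,8,9,10] (Cut [5]
     [[0,1,2,3,4],[6,7,8,9,10]]))))))))) (Deg 4)))))) (Deg 0))))))))))))))),
     Forb 5 10 [0,1,2,3,4,5,10,9,8,7,6] (Forb 5 9 [5,4,3,2,1,0,6,7,8,9,10] (Forb 5 8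
     [5,4,3,2,1,0,6,7,8,9,10] (Forb 5 7 [5,4,3,2,1,0,6,7,8,9,10] (Forb 4 10
     [0,1,2,3,4,10,9,8,7,6,5] (Forb 3 10 [0,1,2,3,10,9,8,7,6,5,4] (Forb 2 10
     [0,1,2,10,9,8,7,6,5,4,3] (Forb 1 10 [2,3,4,5,6,7,8,9,10,1,0] (Forb 0 10
     [0,1,2,3,4,5,6,7,8,9,10] (Forb 0 9 [0,1,2,3,4,5,6,7,8,9,10] (Forb 0 8
     [0,1,2,3,4,5,6,7,8,9,10] (Forb 0 7 [0,1,2,3,4,5,6,7,8,9,10] (Case 6 10 (Forb 4 7
     [0,1,2,3,4,7,8,9,10,6,5] (Forb 3 7 [0,1,2,3,7,8,9,10,6,5,4] (Forb 2 7
     [0,1,2,7,8,9,10,6,5,4,3] (Forb 1 7 [2,3,4,5,6,10,9,8,7,1,0] (Case 7 10 (Forb 4 9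
     [0,1,2,3,4,9,8,7,10,6,5] (Forb 4 8 [0,1,2,3,4,8,9,10,7,6,5] (Forb 3 9
     [0,1,2,3,9,8,7,10,6,5,4] (Forb 3 8 [0,1,2,3,8,9,10,7,6,5,4] (Forb 2 9
     [0,1,2,9,8,7,10,6,5,4,3] (Forb 2 8 [0,1,2,8,9,10,7,6,5,4,3] (Forb 1 9
     [2,3,4,5,6,10,7,8,9,1,0] (Forb 1 8 [2,3,4,5,6,7,10,9,8,1,0] (Cut [6]
     [[0,1,2,3,4,5],[7,8,9,10]]))))))))) (Deg 7)))))) (Deg 10))))))))))))),
     Forb 6 10 [0,1,2,3,4,5,6,10,9,8,7] (Forb 6 9 [6,5,4,3,2,1,0,7,8,9,10] (Forb 6 8
     [6,5,4,3,2,1,0,7,8,9,10] (Forb 5 10 [0,1,2,3,4,5,10,9,8,7,6] (Forb 4 10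
     [0,1,2,3,4,10,9,8,7,6,5] (Forb 2 10 [3,4,5,6,7,8,9,10,2,1,0] (Forb 1 10
     [2,3,4,5,6,7,8,9,10,1,0] (Forb 0 10 [0,1,2,3,4,5,6,7,8,9,10] (Forb 0 9
     [0,1,2,3,4,5,6,7,8,9,10] (Forb 0 8 [0,1,2,3,4,5,6,7,8,9,10] (Case 3 10 (Forb 5 8
     [2,1,0,7,6,5,8,9,10,3,4] (Forb 4 9 [0,1,2,3,10,9,4,5,6,7,8] (Forb 4 8
     [0,1,2,3,10,9,8,4,5,6,7] (Forb 2 9 [0,1,2,9,10,3,4,5,6,7,8] (Forb 2 8
     [0,1,2,8,9,10,3,4,5,6,7] (Forb 2 6 [0,1,2,6,5,4,3,10,9,8,7] (Forb 2 5
     [0,1,2,5,4,3,10,9,8,7,6] (Forb 2 4 [0,1,2,4,3,10,9,8,7,6,5] (Forb 1 8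
     [0,7,6,5,4,3,10,9,8,1,2] (Forb 1 6 [0,7,8,9,10,3,4,5,6,1,2] (Forb 1 4
     [2,3,10,9,8,7,6,5,4,1,0] (Forb 0 6 [0,1,2,3,10,9,8,7,6,5,4] (Forb 0 5
     [0,1,2,3,10,9,8,7,6,5,4] (Forb 0 4 [0,1,2,3,10,9,8,7,6,5,4] (Case 0 2 (Forb 1 9
     [0,2,1,9,10,3,4,5,6,7,8] (Forb 1 5 [0,2,1,5,4,3,10,9,8,7,6] (Case 4 6 (Forb 5 9
     [0,1,2,3,10,9,5,4,6,7,8] (Cut [3,7] [[0,1,2],[4,5,6],[8,9,10]])) (Deg 4)))) (Deg
     0)))))))))))))))) (Deg 10))))))))))),
     Forb 7 10 [0,1,2,3,4,5,6,7,10,9,8] (Forb 7 9 [7,6,5,4,3,2,1,0,8,9,10] (Forb 6 10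
     [0,1,2,3,4,5,6,10,9,8,7] (Forb 1 10 [2,3,4,5,6,7,8,9,10,1,0] (Forb 0 10
     [0,1,2,3,4,5,6,7,8,9,10] (Forb 0 9 [0,1,2,3,4,5,6,7,8,9,10] (Case 3 10 (Forb 4 10
     [0,1,2,3,10,4,5,6,7,8,9] (Forb 4 9 [0,1,2,3,10,9,4,5,6,7,8] (Forb 2 10
     [0,1,2,10,3,4,5,6,7,8,9] (Forb 1 4 [2,3,10,9,8,7,6,5,4,1,0] (Forb 0 4
     [0,1,2,3,10,9,8,7,6,5,4] (Case 5 10 (Forb 4 7 [0,1,2,3,4,7,6,5,10,9,8] (Forb 4 6
     [0,1,2,3,4,6,5,10,9,8,7] (Forb 2 4 [0,1,2,4,3,10,5,6,7,8,9] (Deg 4)))) (Deg 10))))))) (Case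
     4 10 (Forb 6 9 [3,2,1,0,8,7,6,9,10,4,5] (Forb 5 9 [0,1,2,3,4,10,9,5,6,7,8] (Forb 3 10
     [0,1,2,3,10,4,5,6,7,8,9] (Forb 3 9 [0,1,2,3,9,10,4,5,6,7,8] (Forb 3 7
     [0,1,2,3,7,6,5,4,10,9,8] (Forb 3 6 [0,1,2,3,6,5,4,10,9,8,7] (Forb 2 9
     [1,0,8,7,6,5,4,10,9,2,3] (Case 1 9 (Forb 3 8 [2,3,8,7,6,5,4,10,9,1,0] (Forb 3 5
     [0,8,7,6,5,3,4,10,9,1,2] (Forb 0 3 [0,3,2,1,9,10,4,5,6,7,8] (Deg 3)))) (Deg 9)))))))))
     (Case 2 10 (Forb 4 9 [1,0,8,7,6,5,4,9,10,2,3] (Forb 3 10 [0,1,2,10,3,4,5,6,7,8,9] (Forb 3 9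
     [0,1,2,10,9,3,4,5,6,7,8] (Forb 1 9 [0,1,9,10,2,3,4,5,6,7,8] (Forb 1 7
     [0,1,7,6,5,4,3,2,10,9,8] (Forb 1 6 [0,1,6,5,4,3,2,10,9,8,7] (Forb 1 3
     [2,10,9,8,7,6,5,4,3,1,0] (Forb 0 7 [3,4,5,6,7,0,8,9,10,2,1] (Forb 0 4
     [0,1,2,10,9,8,7,6,5,4,3] (Forb 0 3 [0,1,2,10,9,8,7,6,5,4,3] (Case 5 10 (Forb 6 9
     [0,1,2,3,4,5,10,9,6,7,8] (Forb 4 10 [0,1,2,3,4,10,5,6,7,8,9] (Forb 4 7
     [0,1,2,3,4,7,6,5,10,9,8] (Forb 4 6 [0,1,2,3,4,6,5,10,9,8,7] (Forb 3 7
     [2,1,0,8,9,10,5,6,7,3,4] (Forb 3 6 [0,1,2,10,5,4,3,6,7,8,9] (Forb 1 4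
     [0,1,4,3,2,10,5,6,7,8,9] (Forb 0 6 [0,1,2,3,4,5,10,9,8,7,6] (Cut [2,5,8]
     [[0,1],[3,4],[6,7],[9,10]]))))))))) (Deg 10)))))))))))) (Deg 10))))))))),
     Forb 8 10 [0,1,2,3,4,5,6,7,8,10,9] (Forb 0 10 [0,1,2,3,4,5,6,7,8,9,10] (Case 2 10 (Forb 3
     10 [0,1,2,10,3,4,5,6,7,8,9] (Forb 1 10 [0,1,10,2,3,4,5,6,7,8,9] (Forb 1 8
     [0,1,8,7,6,5,4,3,2,10,9] (Forb 0 3 [0,1,2,10,9,8,7,6,5,4,3] (Case 4 10 (Forb 5 10
     [0,1,2,3,4,10,5,6,7,8,9] (Forb 3 8 [0,1,2,3,8,7,6,5,4,10,9] (Forb 3 5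
     [0,1,2,10,4,3,5,6,7,8,9] (Forb 1 3 [0,1,3,2,10,4,5,6,7,8,9] (Forb 0 5
     [0,1,2,3,4,10,9,8,7,6,5] (Case 3 7 (Forb 6 10 [0,1,2,10,6,5,4,3,7,8,9] (Forb 6 8
     [0,1,2,3,7,8,6,5,4,10,9] (Forb 5 8 [0,1,2,10,4,3,7,6,5,8,9] (Forb 3 6
     [0,1,2,10,4,5,6,3,7,8,9] (Forb 1 6 [0,1,6,5,4,10,2,3,7,8,9] (Forb 0 8
     [0,1,2,3,7,6,5,4,10,9,8] (Forb 0 6 [0,1,2,3,7,8,9,10,4,5,6] (Case 1 5 (Forb 0 4
     [0,1,5,6,7,8,9,10,2,3,4] (Forb 0 2 [0,1,5,6,7,8,9,10,4,3,2] (Deg 0))) (Cut [2,4,7,9]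
     [[0,1],[3],[5,6],[8],[10]]))))))))) (Case 3 6 (Forb 7 10 [0,1,2,3,6,5,4,10,7,8,9] (Forb 5 8
     [0,1,2,3,6,7,8,5,4,10,9] (Forb 5 7 [0,1,2,10,4,3,6,5,7,8,9] (Forb 3 7
     [0,1,2,10,4,5,6,3,7,8,9] (Forb 1 5 [0,1,5,4,10,2,3,6,7,8,9] (Forb 0 7
     [0,1,2,3,6,5,4,10,9,8,7] (Case 0 8 (Forb 3 9 [0,1,2,3,9,10,4,5,6,7,8] (Deg 3)) (Case 1 7
     (Forb 0 8 [0,1,7,6,5,4,3,2,10,9,8] (Forb 0 6 [0,1,7,8,9,10,2,3,4,5,6] (Forb 0 4
     [0,1,7,8,9,10,2,3,6,5,4] (Forb 0 2 [0,1,7,8,9,10,4,5,6,3,2] (Deg 0))))) (Cut [2,4,6,9]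
     [[0,1],[3],[5],[7,8],[10]]))))))))) (Deg 3)))))))) (Case 6 10 (Forb 7 10
     [0,1,2,3,4,5,6,10,7,8,9] (Forb 5 10 [0,1,2,3,4,5,10,6,7,8,9] (Deg 10))) (Case 5 10 (Forb 6
     10 [0,1,2,3,4,5,10,6,7,8,9] (Forb 4 10 [0,1,2,3,4,10,5,6,7,8,9] (Forb 4 8
     [0,1,2,3,4,8,7,6,5,10,9] (Forb 3 6 [0,1,2,10,5,4,3,6,7,8,9] (Forb 1 4
     [0,1,4,3,2,10,5,6,7,8,9] (Forb 0 6 [0,1,2,3,4,5,10,9,8,7,6] (Case 7 10 (Forb 6 8
     [0,1,2,3,4,5,6,8,7,10,9] (Forb 4 6 [0,1,2,3,4,6,5,10,7,8,9] (Forb 3 8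
     [0,1,2,10,7,6,5,4,3,8,9] (Forb 1 6 [0,1,6,5,4,3,2,10,7,8,9] (Forb 0 8
     [0,1,2,3,4,5,6,7,10,9,8] (Case 0 4 (Forb 1 9 [0,1,9,8,7,6,5,10,2,3,4] (Forb 1 5
     [0,1,5,6,7,8,9,10,2,3,4] (Forb 1 3 [0,1,3,2,10,9,8,7,6,5,4] (Deg 1)))) (Case 1 3 (Forb 2 6
     [0,1,3,4,5,6,2,10,7,8,9] (Deg 6)) (Cut [2,5,7,9] [[0,1],[3,4],[6],[8],[10]])))))))) (Deg
     10)))))))) (Deg 10)))))))) (Case 4 10 (Forb 5 10 [0,1,2,3,4,10,5,6,7,8,9] (Forb 3 10
     [0,1,2,3,10,4,5,6,7,8,9] (Forb 3 8 [0,1,2,3,8,7,6,5,4,10,9] (Forb 0 5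
     [0,1,2,3,4,10,9,8,7,6,5] (Case 6 10 (Forb 7 10 [0,1,2,3,4,5,6,10,7,8,9] (Forb 5 8
     [0,1,2,3,4,5,8,7,6,10,9] (Forb 5 7 [0,1,2,3,4,10,6,5,7,8,9] (Forb 3 5
     [0,1,2,3,5,4,10,6,7,8,9] (Forb 0 7 [0,1,2,3,4,5,6,10,9,8,7] (Case 1 10 (Forb 2 10
     [0,1,10,2,3,4,5,6,7,8,9] (Forb 2 7 [0,1,10,6,5,4,3,2,7,8,9] (Forb 2 5
     [0,1,10,4,3,2,5,6,7,8,9] (Forb 0 8 [0,8,7,6,5,4,3,2,1,10,9] (Forb 0 3
     [0,3,2,1,10,4,5,6,7,8,9] (Forb 0 2 [0,1,10,9,8,7,6,5,4,3,2] (Case 0 4 (Forb 3 7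
     [0,1,2,3,7,8,9,10,6,5,4] (Case 2 8 (Forb 3 9 [0,1,10,4,5,6,7,8,2,3,9] (Forb 1 3
     [0,1,3,2,8,7,6,5,4,10,9] (Deg 3))) (Cut [1,4,6,9] [[0],[2,3],[5],[7,8],[10]]))) (Deg
     0)))))))) (Deg 10))))))) (Case 1 10 (Forb 2 10 [0,1,10,2,3,4,5,6,7,8,9] (Forb 2 5
     [0,1,10,4,3,2,5,6,7,8,9] (Forb 0 8 [0,8,7,6,5,4,3,2,1,10,9] (Forb 0 3
     [0,3,2,1,10,4,5,6,7,8,9] (Forb 0 2 [0,1,10,9,8,7,6,5,4,3,2] (Case 7 10 (Forb 6 10
     [0,1,2,3,4,5,6,10,7,8,9] (Forb 6 8 [0,1,2,3,4,5,6,8,7,10,9] (Forb 5 8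
     [0,1,2,3,4,10,7,6,5,8,9] (Forb 3 6 [0,1,2,3,6,5,4,10,7,8,9] (Forb 2 8
     [0,1,10,7,6,5,4,3,2,8,9] (Forb 0 6 [0,6,5,4,3,2,1,10,7,8,9] (Case 0 4 (Forb 3 5
     [0,1,2,3,5,6,7,8,9,10,4] (Case 2 6 (Forb 3 9 [0,1,10,7,8,9,3,2,6,5,4] (Forb 3 7
     [0,1,10,4,5,6,2,3,7,8,9] (Forb 1 3 [0,1,3,2,6,5,4,10,7,8,9] (Deg 3)))) (Cut [1,4,7,9]
     [[0],[2,3],[5,6],[8],[10]]))) (Deg 0)))))))) (Deg 10))))))) (Deg 10))))))) (Case 6 10 (Forb
     7 10 [0,1,2,3,4,5,6,10,7,8,9] (Forb 5 10 [0,1,2,3,4,5,10,6,7,8,9] (Forb 5 8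
     [0,1,2,3,4,5,8,7,6,10,9] (Forb 0 7 [0,1,2,3,4,5,6,10,9,8,7] (Case 1 10 (Forb 2 10
     [0,1,10,2,3,4,5,6,7,8,9] (Forb 2 7 [0,1,10,6,5,4,3,2,7,8,9] (Forb 0 8
     [0,8,7,6,5,4,3,2,1,10,9] (Forb 0 5 [0,5,4,3,2,1,10,6,7,8,9] (Forb 0 2
     [0,1,10,9,8,7,6,5,4,3,2] (Case 3 10 (Forb 4 10 [0,1,2,3,10,4,5,6,7,8,9] (Forb 4 7
     [0,1,2,3,10,6,5,4,7,8,9] (Forb 2 8 [0,1,2,8,7,6,5,4,3,10,9] (Forb 2 5
     [0,1,2,5,4,3,10,6,7,8,9] (Forb 2 4 [0,1,10,3,2,4,5,6,7,8,9] (Forb 0 4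
     [0,1,2,3,10,9,8,7,6,5,4] (Case 0 6 (Forb 5 7 [0,1,2,3,4,5,7,8,9,10,6] (Case 4 8 (Forb 5 9
     [0,1,2,3,10,6,7,8,4,5,9] (Forb 3 5 [0,1,2,3,5,4,8,7,6,10,9] (Forb 1 5
     [0,6,7,8,4,5,1,2,3,10,9] (Deg 5)))) (Cut [1,3,6,9] [[0],[2],[4,5],[7,8],[10]]))) (Deg
     0)))))))) (Deg 10))))))) (Deg 10)))))) (Case 1 10 (Forb 2 10 [0,1,10,2,3,4,5,6,7,8,9] (Forb
     0 8 [0,8,7,6,5,4,3,2,1,10,9] (Forb 0 2 [0,1,10,9,8,7,6,5,4,3,2] (Case 5 10 (Forb 6 10
     [0,1,2,3,4,5,10,6,7,8,9] (Forb 4 10 [0,1,2,3,4,10,5,6,7,8,9] (Forb 4 8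
     [0,1,2,3,4,8,7,6,5,10,9] (Forb 2 6 [0,1,10,5,4,3,2,6,7,8,9] (Forb 0 6
     [0,1,2,3,4,5,10,9,8,7,6] (Forb 0 4 [0,4,3,2,1,10,5,6,7,8,9] (Case 0 3 (Forb 4 6
     [0,3,2,1,10,5,4,6,7,8,9] (Forb 2 8 [0,3,4,5,6,7,8,2,1,10,9] (Forb 2 4
     [0,1,10,9,8,7,6,5,4,2,3] (Case 6 8 (Forb 7 10 [0,1,2,3,4,5,6,8,7,10,9] (Forb 4 7
     [0,1,2,3,4,7,8,6,5,10,9] (Forb 2 7 [0,1,2,7,6,8,9,10,5,4,3] (Forb 0 7
     [0,1,2,3,4,5,10,9,8,6,7] (Cut [1,3,5,9] [[0],[2],[4],[6,7,8],[10]]))))) (Cut [1,3,5,7,9]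
     [[0],[2],[4],[6],[8],[10]]))))) (Case 0 7 (Forb 6 8 [0,1,2,3,4,5,10,9,8,6,7] (Forb 4 6
     [0,1,2,3,4,6,5,10,9,8,7] (Forb 2 8 [0,1,10,9,8,2,3,4,5,6,7] (Case 2 4 (Forb 3 10
     [0,1,2,4,3,10,5,6,7,8,9] (Forb 3 8 [0,1,2,4,3,8,7,6,5,10,9] (Forb 3 6
     [0,1,2,4,3,6,5,10,9,8,7] (Forb 0 3 [0,1,10,9,8,7,6,5,4,2,3] (Cut [1,5,7,9]
     [[0],[2,3,4],[6],[8],[10]]))))) (Cut [1,3,5,7,9] [[0],[2],[4],[6],[8],[10]]))))) (Deg
     0))))))))) (Case 3 10 (Forb 4 10 [0,1,2,3,10,4,5,6,7,8,9] (Forb 2 8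
     [0,1,2,8,7,6,5,4,3,10,9] (Forb 2 4 [0,1,10,3,2,4,5,6,7,8,9] (Forb 0 4
     [0,1,2,3,10,9,8,7,6,5,4] (Case 7 10 (Forb 6 10 [0,1,2,3,4,5,6,10,7,8,9] (Forb 6 8
     [0,1,2,3,4,5,6,8,7,10,9] (Forb 4 8 [0,1,2,3,10,7,6,5,4,8,9] (Forb 2 6
     [0,1,2,6,5,4,3,10,7,8,9] (Forb 0 6 [0,6,5,4,3,2,1,10,7,8,9] (Case 4 6 (Forb 5 10
     [0,1,2,3,4,6,5,10,7,8,9] (Forb 5 8 [0,1,2,3,4,6,5,8,7,10,9] (Forb 2 5
     [0,1,2,5,6,4,3,10,7,8,9] (Forb 0 5 [0,1,2,3,10,9,8,7,6,4,5] (Cut [1,3,7,9]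
     [[0],[2],[4,5,6],[8],[10]]))))) (Cut [1,3,5,7,9] [[0],[2],[4],[6],[8],[10]]))))))) (Deg
     10)))))) (Deg 10)))))) (Case 3 10 (Forb 4 10 [0,1,2,3,10,4,5,6,7,8,9] (Forb 2 10
     [0,1,2,10,3,4,5,6,7,8,9] (Forb 2 8 [0,1,2,8,7,6,5,4,3,10,9] (Forb 0 4
     [0,1,2,3,10,9,8,7,6,5,4] (Case 5 10 (Forb 6 10 [0,1,2,3,4,5,10,6,7,8,9] (Forb 4 8
     [0,1,2,3,4,8,7,6,5,10,9] (Forb 4 6 [0,1,2,3,10,5,4,6,7,8,9] (Forb 2 4
     [0,1,2,4,3,10,5,6,7,8,9] (Forb 0 6 [0,1,2,3,4,5,10,9,8,7,6] (Case 7 10 (Forb 6 8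
     [0,1,2,3,4,5,6,8,7,10,9] (Forb 2 6 [0,1,2,6,5,4,3,10,7,8,9] (Forb 0 8
     [0,1,2,3,4,5,6,7,10,9,8] (Case 0 2 (Forb 1 10 [0,1,10,9,8,7,6,5,4,3,2] (Forb 1 8
     [0,1,8,9,10,7,6,5,4,3,2] (Forb 1 6 [0,1,6,7,8,9,10,5,4,3,2] (Forb 1 4
     [0,1,4,5,6,7,8,9,10,3,2] (Cut [3,5,7,9] [[0,1,2],[4],[6],[8],[10]]))))) (Cut [1,3,5,7,9]
     [[0],[2],[4],[6],[8],[10]]))))) (Deg 10))))))) (Deg 10)))))) (Deg 10)))))))],
   [
     Forb 3 11 [0,1,2,3,11,10,9,8,7,6,5,4] (Forb 3 10 [3,2,1,0,4,5,6,7,8,9,10,11] (Forb 3 9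
     [3,2,1,0,4,5,6,7,8,9,10,11] (Forb 3 8 [3,2,1,0,4,5,6,7,8,9,10,11] (Forb 3 7
     [3,2,1,0,4,5,6,7,8,9,10,11] (Forb 3 6 [3,2,1,0,4,5,6,7,8,9,10,11] (Forb 3 5
     [3,2,1,0,4,5,6,7,8,9,10,11] (Forb 2 11 [0,1,2,11,10,9,8,7,6,5,4,3] (Forb 1 11
     [0,1,11,10,9,8,7,6,5,4,3,2] (Forb 0 11 [0,1,2,3,4,5,6,7,8,9,10,11] (Forb 0 10
     [0,1,2,3,4,5,6,7,8,9,10,11] (Forb 0 9 [0,1,2,3,4,5,6,7,8,9,10,11] (Forb 0 8
     [0,1,2,3,4,5,6,7,8,9,10,11] (Forb 0 7 [0,1,2,3,4,5,6,7,8,9,10,11] (Forb 0 6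
     [0,1,2,3,4,5,6,7,8,9,10,11] (Forb 0 5 [0,1,2,3,4,5,6,7,8,9,10,11] (Case 0 3 (Forb 2 10
     [2,1,0,3,4,5,6,7,8,9,10,11] (Forb 2 9 [2,1,0,3,4,5,6,7,8,9,10,11] (Forb 2 8
     [2,1,0,3,4,5,6,7,8,9,10,11] (Forb 2 7 [2,1,0,3,4,5,6,7,8,9,10,11] (Forb 2 6
     [2,1,0,3,4,5,6,7,8,9,10,11] (Forb 2 5 [2,1,0,3,4,5,6,7,8,9,10,11] (Forb 1 10
     [1,2,3,0,4,5,6,7,8,9,10,11] (Forb 1 9 [1,2,3,0,4,5,6,7,8,9,10,11] (Forb 1 8
     [1,2,3,0,4,5,6,7,8,9,10,11] (Forb 1 7 [1,2,3,0,4,5,6,7,8,9,10,11] (Forb 1 6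
     [1,2,3,0,4,5,6,7,8,9,10,11] (Forb 1 5 [1,2,3,0,4,5,6,7,8,9,10,11] (Cut [4]
     [[0,1,2,3],[5,6,7,8,9,10,11]]))))))))))))) (Deg 0))))))))))))))))),
     Forb 4 11 [0,1,2,3,4,11,10,9,8,7,6,5] (Forb 4 10 [4,3,2,1,0,5,6,7,8,9,10,11] (Forb 4 9
     [4,3,2,1,0,5,6,7,8,9,10,11] (Forb 4 8 [4,3,2,1,0,5,6,7,8,9,10,11] (Forb 4 7
     [4,3,2,1,0,5,6,7,8,9,10,11] (Forb 4 6 [4,3,2,1,0,5,6,7,8,9,10,11] (Forb 3 11
     [0,1,2,3,11,10,9,8,7,6,5,4] (Forb 2 11 [0,1,2,11,10,9,8,7,6,5,4,3] (Forb 1 11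
     [0,1,11,10,9,8,7,6,5,4,3,2] (Forb 0 11 [0,1,2,3,4,5,6,7,8,9,10,11] (Forb 0 10
     [0,1,2,3,4,5,6,7,8,9,10,11] (Forb 0 9 [0,1,2,3,4,5,6,7,8,9,10,11] (Forb 0 8
     [0,1,2,3,4,5,6,7,8,9,10,11] (Forb 0 7 [0,1,2,3,4,5,6,7,8,9,10,11] (Forb 0 6
     [0,1,2,3,4,5,6,7,8,9,10,11] (Case 0 4 (Forb 3 10 [3,2,1,0,4,5,6,7,8,9,10,11] (Forb 3 9
     [3,2,1,0,4,5,6,7,8,9,10,11] (Forb 3 8 [3,2,1,0,4,5,6,7,8,9,10,11] (Forb 3 7
     [3,2,1,0,4,5,6,7,8,9,10,11] (Forb 3 6 [3,2,1,0,4,5,6,7,8,9,10,11] (Forb 1 10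
     [1,2,3,4,0,5,6,7,8,9,10,11] (Forb 1 9 [1,2,3,4,0,5,6,7,8,9,10,11] (Forb 1 8
     [1,2,3,4,0,5,6,7,8,9,10,11] (Forb 1 7 [1,2,3,4,0,5,6,7,8,9,10,11] (Forb 1 6
     [1,2,3,4,0,5,6,7,8,9,10,11] (Case 0 3 (Forb 2 10 [2,1,0,3,4,5,6,7,8,9,10,11] (Forb 2 9
     [2,1,0,3,4,5,6,7,8,9,10,11] (Forb 2 8 [2,1,0,3,4,5,6,7,8,9,10,11] (Forb 2 7
     [2,1,0,3,4,5,6,7,8,9,10,11] (Forb 2 6 [2,1,0,3,4,5,6,7,8,9,10,11] (Cut [5]
     [[0,1,2,3,4],[6,7,8,9,10,11]])))))) (Case 1 3 (Forb 2 10 [2,1,3,4,0,5,6,7,8,9,10,11] (Forb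
     2 9 [2,1,3,4,0,5,6,7,8,9,10,11] (Forb 2 8 [2,1,3,4,0,5,6,7,8,9,10,11] (Forb 2 7
     [2,1,3,4,0,5,6,7,8,9,10,11] (Forb 2 6 [2,1,3,4,0,5,6,7,8,9,10,11] (Cut [5]
     [[0,1,2,3,4],[6,7,8,9,10,11]])))))) (Deg 3))))))))))))) (Case 0 2 (Forb 1 10
     [1,0,2,3,4,5,6,7,8,9,10,11] (Forb 1 9 [1,0,2,3,4,5,6,7,8,9,10,11] (Forb 1 8
     [1,0,2,3,4,5,6,7,8,9,10,11] (Forb 1 7 [1,0,2,3,4,5,6,7,8,9,10,11] (Forb 1 6
     [1,0,2,3,4,5,6,7,8,9,10,11] (Case 1 4 (Forb 3 10 [3,2,0,1,4,5,6,7,8,9,10,11] (Forb 3 9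
     [3,2,0,1,4,5,6,7,8,9,10,11] (Forb 3 8 [3,2,0,1,4,5,6,7,8,9,10,11] (Forb 3 7
     [3,2,0,1,4,5,6,7,8,9,10,11] (Forb 3 6 [3,2,0,1,4,5,6,7,8,9,10,11] (Forb 2 10
     [2,3,4,1,0,5,6,7,8,9,10,11] (Forb 2 9 [2,3,4,1,0,5,6,7,8,9,10,11] (Forb 2 8
     [2,3,4,1,0,5,6,7,8,9,10,11] (Forb 2 7 [2,3,4,1,0,5,6,7,8,9,10,11] (Forb 2 6
     [2,3,4,1,0,5,6,7,8,9,10,11] (Cut [5] [[0,1,2,3,4],[6,7,8,9,10,11]]))))))))))) (Deg 4)))))))
     (Deg 0))))))))))))))))),
     Forb 5 11 [0,1,2,3,4,5,11,10,9,8,7,6] (Forb 5 10 [5,4,3,2,1,0,6,7,8,9,10,11] (Forb 5 9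
     [5,4,3,2,1,0,6,7,8,9,10,11] (Forb 5 8 [5,4,3,2,1,0,6,7,8,9,10,11] (Forb 5 7
     [5,4,3,2,1,0,6,7,8,9,10,11] (Forb 4 11 [0,1,2,3,4,11,10,9,8,7,6,5] (Forb 3 11
     [0,1,2,3,11,10,9,8,7,6,5,4] (Forb 2 11 [0,1,2,11,10,9,8,7,6,5,4,3] (Forb 1 11
     [0,1,11,10,9,8,7,6,5,4,3,2] (Forb 0 11 [0,1,2,3,4,5,6,7,8,9,10,11] (Forb 0 10
     [0,1,2,3,4,5,6,7,8,9,10,11] (Forb 0 9 [0,1,2,3,4,5,6,7,8,9,10,11] (Forb 0 8
     [0,1,2,3,4,5,6,7,8,9,10,11] (Forb 0 7 [0,1,2,3,4,5,6,7,8,9,10,11] (Case 6 11 (Forb 4 7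
     [0,1,2,3,4,7,8,9,10,11,6,5] (Forb 3 7 [0,1,2,3,7,8,9,10,11,6,5,4] (Forb 2 7
     [0,1,2,7,8,9,10,11,6,5,4,3] (Forb 1 7 [0,1,7,8,9,10,11,6,5,4,3,2] (Case 7 11 (Forb 4 10
     [0,1,2,3,4,10,9,8,7,11,6,5] (Forb 4 8 [0,1,2,3,4,8,9,10,11,7,6,5] (Forb 3 10
     [0,1,2,3,10,9,8,7,11,6,5,4] (Forb 3 8 [0,1,2,3,8,9,10,11,7,6,5,4] (Forb 2 10
     [0,1,2,10,9,8,7,11,6,5,4,3] (Forb 2 8 [0,1,2,8,9,10,11,7,6,5,4,3] (Forb 1 10
     [0,1,10,9,8,7,11,6,5,4,3,2] (Forb 1 8 [0,1,8,9,10,11,7,6,5,4,3,2] (Case 6 8 (Forb 4 9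
     [0,1,2,3,4,9,10,11,7,8,6,5] (Forb 3 9 [0,1,2,3,9,10,11,7,8,6,5,4] (Forb 2 9
     [0,1,2,9,10,11,7,8,6,5,4,3] (Forb 1 9 [0,1,9,10,11,7,8,6,5,4,3,2] (Cut [6]
     [[0,1,2,3,4,5],[7,8,9,10,11]]))))) (Case 8 10 (Forb 4 9 [0,1,2,3,4,9,8,10,11,7,6,5] (Forb 3
     9 [0,1,2,3,9,8,10,11,7,6,5,4] (Forb 2 9 [0,1,2,9,8,10,11,7,6,5,4,3] (Forb 1 9
     [0,1,9,8,10,11,7,6,5,4,3,2] (Cut [6] [[0,1,2,3,4,5],[7,8,9,10,11]]))))) (Deg 8)))))))))))
     (Case 7 9 (Forb 4 8 [0,1,2,3,4,8,7,9,10,11,6,5] (Forb 3 8 [0,1,2,3,8,7,9,10,11,6,5,4] (Forb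
     2 8 [0,1,2,8,7,9,10,11,6,5,4,3] (Forb 1 8 [0,1,8,7,9,10,11,6,5,4,3,2] (Case 8 11 (Forb 4 10
     [0,1,2,3,4,10,9,7,8,11,6,5] (Forb 4 9 [0,1,2,3,4,9,10,11,8,7,6,5] (Forb 3 10
     [0,1,2,3,10,9,7,8,11,6,5,4] (Forb 3 9 [0,1,2,3,9,10,11,8,7,6,5,4] (Forb 2 10
     [0,1,2,10,9,7,8,11,6,5,4,3] (Forb 2 9 [0,1,2,9,10,11,8,7,6,5,4,3] (Forb 1 10
     [0,1,10,9,7,8,11,6,5,4,3,2] (Forb 1 9 [0,1,9,10,11,8,7,6,5,4,3,2] (Cut [6]
     [[0,1,2,3,4,5],[7,8,9,10,11]]))))))))) (Deg 11)))))) (Deg 7))))))) (Case 7 11 (Forb 4 8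
     [0,1,2,3,4,8,9,10,11,7,6,5] (Forb 3 8 [0,1,2,3,8,9,10,11,7,6,5,4] (Forb 2 8
     [0,1,2,8,9,10,11,7,6,5,4,3] (Forb 1 8 [0,1,8,9,10,11,7,6,5,4,3,2] (Case 8 11 (Forb 4 10
     [0,1,2,3,4,10,9,8,11,7,6,5] (Forb 4 9 [0,1,2,3,4,9,10,11,8,7,6,5] (Forb 3 10
     [0,1,2,3,10,9,8,11,7,6,5,4] (Forb 3 9 [0,1,2,3,9,10,11,8,7,6,5,4] (Forb 2 10
     [0,1,2,10,9,8,11,7,6,5,4,3] (Forb 2 9 [0,1,2,9,10,11,8,7,6,5,4,3] (Forb 1 10
     [0,1,10,9,8,11,7,6,5,4,3,2] (Forb 1 9 [0,1,9,10,11,8,7,6,5,4,3,2] (Case 6 8 (Forb 4 7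
     [0,1,2,3,4,7,11,10,9,8,6,5] (Forb 3 7 [0,1,2,3,7,11,10,9,8,6,5,4] (Forb 2 7
     [0,1,2,7,11,10,9,8,6,5,4,3] (Forb 1 7 [0,1,7,11,10,9,8,6,5,4,3,2] (Cut [6]
     [[0,1,2,3,4,5],[7,8,9,10,11]]))))) (Case 6 9 (Forb 4 7 [0,1,2,3,4,7,8,11,10,9,6,5] (Forb 3
     7 [0,1,2,3,7,8,11,10,9,6,5,4] (Forb 2 7 [0,1,2,7,8,11,10,9,6,5,4,3] (Forb 1 7
     [0,1,7,8,11,10,9,6,5,4,3,2] (Cut [6] [[0,1,2,3,4,5],[7,8,9,10,11]]))))) (Case 6 10 (Forb 4
     7 [0,1,2,3,4,7,11,8,9,10,6,5] (Forb 3 7 [0,1,2,3,7,11,8,9,10,6,5,4] (Forb 2 7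
     [0,1,2,7,11,8,9,10,6,5,4,3] (Forb 1 7 [0,1,7,11,8,9,10,6,5,4,3,2] (Cut [6]
     [[0,1,2,3,4,5],[7,8,9,10,11]]))))) (Cut [7] [[0,1,2,3,4,5,6],[8,9,10,11]])))))))))))) (Deg
     11)))))) (Deg 11)))))))))))))))),
     Forb 6 11 [0,1,2,3,4,5,6,11,10,9,8,7] (Forb 6 10 [6,5,4,3,2,1,0,7,8,9,10,11] (Forb 6 9
     [6,5,4,3,2,1,0,7,8,9,10,11] (Forb 6 8 [6,5,4,3,2,1,0,7,8,9,10,11] (Forb 5 11
     [0,1,2,3,4,5,11,10,9,8,7,6] (Forb 4 11 [0,1,2,3,4,11,10,9,8,7,6,5] (Forb 3 11
     [0,1,2,3,11,10,9,8,7,6,5,4] (Forb 2 11 [3,4,5,6,7,8,9,10,11,2,1,0] (Forb 1 11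
     [2,3,4,5,6,7,8,9,10,11,1,0] (Forb 0 11 [0,1,2,3,4,5,6,7,8,9,10,11] (Forb 0 10
     [0,1,2,3,4,5,6,7,8,9,10,11] (Forb 0 9 [0,1,2,3,4,5,6,7,8,9,10,11] (Forb 0 8
     [0,1,2,3,4,5,6,7,8,9,10,11] (Case 7 11 (Forb 5 8 [0,1,2,3,4,5,8,9,10,11,7,6] (Forb 4 8
     [0,1,2,3,4,8,9,10,11,7,6,5] (Forb 3 8 [0,1,2,3,8,9,10,11,7,6,5,4] (Forb 2 8
     [3,4,5,6,7,11,10,9,8,2,1,0] (Forb 1 8 [2,3,4,5,6,7,11,10,9,8,1,0] (Case 8 11 (Forb 5 10
     [0,1,2,3,4,5,10,9,8,11,7,6] (Forb 5 9 [0,1,2,3,4,5,9,10,11,8,7,6] (Forb 4 10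
     [0,1,2,3,4,10,9,8,11,7,6,5] (Forb 4 9 [0,1,2,3,4,9,10,11,8,7,6,5] (Forb 3 10
     [0,1,2,3,10,9,8,11,7,6,5,4] (Forb 3 9 [0,1,2,3,9,10,11,8,7,6,5,4] (Forb 2 10
     [3,4,5,6,7,11,8,9,10,2,1,0] (Forb 2 9 [3,4,5,6,7,8,11,10,9,2,1,0] (Forb 1 10
     [2,3,4,5,6,7,11,8,9,10,1,0] (Forb 1 9 [2,3,4,5,6,7,8,11,10,9,1,0] (Cut [7]
     [[0,1,2,3,4,5,6],[8,9,10,11]]))))))))))) (Deg 8))))))) (Deg 11)))))))))))))),
     Forb 7 11 [0,1,2,3,4,5,6,7,11,10,9,8] (Forb 7 10 [7,6,5,4,3,2,1,0,8,9,10,11] (Forb 7 9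
     [7,6,5,4,3,2,1,0,8,9,10,11] (Forb 6 11 [0,1,2,3,4,5,6,11,10,9,8,7] (Forb 5 11
     [0,1,2,3,4,5,11,10,9,8,7,6] (Forb 2 11 [3,4,5,6,7,8,9,10,11,2,1,0] (Forb 1 11
     [2,3,4,5,6,7,8,9,10,11,1,0] (Forb 0 11 [0,1,2,3,4,5,6,7,8,9,10,11] (Forb 0 10
     [0,1,2,3,4,5,6,7,8,9,10,11] (Forb 0 9 [0,1,2,3,4,5,6,7,8,9,10,11] (Case 3 11 (Forb 6 9
     [2,1,0,8,7,6,9,10,11,3,4,5] (Forb 5 9 [2,1,0,8,7,6,5,9,10,11,3,4] (Forb 4 11
     [0,1,2,3,11,4,5,6,7,8,9,10] (Forb 4 10 [0,1,2,3,11,10,4,5,6,7,8,9] (Forb 4 9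
     [0,1,2,3,11,10,9,4,5,6,7,8] (Forb 2 10 [0,1,2,10,11,3,4,5,6,7,8,9] (Forb 2 9
     [0,1,2,9,10,11,3,4,5,6,7,8] (Forb 2 7 [0,1,2,7,6,5,4,3,11,10,9,8] (Forb 2 6
     [0,1,2,6,5,4,3,11,10,9,8,7] (Forb 2 5 [0,1,2,5,4,3,11,10,9,8,7,6] (Forb 2 4
     [3,11,10,9,8,7,6,5,4,2,1,0] (Forb 1 9 [0,8,7,6,5,4,3,11,10,9,1,2] (Forb 1 7
     [0,8,9,10,11,3,4,5,6,7,1,2] (Forb 1 4 [2,3,11,10,9,8,7,6,5,4,1,0] (Forb 0 7
     [4,5,6,7,0,8,9,10,11,3,2,1] (Forb 0 6 [0,1,2,3,11,10,9,8,7,6,5,4] (Forb 0 5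
     [0,1,2,3,11,10,9,8,7,6,5,4] (Forb 0 4 [0,1,2,3,11,10,9,8,7,6,5,4] (Case 0 2 (Forb 1 10
     [0,2,1,10,11,3,4,5,6,7,8,9] (Forb 1 6 [0,2,1,6,5,4,3,11,10,9,8,7] (Forb 1 5
     [0,2,1,5,4,3,11,10,9,8,7,6] (Case 9 11 (Forb 6 10 [0,1,2,3,4,5,6,10,11,9,8,7] (Forb 5 10
     [0,1,2,3,4,5,10,11,9,8,7,6] (Cut [3,8] [[0,1,2],[4,5,6,7],[9,10,11]]))) (Deg 9))))) (Deg
     0)))))))))))))))))))) (Case 4 11 (Forb 6 9 [3,2,1,0,8,7,6,9,10,11,4,5] (Forb 5 10
     [0,1,2,3,4,11,10,5,6,7,8,9] (Forb 5 9 [0,1,2,3,4,11,10,9,5,6,7,8] (Forb 3 11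
     [0,1,2,3,11,4,5,6,7,8,9,10] (Forb 3 10 [0,1,2,3,10,11,4,5,6,7,8,9] (Forb 3 9
     [0,1,2,3,9,10,11,4,5,6,7,8] (Forb 3 7 [0,1,2,3,7,6,5,4,11,10,9,8] (Forb 3 6
     [0,1,2,3,6,5,4,11,10,9,8,7] (Forb 3 5 [0,1,2,3,5,4,11,10,9,8,7,6] (Forb 2 9
     [1,0,8,7,6,5,4,11,10,9,2,3] (Forb 2 7 [1,0,8,9,10,11,4,5,6,7,2,3] (Forb 2 5
     [3,4,11,10,9,8,7,6,5,2,1,0] (Forb 1 9 [0,8,7,6,5,4,11,10,9,1,2,3] (Forb 1 7
     [0,8,9,10,11,4,5,6,7,1,2,3] (Forb 1 5 [2,3,4,11,10,9,8,7,6,5,1,0] (Forb 0 7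
     [0,1,2,3,4,11,10,9,8,7,6,5] (Forb 0 6 [0,1,2,3,4,11,10,9,8,7,6,5] (Forb 0 5
     [0,1,2,3,4,11,10,9,8,7,6,5] (Case 5 7 (Forb 6 10 [0,1,2,3,4,11,10,6,5,7,8,9] (Forb 2 6
     [1,0,8,9,10,11,4,5,7,6,2,3] (Forb 1 6 [0,8,9,10,11,4,5,7,6,1,2,3] (Case 9 11 (Forb 2 10
     [1,0,8,7,6,5,4,11,9,10,2,3] (Forb 1 10 [0,8,7,6,5,4,11,9,10,1,2,3] (Cut [4,8]
     [[0,1,2,3],[5,6,7],[9,10,11]]))) (Deg 11))))) (Deg 5)))))))))))))))))))) (Deg
     11)))))))))))),
     Forb 8 11 [0,1,2,3,4,5,6,7,8,11,10,9] (Forb 8 10 [8,7,6,5,4,3,2,1,0,9,10,11] (Forb 7 11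
     [0,1,2,3,4,5,6,7,11,10,9,8] (Forb 1 11 [2,3,4,5,6,7,8,9,10,11,1,0] (Forb 0 11
     [0,1,2,3,4,5,6,7,8,9,10,11] (Forb 0 10 [0,1,2,3,4,5,6,7,8,9,10,11] (Case 9 11 (Forb 7 10
     [0,1,2,3,4,5,6,7,10,11,9,8] (Forb 1 10 [2,3,4,5,6,7,8,9,11,10,1,0] (Case 3 10 (Forb 5 11
     [2,1,0,9,8,7,6,5,11,10,3,4] (Forb 4 11 [0,1,2,3,10,11,4,5,6,7,8,9] (Forb 4 10
     [0,1,2,3,10,4,5,6,7,8,9,11] (Forb 2 11 [0,1,2,11,10,3,4,5,6,7,8,9] (Forb 2 10
     [0,1,2,10,3,4,5,6,7,8,9,11] (Forb 2 8 [0,1,2,8,7,6,5,4,3,10,9,11] (Forb 2 7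
     [0,1,2,7,6,5,4,3,10,11,9,8] (Forb 1 8 [0,9,11,10,3,4,5,6,7,8,1,2] (Forb 1 4
     [2,3,10,11,9,8,7,6,5,4,1,0] (Forb 0 5 [0,1,2,3,10,11,9,8,7,6,5,4] (Forb 0 4
     [0,1,2,3,10,11,9,8,7,6,5,4] (Case 6 11 (Forb 5 10 [0,1,2,3,4,5,10,11,6,7,8,9] (Forb 5 8
     [0,1,2,3,4,5,8,7,6,11,9,10] (Forb 5 7 [0,1,2,3,4,5,7,6,11,10,9,8] (Forb 4 8
     [3,2,1,0,9,10,11,6,7,8,4,5] (Forb 4 7 [0,1,2,3,10,11,6,5,4,7,8,9] (Forb 2 5
     [0,1,2,5,4,3,10,11,6,7,8,9] (Forb 2 4 [2,1,0,9,8,7,6,11,10,3,4,5] (Forb 1 7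
     [2,3,4,5,6,11,10,9,8,7,1,0] (Forb 1 5 [0,9,8,7,6,11,10,3,4,5,1,2] (Forb 0 8
     [0,1,2,3,4,5,6,11,10,9,8,7] (Forb 0 7 [0,1,2,3,4,5,6,11,10,9,8,7] (Cut [3,6,9]
     [[0,1,2],[4,5],[7,8],[10,11]])))))))))))) (Deg 11))))))))))))) (Case 5 10 (Forb 6 11
     [0,1,2,3,4,5,10,11,6,7,8,9] (Forb 6 10 [0,1,2,3,4,5,10,6,7,8,9,11] (Forb 4 11
     [0,1,2,3,4,11,10,5,6,7,8,9] (Forb 4 10 [0,1,2,3,4,10,5,6,7,8,9,11] (Forb 4 8
     [0,1,2,3,4,8,7,6,5,10,9,11] (Forb 4 7 [0,1,2,3,4,7,6,5,10,11,9,8] (Forb 3 11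
     [2,1,0,9,8,7,6,5,10,11,3,4] (Forb 3 8 [2,1,0,9,11,10,5,6,7,8,3,4] (Forb 1 6
     [2,3,4,5,10,11,9,8,7,6,1,0] (Forb 0 7 [0,1,2,3,4,5,10,11,9,8,7,6] (Forb 0 6
     [0,1,2,3,4,5,10,11,9,8,7,6] (Case 2 11 (Forb 4 6 [1,0,9,8,7,6,4,5,10,11,2,3] (Forb 3 10
     [0,1,2,11,10,3,4,5,6,7,8,9] (Forb 3 7 [3,4,5,10,11,2,1,0,9,8,7,6] (Forb 3 6
     [0,1,2,11,10,5,4,3,6,7,8,9] (Forb 1 8 [0,1,8,7,6,5,4,3,2,11,9,10] (Forb 1 7
     [0,1,7,6,5,4,3,2,11,10,9,8] (Forb 1 4 [0,1,4,3,2,11,10,5,6,7,8,9] (Forb 1 3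
     [1,0,9,8,7,6,5,10,11,2,3,4] (Forb 0 8 [3,4,5,6,7,8,0,9,10,11,2,1] (Forb 0 4
     [0,1,2,11,10,9,8,7,6,5,4,3] (Forb 0 3 [0,1,2,11,10,9,8,7,6,5,4,3] (Cut [2,5,9]
     [[0,1],[3,4],[6,7,8],[10,11]])))))))))))) (Deg 11))))))))))))) (Case 2 10 (Forb 4 11
     [1,0,9,8,7,6,5,4,11,10,2,3] (Forb 3 11 [0,1,2,10,11,3,4,5,6,7,8,9] (Forb 3 10
     [0,1,2,10,3,4,5,6,7,8,9,11] (Forb 1 8 [0,1,8,7,6,5,4,3,2,10,9,11] (Forb 1 7
     [0,1,7,6,5,4,3,2,10,11,9,8] (Forb 1 3 [2,10,11,9,8,7,6,5,4,3,1,0] (Forb 0 8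
     [3,4,5,6,7,8,0,9,11,10,2,1] (Forb 0 4 [0,1,2,10,11,9,8,7,6,5,4,3] (Forb 0 3
     [0,1,2,10,11,9,8,7,6,5,4,3] (Case 5 11 (Forb 6 10 [0,1,2,3,4,5,11,10,6,7,8,9] (Forb 4 10
     [0,1,2,3,4,10,11,5,6,7,8,9] (Deg 10))) (Case 6 11 (Forb 5 11 [0,1,2,3,4,5,11,6,7,8,9,10]
     (Forb 5 10 [0,1,2,3,4,5,10,11,6,7,8,9] (Forb 5 8 [0,1,2,3,4,5,8,7,6,11,9,10] (Forb 5 7
     [0,1,2,3,4,5,7,6,11,10,9,8] (Forb 4 10 [3,2,1,0,9,8,7,6,11,10,4,5] (Forb 4 8
     [3,2,1,0,9,10,11,6,7,8,4,5] (Forb 4 7 [1,0,9,8,7,4,5,6,11,10,2,3] (Forb 3 8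
     [3,4,5,6,11,10,2,1,0,9,8,7] (Forb 3 7 [0,1,2,10,11,6,5,4,3,7,8,9] (Forb 1 5
     [0,1,5,4,3,2,10,11,6,7,8,9] (Forb 1 4 [1,0,9,8,7,6,11,10,2,3,4,5] (Forb 0 7
     [0,1,2,3,4,5,6,11,10,9,8,7] (Forb 0 5 [3,4,5,0,9,8,7,6,11,10,2,1] (Cut [2,6,9]
     [[0,1],[3,4,5],[7,8],[10,11]])))))))))))))) (Deg 11)))))))))))) (Case 4 10 (Forb 6 11
     [3,2,1,0,9,8,7,6,11,10,4,5] (Forb 5 11 [0,1,2,3,4,10,11,5,6,7,8,9] (Forb 3 11
     [0,1,2,3,11,10,4,5,6,7,8,9] (Forb 2 11 [1,0,9,8,7,6,5,4,10,11,2,3] (Deg 11))))) (Deg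
     10))))))) (Case 3 11 (Forb 4 11 [0,1,2,3,11,4,5,6,7,8,9,10] (Forb 2 11
     [0,1,2,11,3,4,5,6,7,8,9,10] (Case 5 11 (Forb 6 11 [0,1,2,3,4,5,11,6,7,8,9,10] (Deg 11))
     (Deg 11)))) (Case 5 11 (Forb 6 11 [0,1,2,3,4,5,11,6,7,8,9,10] (Forb 4 11
     [0,1,2,3,4,11,5,6,7,8,9,10] (Deg 11))) (Case 4 11 (Forb 6 10 [3,2,1,0,9,8,7,6,10,11,4,5]
     (Forb 5 11 [0,1,2,3,4,11,5,6,7,8,9,10] (Forb 5 10 [0,1,2,3,4,11,10,5,6,7,8,9] (Forb 3 11
     [0,1,2,3,11,4,5,6,7,8,9,10] (Forb 3 10 [0,1,2,3,10,11,4,5,6,7,8,9] (Forb 2 10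
     [1,0,9,8,7,6,5,4,11,10,2,3] (Case 2 11 (Forb 4 10 [1,0,9,8,7,6,5,4,10,11,2,3] (Forb 1 10
     [0,1,10,11,2,3,4,5,6,7,8,9] (Deg 10))) (Deg 11)))))))) (Deg 11)))))))))),
     Forb 9 11 [0,1,2,3,4,5,6,7,8,9,11,10] (Forb 0 11 [0,1,2,3,4,5,6,7,8,9,10,11] (Case 2 11
     (Forb 3 11 [0,1,2,11,3,4,5,6,7,8,9,10] (Forb 1 11 [0,1,11,2,3,4,5,6,7,8,9,10] (Forb 1 9
     [0,1,9,8,7,6,5,4,3,2,11,10] (Forb 0 3 [0,1,2,11,10,9,8,7,6,5,4,3] (Case 5 11 (Forb 6 11
     [0,1,2,3,4,5,11,6,7,8,9,10] (Forb 4 11 [0,1,2,3,4,11,5,6,7,8,9,10] (Forb 4 9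
     [0,1,2,3,4,9,8,7,6,5,11,10] (Forb 3 6 [0,1,2,11,5,4,3,6,7,8,9,10] (Forb 1 4
     [0,1,4,3,2,11,5,6,7,8,9,10] (Forb 0 6 [0,1,2,3,4,5,11,10,9,8,7,6] (Case 7 11 (Forb 8 11
     [0,1,2,3,4,5,6,7,11,8,9,10] (Forb 6 9 [0,1,2,3,4,5,6,9,8,7,11,10] (Forb 6 8
     [0,1,2,3,4,5,11,7,6,8,9,10] (Forb 4 6 [0,1,2,3,4,6,5,11,7,8,9,10] (Forb 3 8
     [0,1,2,11,7,6,5,4,3,8,9,10] (Forb 1 6 [0,1,6,5,4,3,2,11,7,8,9,10] (Forb 0 8
     [0,1,2,3,4,5,6,7,11,10,9,8] (Case 2 6 (Forb 3 9 [0,1,2,6,5,4,3,9,8,7,11,10] (Forb 1 3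
     [0,1,3,4,5,6,2,11,7,8,9,10] (Case 6 10 (Forb 0 9 [0,1,2,3,4,5,6,10,11,7,8,9] (Case 3 5
     (Forb 4 8 [0,1,2,6,7,11,5,3,4,8,9,10] (Forb 0 4 [0,1,2,6,7,8,9,10,11,5,3,4] (Case 1 8 (Forb
     0 7 [0,1,8,9,10,6,2,3,4,5,11,7] (Forb 0 5 [0,1,8,9,10,6,7,11,2,3,4,5] (Forb 0 2
     [0,1,8,9,10,6,7,11,5,4,3,2] (Deg 0)))) (Cut [2,5,7,10] [[0,1],[3,4],[6],[8,9],[11]]))))
     (Case 3 7 (Forb 4 8 [0,1,2,6,5,11,7,3,4,8,9,10] (Forb 0 4 [0,1,2,6,5,11,10,9,8,7,3,4] (Case
     1 8 (Forb 0 7 [0,1,8,9,10,6,2,3,4,5,11,7] (Forb 0 5 [0,1,8,9,10,6,2,11,7,3,4,5] (Forb 0 2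
     [0,1,8,9,10,6,5,4,3,7,11,2] (Deg 0)))) (Cut [2,5,7,10] [[0,1],[3,4],[6],[8,9],[11]]))))
     (Deg 3)))) (Deg 6)))) (Deg 6))))))))) (Case 8 11 (Forb 7 11 [0,1,2,3,4,5,6,7,11,8,9,10]
     (Forb 7 9 [0,1,2,3,4,5,6,7,9,8,11,10] (Forb 6 9 [0,1,2,3,4,5,11,8,7,6,9,10] (Forb 4 7
     [0,1,2,3,4,7,6,5,11,8,9,10] (Forb 3 9 [0,1,2,11,8,7,6,5,4,3,9,10] (Forb 1 7
     [0,1,7,6,5,4,3,2,11,8,9,10] (Forb 0 9 [0,1,2,3,4,5,6,7,8,11,10,9] (Case 2 9 (Forb 1 6
     [0,1,6,7,8,9,2,3,4,5,11,10] (Forb 1 3 [0,1,3,4,5,6,7,8,9,2,11,10] (Case 5 9 (Forb 4 6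
     [0,1,2,3,4,6,7,8,9,5,11,10] (Case 1 8 (Forb 0 7 [0,1,8,9,10,11,2,3,4,5,6,7] (Forb 0 4
     [0,1,8,7,6,5,9,10,11,2,3,4] (Case 3 7 (Forb 4 10 [0,1,2,9,8,11,5,6,7,3,4,10] (Forb 4 8
     [0,1,2,9,5,6,7,3,4,8,11,10] (Forb 2 4 [0,1,2,4,3,7,6,5,9,8,11,10] (Deg 4)))) (Cut
     [2,5,8,10] [[0,1],[3,4],[6,7],[9],[11]])))) (Case 1 10 (Forb 0 7
     [0,1,10,9,8,11,2,3,4,5,6,7] (Forb 0 4 [0,1,10,9,5,6,7,8,11,2,3,4] (Case 3 7 (Forb 4 10
     [0,1,2,9,8,11,5,6,7,3,4,10] (Forb 4 8 [0,1,2,9,5,6,7,3,4,8,11,10] (Forb 2 4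
     [0,1,2,4,3,7,6,5,9,8,11,10] (Deg 4)))) (Cut [2,5,8,10] [[0,1],[3,4],[6,7],[9],[11]]))))
     (Deg 1)))) (Deg 9)))) (Deg 9))))))))) (Deg 11))))))))) (Case 6 11 (Forb 7 11
     [0,1,2,3,4,5,6,11,7,8,9,10] (Forb 5 11 [0,1,2,3,4,5,11,6,7,8,9,10] (Forb 5 9
     [0,1,2,3,4,5,9,8,7,6,11,10] (Forb 3 7 [0,1,2,11,6,5,4,3,7,8,9,10] (Forb 1 5
     [0,1,5,4,3,2,11,6,7,8,9,10] (Forb 0 7 [0,1,2,3,4,5,6,11,10,9,8,7] (Case 8 11 (Forb 7 9
     [0,1,2,3,4,5,6,7,9,8,11,10] (Forb 5 7 [0,1,2,3,4,5,7,6,11,8,9,10] (Forb 3 9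
     [0,1,2,11,8,7,6,5,4,3,9,10] (Forb 1 7 [0,1,7,6,5,4,3,2,11,8,9,10] (Forb 0 9
     [0,1,2,3,4,5,6,7,8,11,10,9] (Case 4 7 (Forb 3 5 [0,1,2,3,5,4,7,6,11,8,9,10] (Forb 1 3
     [0,1,3,2,11,6,5,4,7,8,9,10] (Forb 0 5 [0,1,2,3,4,7,8,9,10,11,6,5] (Cut [2,4,6,8,10]
     [[0,1],[3],[5],[7],[9],[11]])))) (Case 2 7 (Forb 1 3 [0,1,3,4,5,6,7,2,11,8,9,10] (Case 7 10
     (Case 4 9 (Forb 3 5 [0,1,2,3,5,4,9,8,7,6,11,10] (Forb 0 5 [0,1,2,3,4,9,8,7,10,11,6,5] (Cut
     [2,4,6,8,10] [[0,1],[3],[5],[7],[9],[11]]))) (Case 2 9 (Case 6 9 (Case 3 5 (Forb 4 11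
     [0,1,2,3,5,4,11,6,7,8,9,10] (Forb 4 9 [0,1,2,3,5,4,9,6,7,8,11,10] (Forb 4 7
     [0,1,2,3,5,4,7,6,9,8,11,10] (Forb 1 4 [0,1,4,3,5,6,7,2,9,8,11,10] (Forb 0 4
     [0,1,2,7,8,9,10,11,6,5,3,4] (Case 0 5 (Forb 4 10 [0,1,2,7,6,9,8,11,10,4,3,5] (Forb 4 8
     [0,1,2,7,6,9,10,11,8,4,3,5] (Forb 4 6 [0,1,2,7,8,9,10,11,6,4,3,5] (Deg 4)))) (Cut
     [2,6,8,10] [[0,1],[3,4,5],[7],[9],[11]]))))))) (Case 0 5 (Forb 3 10
     [0,1,2,7,6,9,8,11,10,3,4,5] (Forb 3 8 [0,1,2,7,6,9,10,11,8,3,4,5] (Forb 3 6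
     [0,1,2,7,8,9,10,11,6,3,4,5] (Deg 3)))) (Cut [2,4,6,8,10] [[0,1],[3],[5],[7],[9],[11]])))
     (Deg 9)) (Deg 9))) (Deg 7))) (Deg 7)))))))) (Case 4 11 (Forb 5 7
     [0,1,2,3,4,11,6,5,7,8,9,10] (Forb 3 9 [0,1,2,3,9,8,7,6,5,4,11,10] (Forb 3 5
     [0,1,2,3,5,4,11,6,7,8,9,10] (Forb 1 3 [0,1,3,2,11,4,5,6,7,8,9,10] (Forb 0 5
     [0,1,2,3,4,11,10,9,8,7,6,5] (Case 3 8 (Forb 7 9 [0,1,2,3,8,9,7,6,5,4,11,10] (Forb 1 7
     [0,1,7,6,5,4,11,2,3,8,9,10] (Forb 0 9 [0,1,2,3,8,7,6,5,4,11,10,9] (Cut [2,4,6,8,10]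
     [[0,1],[3],[5],[7],[9],[11]])))) (Case 3 10 (Forb 0 9 [0,1,2,3,10,11,4,5,6,7,8,9] (Case 3 6
     (Case 5 8 (Forb 7 9 [0,1,2,3,4,5,8,9,7,6,11,10] (Forb 1 7 [0,1,7,6,3,2,11,4,5,8,9,10] (Cut
     [2,4,6,8,10] [[0,1],[3],[5],[7],[9],[11]]))) (Case 2 5 (Case 5 10 (Case 0 8 (Forb 7 9
     [0,1,2,3,4,5,6,11,10,9,7,8] (Forb 1 7 [0,1,7,6,3,2,5,4,11,10,9,8] (Cut [2,4,6,8,10]
     [[0,1],[3],[5],[7],[9],[11]]))) (Case 1 7 (Forb 0 8 [0,1,7,6,3,2,5,4,11,10,9,8] (Forb 0 6
     [0,1,7,8,9,10,3,2,5,4,11,6] (Forb 0 4 [0,1,7,8,9,10,3,2,5,6,11,4] (Forb 0 2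
     [0,1,7,8,9,10,3,4,5,6,11,2] (Deg 0))))) (Case 1 8 (Forb 7 9 [0,1,8,9,7,6,3,2,5,4,11,10]
     (Cut [2,4,6,8,10] [[0,1],[3],[5],[7],[9],[11]])) (Cut [2,4,6,10]
     [[0,1],[3],[5],[7,8,9],[11]])))) (Deg 5)) (Deg 5))) (Deg 3))) (Deg 3)))))))) (Deg
     11))))))))) (Case 7 11 (Forb 8 11 [0,1,2,3,4,5,6,7,11,8,9,10] (Forb 6 11
     [0,1,2,3,4,5,6,11,7,8,9,10] (Forb 6 9 [0,1,2,3,4,5,6,9,8,7,11,10] (Forb 3 8
     [0,1,2,11,7,6,5,4,3,8,9,10] (Forb 1 6 [0,1,6,5,4,3,2,11,7,8,9,10] (Forb 0 8
     [0,1,2,3,4,5,6,7,11,10,9,8] (Case 4 11 (Forb 5 11 [0,1,2,3,4,11,5,6,7,8,9,10] (Forb 5 8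
     [0,1,2,3,4,11,7,6,5,8,9,10] (Forb 3 9 [0,1,2,3,9,8,7,6,5,4,11,10] (Forb 3 6
     [0,1,2,3,6,5,4,11,7,8,9,10] (Forb 3 5 [0,1,2,11,4,3,5,6,7,8,9,10] (Forb 1 3
     [0,1,3,2,11,4,5,6,7,8,9,10] (Forb 0 5 [0,1,2,3,4,11,10,9,8,7,6,5] (Case 3 7 (Forb 6 8
     [0,1,2,3,7,11,4,5,6,8,9,10] (Forb 0 6 [0,1,2,3,7,8,9,10,11,4,5,6] (Case 3 10 (Forb 0 9
     [0,1,2,3,10,11,4,5,6,7,8,9] (Case 0 2 (Forb 1 8 [0,1,8,9,10,3,4,5,6,7,11,2] (Forb 1 5
     [0,1,5,6,7,8,9,10,3,4,11,2] (Case 5 9 (Forb 4 6 [0,1,2,3,4,6,5,9,8,7,11,10] (Forb 2 6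
     [0,1,2,6,5,9,8,7,3,4,11,10] (Deg 6))) (Cut [2,4,7,10] [[0,1],[3],[5,6],[8,9],[11]]))))
     (Case 0 4 (Forb 1 8 [0,1,8,9,10,3,2,11,7,6,5,4] (Forb 1 5 [0,1,5,6,7,8,9,10,3,2,11,4] (Case
     5 9 (Forb 4 6 [0,1,2,3,4,6,5,9,8,7,11,10] (Forb 2 6 [0,1,2,6,5,9,8,7,3,4,11,10] (Deg 6)))
     (Cut [2,4,7,10] [[0,1],[3],[5,6],[8,9],[11]])))) (Deg 0)))) (Deg 3)))) (Deg 3))))))))) (Deg
     11)))))))) (Case 4 11 (Forb 5 11 [0,1,2,3,4,11,5,6,7,8,9,10] (Forb 3 9
     [0,1,2,3,9,8,7,6,5,4,11,10] (Forb 3 5 [0,1,2,11,4,3,5,6,7,8,9,10] (Forb 1 3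
     [0,1,3,2,11,4,5,6,7,8,9,10] (Forb 0 5 [0,1,2,3,4,11,10,9,8,7,6,5] (Case 8 11 (Forb 7 11
     [0,1,2,3,4,5,6,7,11,8,9,10] (Forb 7 9 [0,1,2,3,4,5,6,7,9,8,11,10] (Forb 5 9
     [0,1,2,3,4,11,8,7,6,5,9,10] (Forb 3 7 [0,1,2,3,7,6,5,4,11,8,9,10] (Forb 1 7
     [0,1,7,6,5,4,3,2,11,8,9,10] (Forb 0 9 [0,1,2,3,4,5,6,7,8,11,10,9] (Case 3 6 (Forb 5 7
     [0,1,2,3,6,7,5,4,11,8,9,10] (Forb 1 5 [0,1,5,4,11,2,3,6,7,8,9,10] (Forb 0 7
     [0,1,2,3,6,5,4,11,10,9,8,7] (Cut [2,4,6,8,10] [[0,1],[3],[5],[7],[9],[11]])))) (Case 3 8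
     (Forb 0 7 [0,1,2,3,8,9,10,11,4,5,6,7] (Case 3 10 (Case 6 9 (Forb 5 7
     [0,1,2,3,4,5,7,6,9,8,11,10] (Forb 1 5 [0,1,5,4,3,2,11,8,7,6,9,10] (Cut [2,4,6,8,10]
     [[0,1],[3],[5],[7],[9],[11]]))) (Case 2 9 (Forb 1 5 [0,1,5,6,7,8,3,4,11,2,9,10] (Case 5 7
     (Forb 6 11 [0,1,2,3,4,5,7,6,11,8,9,10] (Forb 6 9 [0,1,2,3,4,5,7,6,9,8,11,10] (Forb 3 6
     [0,1,2,3,6,7,5,4,11,8,9,10] (Forb 1 6 [0,1,6,5,7,8,3,4,11,2,9,10] (Forb 0 6
     [0,1,2,3,4,11,10,9,8,7,5,6] (Cut [2,4,8,10] [[0,1],[3],[5,6,7],[9],[11]])))))) (Cut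
     [2,4,6,8,10] [[0,1],[3],[5],[7],[9],[11]]))) (Deg 9))) (Deg 3))) (Deg 3))))))))) (Deg
     11))))))) (Deg 11))))))))) (Case 5 11 (Forb 6 11 [0,1,2,3,4,5,11,6,7,8,9,10] (Forb 4 11
     [0,1,2,3,4,11,5,6,7,8,9,10] (Forb 4 9 [0,1,2,3,4,9,8,7,6,5,11,10] (Forb 0 6
     [0,1,2,3,4,5,11,10,9,8,7,6] (Case 7 11 (Forb 8 11 [0,1,2,3,4,5,6,7,11,8,9,10] (Forb 6 9
     [0,1,2,3,4,5,6,9,8,7,11,10] (Forb 6 8 [0,1,2,3,4,5,11,7,6,8,9,10] (Forb 4 6
     [0,1,2,3,4,6,5,11,7,8,9,10] (Forb 0 8 [0,1,2,3,4,5,6,7,11,10,9,8] (Case 3 11 (Forb 4 8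
     [0,1,2,3,11,7,6,5,4,8,9,10] (Forb 2 11 [0,1,2,11,3,4,5,6,7,8,9,10] (Forb 2 9
     [0,1,2,9,8,7,6,5,4,3,11,10] (Forb 2 6 [0,1,2,6,5,4,3,11,7,8,9,10] (Forb 2 4
     [0,1,2,4,3,11,5,6,7,8,9,10] (Forb 0 4 [0,1,2,3,11,10,9,8,7,6,5,4] (Case 1 4 (Forb 2 8
     [0,1,4,5,6,7,11,3,2,8,9,10] (Forb 0 9 [0,9,8,7,6,5,4,1,2,3,11,10] (Forb 0 2
     [0,1,4,5,6,7,8,9,10,11,3,2] (Cut [1,3,5,7,10] [[0],[2],[4],[6],[8,9],[11]])))) (Case 4 10
     (Forb 0 9 [0,1,2,3,4,10,11,5,6,7,8,9] (Case 4 7 (Case 1 6 (Forb 2 8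
     [0,1,6,5,4,7,11,3,2,8,9,10] (Forb 0 2 [0,1,6,5,4,7,8,9,10,11,3,2] (Cut [1,3,5,7,10]
     [[0],[2],[4],[6],[8,9],[11]]))) (Case 3 6 (Case 6 10 (Case 0 2 (Forb 1 11
     [0,1,11,5,4,7,8,9,10,6,3,2] (Forb 1 9 [0,1,9,8,7,4,5,6,10,11,3,2] (Forb 1 8
     [0,1,8,9,10,4,5,6,7,11,3,2] (Forb 1 6 [0,1,6,5,4,7,8,9,10,11,3,2] (Forb 1 4
     [0,1,4,5,6,7,8,9,10,11,3,2] (Case 2 8 (Forb 1 7 [0,1,7,4,3,6,5,11,10,9,8,2] (Forb 1 5
     [0,1,5,4,3,6,7,11,10,9,8,2] (Forb 1 3 [0,1,3,4,5,6,7,11,10,9,8,2] (Deg 1)))) (Cut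
     [3,5,7,10] [[0,1,2],[4],[6],[8,9],[11]]))))))) (Case 2 8 (Forb 0 7
     [0,1,2,8,9,10,4,3,6,5,11,7] (Forb 0 5 [0,1,2,8,9,10,4,3,6,7,11,5] (Forb 0 3
     [0,1,2,8,9,10,4,5,6,7,11,3] (Deg 0)))) (Cut [1,3,5,7,10] [[0],[2],[4],[6],[8,9],[11]])))
     (Deg 6)) (Deg 6))) (Deg 4))) (Deg 4))))))))) (Case 1 11 (Forb 2 11
     [0,1,11,2,3,4,5,6,7,8,9,10] (Forb 2 8 [0,1,11,7,6,5,4,3,2,8,9,10] (Forb 2 6
     [0,1,11,5,4,3,2,6,7,8,9,10] (Forb 0 9 [0,9,8,7,6,5,4,3,2,1,11,10] (Forb 0 4
     [0,4,3,2,1,11,5,6,7,8,9,10] (Forb 0 2 [0,1,11,10,9,8,7,6,5,4,3,2] (Case 0 3 (Forb 4 8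
     [0,3,2,1,11,7,6,5,4,8,9,10] (Forb 2 9 [0,3,4,5,6,7,8,9,2,1,11,10] (Forb 2 4
     [0,1,11,10,9,8,7,6,5,4,2,3] (Cut [1,3,5,7,10] [[0],[2],[4],[6],[8,9],[11]])))) (Case 0 5
     (Forb 4 8 [0,1,2,3,4,8,9,10,11,7,6,5] (Case 0 7 (Case 3 6 (Forb 2 9
     [0,1,2,9,8,7,6,3,4,5,11,10] (Forb 2 4 [0,1,2,4,3,6,5,11,7,8,9,10] (Cut [1,3,5,7,10]
     [[0],[2],[4],[6],[8,9],[11]]))) (Case 1 6 (Forb 2 9 [0,1,6,5,4,3,2,9,8,7,11,10] (Case 2 4
     (Forb 3 11 [0,1,2,4,3,11,5,6,7,8,9,10] (Forb 3 9 [0,1,2,4,3,9,8,7,6,5,11,10] (Forb 3 8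
     [0,1,2,4,3,8,9,10,11,5,6,7] (Forb 3 6 [0,1,2,4,3,6,5,11,7,8,9,10] (Forb 0 3
     [0,1,6,7,8,9,10,11,5,4,2,3] (Cut [1,5,7,10] [[0],[2,3,4],[6],[8,9],[11]])))))) (Cut
     [1,3,5,7,10] [[0],[2],[4],[6],[8,9],[11]]))) (Deg 6))) (Deg 0))) (Deg 0))))))))) (Deg
     11)))))))) (Case 3 11 (Forb 4 6 [0,1,2,3,11,5,4,6,7,8,9,10] (Forb 2 11
     [0,1,2,11,3,4,5,6,7,8,9,10] (Forb 2 9 [0,1,2,9,8,7,6,5,4,3,11,10] (Forb 2 4
     [0,1,2,4,3,11,5,6,7,8,9,10] (Forb 0 4 [0,1,2,3,11,10,9,8,7,6,5,4] (Case 8 11 (Forb 7 11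
     [0,1,2,3,4,5,6,7,11,8,9,10] (Forb 7 9 [0,1,2,3,4,5,6,7,9,8,11,10] (Forb 6 9
     [0,1,2,3,4,5,11,8,7,6,9,10] (Forb 4 7 [0,1,2,3,4,7,6,5,11,8,9,10] (Forb 2 7
     [0,1,2,7,6,5,4,3,11,8,9,10] (Forb 0 9 [0,1,2,3,4,5,6,7,8,11,10,9] (Case 1 4 (Forb 2 6
     [0,1,4,5,11,3,2,6,7,8,9,10] (Forb 0 7 [0,7,6,5,4,1,2,3,11,8,9,10] (Forb 0 2
     [0,1,4,5,6,7,8,9,10,11,3,2] (Cut [1,3,5,8,10] [[0],[2],[4],[6,7],[9],[11]])))) (Case 4 8
     (Forb 0 7 [0,1,2,3,4,8,9,10,11,5,6,7] (Case 4 10 (Case 1 9 (Forb 2 6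
     [0,1,9,8,7,6,2,3,4,5,11,10] (Forb 0 2 [0,1,9,8,7,6,5,4,10,11,3,2] (Cut [1,3,5,8,10]
     [[0],[2],[4],[6,7],[9],[11]]))) (Case 3 9 (Forb 2 6 [0,1,2,6,7,8,4,5,11,3,9,10] (Case 0 2
     (Forb 1 11 [0,1,11,5,6,7,8,4,10,9,3,2] (Forb 1 9 [0,1,9,8,7,6,5,4,10,11,3,2] (Forb 1 7
     [0,1,7,6,5,4,8,9,10,11,3,2] (Forb 1 6 [0,1,6,7,8,4,5,11,10,9,3,2] (Forb 1 4
     [0,1,4,5,6,7,8,9,10,11,3,2] (Cut [3,5,8,10] [[0,1,2],[4],[6,7],[9],[11]])))))) (Cut
     [1,3,5,8,10] [[0],[2],[4],[6,7],[9],[11]]))) (Deg 9))) (Deg 4))) (Deg 4))))))))) (Case 1 11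
     (Forb 2 6 [0,1,11,5,4,3,2,6,7,8,9,10] (Forb 0 9 [0,9,8,7,6,5,4,3,2,1,11,10] (Forb 0 2
     [0,1,11,10,9,8,7,6,5,4,3,2] (Case 0 7 (Forb 8 11 [0,7,6,5,4,3,2,1,11,8,9,10] (Forb 6 9
     [0,7,8,9,6,5,4,3,2,1,11,10] (Forb 6 8 [0,1,2,3,4,5,11,10,9,8,6,7] (Forb 4 8
     [0,1,2,3,4,8,9,10,11,5,6,7] (Forb 2 8 [0,1,2,8,9,10,11,3,4,5,6,7] (Forb 0 8
     [0,7,6,5,4,3,2,1,11,10,9,8] (Cut [1,3,5,7,10] [[0],[2],[4],[6],[8,9],[11]]))))))) (Case 0 8
     (Forb 7 11 [0,1,2,3,4,5,6,7,11,10,9,8] (Forb 7 9 [0,8,9,7,6,5,4,3,2,1,11,10] (Forb 6 9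
     [0,1,2,3,4,5,11,10,9,6,7,8] (Forb 4 7 [0,1,2,3,4,7,6,5,11,10,9,8] (Forb 2 7
     [0,1,2,7,6,5,4,3,11,10,9,8] (Forb 0 7 [0,7,6,5,4,3,2,1,11,10,9,8] (Cut [1,3,5,8,10]
     [[0],[2],[4],[6,7],[9],[11]]))))))) (Case 0 3 (Case 0 5 (Case 2 7 (Forb 8 11
     [0,1,2,7,6,5,4,3,11,8,9,10] (Forb 6 9 [0,1,2,7,8,9,6,5,4,3,11,10] (Forb 6 8
     [0,1,2,7,6,8,9,10,11,3,4,5] (Forb 4 8 [0,1,2,7,6,5,4,8,9,10,11,3] (Forb 2 8
     [0,1,11,3,4,5,6,7,2,8,9,10] (Forb 0 8 [0,1,2,7,6,5,4,3,11,10,9,8] (Cut [1,3,5,7,10]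
     [[0],[2],[4],[6],[8,9],[11]]))))))) (Case 2 8 (Forb 7 11 [0,1,2,8,9,10,11,7,6,5,4,3] (Forb
     7 9 [0,1,2,8,9,7,6,5,4,3,11,10] (Forb 6 9 [0,1,2,8,7,6,9,10,11,3,4,5] (Forb 4 7
     [0,1,2,8,9,10,11,3,4,7,6,5] (Forb 2 7 [0,1,11,3,4,5,6,7,2,8,9,10] (Forb 0 7
     [0,1,2,8,9,10,11,3,4,5,6,7] (Cut [1,3,5,8,10] [[0],[2],[4],[6,7],[9],[11]]))))))) (Case 4 7
     (Forb 8 11 [0,1,2,3,4,7,6,5,11,8,9,10] (Forb 6 9 [0,1,2,3,4,7,8,9,6,5,11,10] (Forb 6 8
     [0,1,2,3,4,7,6,8,9,10,11,5] (Forb 4 8 [0,1,2,3,11,5,6,7,4,8,9,10] (Forb 2 8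
     [0,1,2,8,9,10,11,3,4,7,6,5] (Forb 0 8 [0,1,2,3,4,7,6,5,11,10,9,8] (Cut [1,3,5,7,10]
     [[0],[2],[4],[6],[8,9],[11]]))))))) (Case 4 8 (Forb 7 11 [0,1,2,3,4,8,9,10,11,7,6,5] (Forb
     7 9 [0,1,2,3,4,8,9,7,6,5,11,10] (Forb 6 9 [0,1,2,3,4,8,7,6,9,10,11,5] (Forb 4 7
     [0,1,2,3,11,5,6,7,4,8,9,10] (Forb 2 7 [0,1,2,7,6,5,4,8,9,10,11,3] (Forb 0 7
     [0,1,2,3,4,8,9,10,11,5,6,7] (Cut [1,3,5,8,10] [[0],[2],[4],[6,7],[9],[11]]))))))) (Cut
     [1,3,5,10] [[0],[2],[4],[6,7,8,9],[11]]))))) (Deg 0)) (Deg 0))))))) (Deg 11)))))))) (Case 1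
     11 (Forb 2 11 [0,1,11,2,3,4,5,6,7,8,9,10] (Forb 2 6 [0,1,11,5,4,3,2,6,7,8,9,10] (Forb 0 9
     [0,9,8,7,6,5,4,3,2,1,11,10] (Forb 0 4 [0,4,3,2,1,11,5,6,7,8,9,10] (Forb 0 2
     [0,1,11,10,9,8,7,6,5,4,3,2] (Case 8 11 (Forb 7 11 [0,1,2,3,4,5,6,7,11,8,9,10] (Forb 7 9
     [0,1,2,3,4,5,6,7,9,8,11,10] (Forb 6 9 [0,1,2,3,4,5,11,8,7,6,9,10] (Forb 4 7
     [0,1,2,3,4,7,6,5,11,8,9,10] (Forb 2 9 [0,1,11,8,7,6,5,4,3,2,9,10] (Forb 0 7
     [0,7,6,5,4,3,2,1,11,8,9,10] (Case 0 3 (Forb 4 6 [0,3,2,1,11,5,4,6,7,8,9,10] (Forb 2 7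
     [0,3,4,5,6,7,2,1,11,8,9,10] (Forb 2 4 [0,1,11,10,9,8,7,6,5,4,2,3] (Cut [1,3,5,8,10]
     [[0],[2],[4],[6,7],[9],[11]])))) (Case 0 5 (Forb 4 6 [0,1,2,3,4,6,7,8,9,10,11,5] (Case 0 8
     (Case 3 9 (Forb 2 7 [0,1,2,7,6,5,4,3,9,8,11,10] (Forb 2 4 [0,1,2,4,3,9,8,7,6,5,11,10] (Cut
     [1,3,5,8,10] [[0],[2],[4],[6,7],[9],[11]]))) (Case 1 9 (Case 5 9 (Case 2 7 (Forb 4 10
     [0,1,9,5,6,7,2,3,4,10,11,8] (Forb 4 8 [0,1,9,5,6,7,2,3,4,8,11,10] (Forb 1 4
     [0,1,4,3,2,7,6,5,9,8,11,10] (Deg 4)))) (Case 2 4 (Forb 3 11 [0,1,2,4,3,11,5,6,7,8,9,10]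
     (Forb 3 9 [0,1,2,4,3,9,5,6,7,8,11,10] (Forb 3 7 [0,1,2,4,3,7,6,5,9,8,11,10] (Forb 3 6
     [0,1,2,4,3,6,7,8,9,5,11,10] (Forb 0 3 [0,1,9,10,11,8,7,6,5,4,2,3] (Cut [1,5,8,10]
     [[0],[2,3,4],[6,7],[9],[11]])))))) (Cut [1,3,5,8,10] [[0],[2],[4],[6,7],[9],[11]]))) (Deg
     9)) (Deg 9))) (Deg 0))) (Deg 0))))))))) (Deg 11))))))) (Deg 11)))))))) (Case 7 11 (Forb 8
     11 [0,1,2,3,4,5,6,7,11,8,9,10] (Forb 6 11 [0,1,2,3,4,5,6,11,7,8,9,10] (Forb 6 9
     [0,1,2,3,4,5,6,9,8,7,11,10] (Forb 0 8 [0,1,2,3,4,5,6,7,11,10,9,8] (Case 3 11 (Forb 4 11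
     [0,1,2,3,11,4,5,6,7,8,9,10] (Forb 4 8 [0,1,2,3,11,7,6,5,4,8,9,10] (Forb 2 11
     [0,1,2,11,3,4,5,6,7,8,9,10] (Forb 2 9 [0,1,2,9,8,7,6,5,4,3,11,10] (Forb 2 6
     [0,1,2,6,5,4,3,11,7,8,9,10] (Forb 0 4 [0,1,2,3,11,10,9,8,7,6,5,4] (Case 1 11 (Forb 2 8
     [0,1,11,7,6,5,4,3,2,8,9,10] (Forb 2 4 [0,1,11,3,2,4,5,6,7,8,9,10] (Forb 0 9
     [0,9,8,7,6,5,4,3,2,1,11,10] (Forb 0 6 [0,6,5,4,3,2,1,11,7,8,9,10] (Forb 0 2
     [0,1,11,10,9,8,7,6,5,4,3,2] (Case 0 5 (Forb 6 8 [0,5,4,3,2,1,11,7,6,8,9,10] (Forb 4 9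
     [0,5,6,7,8,9,4,3,2,1,11,10] (Forb 4 6 [0,1,2,3,11,10,9,8,7,6,4,5] (Cut [1,3,5,7,10]
     [[0],[2],[4],[6],[8,9],[11]])))) (Case 0 7 (Forb 6 8 [0,1,2,3,4,5,6,8,9,10,11,7] (Case 0 3
     (Case 2 5 (Forb 4 9 [0,1,2,5,6,7,8,9,4,3,11,10] (Forb 4 6 [0,1,2,5,4,6,7,8,9,10,11,3] (Cut
     [1,3,5,7,10] [[0],[2],[4],[6],[8,9],[11]]))) (Case 2 7 (Case 2 10 (Case 4 9 (Forb 6 10
     [0,1,2,3,11,7,8,9,4,5,6,10] (Forb 3 6 [0,1,2,3,6,5,4,9,8,7,11,10] (Forb 1 6
     [0,1,6,5,4,9,8,7,2,3,11,10] (Deg 6)))) (Case 4 6 (Forb 5 11 [0,1,2,3,4,6,5,11,7,8,9,10]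
     (Forb 5 9 [0,1,2,3,4,6,5,9,8,7,11,10] (Forb 5 8 [0,1,2,3,4,6,5,8,9,10,11,7] (Forb 2 5
     [0,1,2,5,4,6,7,8,9,10,11,3] (Forb 0 5 [0,1,2,3,11,10,9,8,7,6,4,5] (Cut [1,3,7,10]
     [[0],[2],[4,5,6],[8,9],[11]])))))) (Cut [1,3,5,7,10] [[0],[2],[4],[6],[8,9],[11]]))) (Deg
     2)) (Deg 2))) (Deg 0))) (Deg 0)))))))) (Deg 11)))))))) (Case 1 11 (Forb 2 11
     [0,1,11,2,3,4,5,6,7,8,9,10] (Forb 2 8 [0,1,11,7,6,5,4,3,2,8,9,10] (Forb 0 9
     [0,9,8,7,6,5,4,3,2,1,11,10] (Forb 0 6 [0,6,5,4,3,2,1,11,7,8,9,10] (Forb 0 2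
     [0,1,11,10,9,8,7,6,5,4,3,2] (Case 4 11 (Forb 5 11 [0,1,2,3,4,11,5,6,7,8,9,10] (Forb 5 8
     [0,1,2,3,4,11,7,6,5,8,9,10] (Forb 3 11 [0,1,2,3,11,4,5,6,7,8,9,10] (Forb 3 9
     [0,1,2,3,9,8,7,6,5,4,11,10] (Forb 3 6 [0,1,2,3,6,5,4,11,7,8,9,10] (Forb 2 5
     [0,1,11,4,3,2,5,6,7,8,9,10] (Forb 0 5 [0,1,2,3,4,11,10,9,8,7,6,5] (Forb 0 3
     [0,3,2,1,11,4,5,6,7,8,9,10] (Case 0 4 (Forb 3 8 [0,1,2,3,8,9,10,11,7,6,5,4] (Forb 3 5
     [0,1,2,3,5,6,7,8,9,10,11,4] (Case 0 7 (Forb 6 8 [0,1,2,3,4,5,6,8,9,10,11,7] (Case 1 3 (Forb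
     2 9 [0,1,3,2,9,8,7,6,5,4,11,10] (Forb 2 6 [0,1,3,2,6,5,4,11,7,8,9,10] (Case 5 9 (Forb 6 10
     [0,1,2,3,4,11,7,8,9,5,6,10] (Forb 4 6 [0,1,2,3,4,6,5,9,8,7,11,10] (Forb 1 6
     [0,4,3,2,1,6,5,9,8,7,11,10] (Deg 6)))) (Cut [1,4,7,10] [[0],[2,3],[5,6],[8,9],[11]]))))
     (Case 3 10 (Forb 2 9 [0,1,11,4,5,6,7,8,9,2,3,10] (Forb 2 6 [0,1,11,4,5,6,2,3,10,9,8,7]
     (Case 5 9 (Forb 6 10 [0,1,2,3,4,11,7,8,9,5,6,10] (Forb 4 6 [0,1,2,3,4,6,5,9,8,7,11,10]
     (Forb 1 6 [0,4,3,2,1,6,5,9,8,7,11,10] (Deg 6)))) (Cut [1,4,7,10]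
     [[0],[2,3],[5,6],[8,9],[11]])))) (Deg 3)))) (Deg 0)))) (Deg 0)))))))))) (Deg 11))))))) (Deg
     11))))))) (Case 3 11 (Forb 4 11 [0,1,2,3,11,4,5,6,7,8,9,10] (Forb 2 11
     [0,1,2,11,3,4,5,6,7,8,9,10] (Forb 2 9 [0,1,2,9,8,7,6,5,4,3,11,10] (Forb 0 4
     [0,1,2,3,11,10,9,8,7,6,5,4] (Case 6 11 (Forb 7 11 [0,1,2,3,4,5,6,11,7,8,9,10] (Forb 5 11
     [0,1,2,3,4,5,11,6,7,8,9,10] (Forb 5 9 [0,1,2,3,4,5,9,8,7,6,11,10] (Forb 4 7
     [0,1,2,3,11,6,5,4,7,8,9,10] (Forb 2 5 [0,1,2,5,4,3,11,6,7,8,9,10] (Forb 0 7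
     [0,1,2,3,4,5,6,11,10,9,8,7] (Case 1 11 (Forb 2 7 [0,1,11,6,5,4,3,2,7,8,9,10] (Forb 2 4
     [0,1,11,3,2,4,5,6,7,8,9,10] (Forb 0 9 [0,9,8,7,6,5,4,3,2,1,11,10] (Forb 0 5
     [0,5,4,3,2,1,11,6,7,8,9,10] (Forb 0 2 [0,1,11,10,9,8,7,6,5,4,3,2] (Case 0 8 (Forb 7 9
     [0,1,2,3,4,5,6,11,10,9,7,8] (Forb 5 7 [0,1,2,3,4,5,7,6,11,10,9,8] (Forb 4 9
     [0,1,2,3,11,10,9,4,5,6,7,8] (Cut [1,3,6,8,10] [[0],[2],[4,5],[7],[9],[11]])))) (Case 0 6
     (Forb 5 7 [0,1,2,3,4,5,7,8,9,10,11,6] (Case 0 3 (Case 2 8 (Forb 7 9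
     [0,1,2,8,7,9,10,11,3,4,5,6] (Forb 4 9 [0,1,2,8,7,6,5,4,9,10,11,3] (Cut [1,3,6,8,10]
     [[0],[2],[4,5],[7],[9],[11]]))) (Case 2 6 (Case 2 10 (Case 7 9 (Forb 8 11
     [0,1,2,3,4,5,6,7,9,8,11,10] (Forb 5 8 [0,1,2,3,4,5,8,7,9,10,11,6] (Forb 4 8
     [0,1,2,3,11,6,5,4,8,7,9,10] (Forb 2 8 [0,1,2,8,7,9,10,11,3,4,5,6] (Forb 0 8
     [0,1,2,3,4,5,6,11,10,9,7,8] (Case 4 9 (Forb 8 10 [0,1,2,3,11,6,5,4,9,7,8,10] (Forb 3 8
     [0,1,2,3,8,7,9,4,5,6,11,10] (Forb 1 8 [0,1,8,7,9,4,5,6,2,3,11,10] (Deg 8)))) (Cut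
     [1,3,6,10] [[0],[2],[4,5],[7,8,9],[11]]))))))) (Case 4 9 (Forb 3 7
     [0,1,2,3,7,8,9,4,5,6,11,10] (Forb 1 7 [0,1,7,8,9,4,5,6,2,3,11,10] (Deg 7))) (Cut
     [1,3,6,8,10] [[0],[2],[4,5],[7],[9],[11]]))) (Deg 2)) (Deg 2))) (Deg 0))) (Deg 0))))))))
     (Case 8 11 (Forb 7 9 [0,1,2,3,4,5,6,7,9,8,11,10] (Forb 5 7 [0,1,2,3,4,5,7,6,11,8,9,10]
     (Forb 4 9 [0,1,2,3,11,8,7,6,5,4,9,10] (Forb 2 7 [0,1,2,7,6,5,4,3,11,8,9,10] (Forb 0 9
     [0,1,2,3,4,5,6,7,8,11,10,9] (Case 1 7 (Forb 2 4 [0,1,7,6,5,4,2,3,11,8,9,10] (Forb 0 5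
     [0,5,4,3,2,1,7,6,11,8,9,10] (Forb 0 2 [0,1,7,8,9,10,11,6,5,4,3,2] (Cut [1,3,6,8,10]
     [[0],[2],[4,5],[7],[9],[11]])))) (Case 3 7 (Forb 2 4 [0,1,2,4,5,6,7,3,11,8,9,10] (Case 7 10
     (Case 1 9 (Forb 0 5 [0,5,4,3,2,1,9,8,7,6,11,10] (Forb 0 2 [0,1,9,8,7,10,11,6,5,4,3,2] (Cut
     [1,3,6,8,10] [[0],[2],[4,5],[7],[9],[11]]))) (Case 3 9 (Case 6 9 (Case 0 5 (Forb 2 10
     [0,1,2,10,7,6,9,8,11,3,4,5] (Forb 2 8 [0,1,2,8,7,6,9,10,11,3,4,5] (Forb 2 6
     [0,1,2,6,7,8,9,10,11,3,4,5] (Deg 2)))) (Case 0 2 (Forb 1 11 [0,1,11,8,7,10,9,6,5,4,3,2]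
     (Forb 1 9 [0,1,9,8,7,10,11,6,5,4,3,2] (Forb 1 7 [0,1,7,8,9,10,11,6,5,4,3,2] (Forb 1 5
     [0,2,1,5,4,3,7,6,9,8,11,10] (Forb 1 4 [0,1,4,5,6,7,8,9,10,11,3,2] (Cut [3,6,8,10]
     [[0,1,2],[4,5],[7],[9],[11]])))))) (Cut [1,3,6,8,10] [[0],[2],[4,5],[7],[9],[11]]))) (Deg
     9)) (Deg 9))) (Deg 7))) (Deg 7)))))))) (Deg 11))))))))) (Case 8 11 (Forb 7 11
     [0,1,2,3,4,5,6,7,11,8,9,10] (Forb 7 9 [0,1,2,3,4,5,6,7,9,8,11,10] (Forb 4 9
     [0,1,2,3,11,8,7,6,5,4,9,10] (Forb 2 7 [0,1,2,7,6,5,4,3,11,8,9,10] (Forb 0 9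
     [0,1,2,3,4,5,6,7,8,11,10,9] (Case 1 11 (Forb 2 4 [0,1,11,3,2,4,5,6,7,8,9,10] (Forb 0 7
     [0,7,6,5,4,3,2,1,11,8,9,10] (Forb 0 2 [0,1,11,10,9,8,7,6,5,4,3,2] (Case 0 5 (Forb 6 11
     [0,5,4,3,2,1,11,6,7,8,9,10] (Forb 6 9 [0,5,4,3,2,1,11,8,7,6,9,10] (Forb 4 7
     [0,5,6,7,4,3,2,1,11,8,9,10] (Forb 4 6 [0,1,2,3,11,10,9,8,7,6,4,5] (Forb 2 6
     [0,1,2,6,7,8,9,10,11,3,4,5] (Forb 0 6 [0,5,4,3,2,1,11,10,9,8,7,6] (Cut [1,3,5,8,10]
     [[0],[2],[4],[6,7],[9],[11]]))))))) (Case 0 6 (Forb 5 11 [0,1,2,3,4,5,11,10,9,8,7,6] (Forb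
     5 9 [0,1,2,3,4,5,9,10,11,8,7,6] (Forb 5 7 [0,6,7,5,4,3,2,1,11,8,9,10] (Forb 4 7
     [0,1,2,3,11,10,9,8,7,4,5,6] (Forb 2 5 [0,1,2,5,4,3,11,10,9,8,7,6] (Forb 0 5
     [0,5,4,3,2,1,11,10,9,8,7,6] (Cut [1,3,6,8,10] [[0],[2],[4,5],[7],[9],[11]]))))))) (Case 0 3
     (Case 0 8 (Case 2 5 (Forb 6 11 [0,1,2,5,4,3,11,6,7,8,9,10] (Forb 6 9
     [0,1,2,5,4,3,11,8,7,6,9,10] (Forb 4 7 [0,1,2,5,6,7,4,3,11,8,9,10] (Forb 4 6
     [0,1,2,5,4,6,7,8,9,10,11,3] (Forb 2 6 [0,1,11,3,4,5,2,6,7,8,9,10] (Forb 0 6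
     [0,1,2,5,4,3,11,10,9,8,7,6] (Cut [1,3,5,8,10] [[0],[2],[4],[6,7],[9],[11]]))))))) (Case 2 6
     (Forb 5 11 [0,1,2,6,7,8,9,10,11,5,4,3] (Forb 5 9 [0,1,2,6,7,8,9,5,4,3,11,10] (Forb 5 7
     [0,1,2,6,7,5,4,3,11,8,9,10] (Forb 4 7 [0,1,2,6,5,4,7,8,9,10,11,3] (Forb 2 5
     [0,1,11,3,4,5,2,6,7,8,9,10] (Forb 0 5 [0,1,2,6,7,8,9,10,11,3,4,5] (Cut [1,3,6,8,10]
     [[0],[2],[4,5],[7],[9],[11]]))))))) (Case 5 9 (Forb 6 11 [0,1,2,3,4,5,9,8,7,6,11,10] (Forb
     6 9 [0,1,2,3,4,5,9,6,7,8,11,10] (Forb 4 7 [0,1,2,3,4,7,6,5,9,8,11,10] (Forb 4 6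
     [0,1,2,3,11,8,7,6,4,5,9,10] (Forb 2 6 [0,1,2,6,7,8,9,5,4,3,11,10] (Forb 0 6
     [0,1,2,3,4,5,9,10,11,8,7,6] (Cut [1,3,5,8,10] [[0],[2],[4],[6,7],[9],[11]]))))))) (Case 6 9
     (Forb 5 11 [0,1,2,3,4,5,11,8,7,6,9,10] (Forb 5 9 [0,1,2,3,4,5,9,6,7,8,11,10] (Forb 5 7
     [0,1,2,3,4,5,7,6,9,8,11,10] (Forb 4 7 [0,1,2,3,11,8,7,4,5,6,9,10] (Forb 2 5
     [0,1,2,5,4,3,11,8,7,6,9,10] (Forb 0 5 [0,5,4,3,2,1,11,8,7,6,9,10] (Cut [1,3,6,8,10]
     [[0],[2],[4,5],[7],[9],[11]]))))))) (Cut [1,3,8,10] [[0],[2],[4,5,6,7],[9],[11]]))))) (Deg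
     0)) (Deg 0))))))) (Deg 11))))))) (Deg 11))))))) (Case 1 11 (Forb 2 11
     [0,1,11,2,3,4,5,6,7,8,9,10] (Forb 0 9 [0,9,8,7,6,5,4,3,2,1,11,10] (Forb 0 2
     [0,1,11,10,9,8,7,6,5,4,3,2] (Case 4 11 (Forb 5 11 [0,1,2,3,4,11,5,6,7,8,9,10] (Forb 3 11
     [0,1,2,3,11,4,5,6,7,8,9,10] (Forb 3 9 [0,1,2,3,9,8,7,6,5,4,11,10] (Forb 2 5
     [0,1,11,4,3,2,5,6,7,8,9,10] (Forb 0 5 [0,1,2,3,4,11,10,9,8,7,6,5] (Forb 0 3
     [0,3,2,1,11,4,5,6,7,8,9,10] (Case 6 11 (Forb 7 11 [0,1,2,3,4,5,6,11,7,8,9,10] (Forb 5 9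
     [0,1,2,3,4,5,9,8,7,6,11,10] (Forb 5 7 [0,1,2,3,4,11,6,5,7,8,9,10] (Forb 3 5
     [0,1,2,3,5,4,11,6,7,8,9,10] (Forb 2 7 [0,1,11,6,5,4,3,2,7,8,9,10] (Forb 0 7
     [0,1,2,3,4,5,6,11,10,9,8,7] (Case 0 8 (Forb 7 9 [0,1,2,3,4,5,6,11,10,9,7,8] (Forb 3 7
     [0,1,2,3,7,6,5,4,11,10,9,8] (Forb 2 9 [0,1,11,10,9,2,3,4,5,6,7,8] (Cut [1,4,6,8,10]
     [[0],[2,3],[5],[7],[9],[11]])))) (Case 0 4 (Forb 3 7 [0,1,2,3,7,8,9,10,11,6,5,4] (Case 0 6
     (Case 5 8 (Forb 7 9 [0,1,2,3,4,5,8,7,9,10,11,6] (Forb 2 9 [0,1,11,6,7,8,5,4,3,2,9,10] (Cut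
     [1,4,6,8,10] [[0],[2,3],[5],[7],[9],[11]]))) (Case 1 5 (Forb 2 9
     [0,1,5,4,3,2,9,8,7,6,11,10] (Case 7 9 (Forb 8 11 [0,1,2,3,4,5,6,7,9,8,11,10] (Forb 5 8
     [0,1,2,3,4,5,8,7,9,10,11,6] (Forb 3 8 [0,1,2,3,8,7,9,10,11,4,5,6] (Forb 2 8
     [0,1,5,4,3,2,8,7,9,10,11,6] (Forb 0 8 [0,1,2,3,4,5,6,11,10,9,7,8] (Cut [1,4,6,10]
     [[0],[2,3],[5],[7,8,9],[11]])))))) (Cut [1,4,6,8,10] [[0],[2,3],[5],[7],[9],[11]]))) (Deg
     5))) (Deg 0))) (Deg 0))))))))) (Case 8 11 (Forb 7 11 [0,1,2,3,4,5,6,7,11,8,9,10] (Forb 7 9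
     [0,1,2,3,4,5,6,7,9,8,11,10] (Forb 5 9 [0,1,2,3,4,11,8,7,6,5,9,10] (Forb 3 7
     [0,1,2,3,7,6,5,4,11,8,9,10] (Forb 2 9 [0,1,11,8,7,6,5,4,3,2,9,10] (Forb 0 7
     [0,7,6,5,4,3,2,1,11,8,9,10] (Case 0 6 (Forb 5 7 [0,1,2,3,4,11,10,9,8,7,5,6] (Forb 3 5
     [0,1,2,3,5,4,11,10,9,8,7,6] (Forb 2 7 [0,1,11,10,9,8,7,2,3,4,5,6] (Cut [1,4,6,8,10]
     [[0],[2,3],[5],[7],[9],[11]])))) (Case 0 4 (Forb 3 5 [0,1,2,3,5,6,7,8,9,10,11,4] (Case 0 8
     (Case 6 9 (Forb 5 7 [0,1,2,3,4,5,7,6,9,8,11,10] (Forb 2 7 [0,1,11,8,7,2,3,4,5,6,9,10] (Cut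
     [1,4,6,8,10] [[0],[2,3],[5],[7],[9],[11]]))) (Case 1 9 (Case 4 9 (Case 2 6 (Forb 5 7
     [0,1,9,4,3,2,6,5,7,8,11,10] (Case 2 7 (Forb 3 8 [0,1,9,4,5,6,7,2,3,8,11,10] (Forb 3 6
     [0,1,9,4,5,6,3,2,7,8,11,10] (Forb 1 3 [0,1,3,2,7,6,5,4,9,8,11,10] (Deg 3)))) (Cut
     [1,4,6,8,10] [[0],[2,3],[5],[7],[9],[11]]))) (Case 2 7 (Forb 3 8
     [0,1,9,4,5,6,7,2,3,8,11,10] (Forb 3 6 [0,1,9,4,5,6,3,2,7,8,11,10] (Forb 1 3
     [0,1,3,2,7,6,5,4,9,8,11,10] (Deg 3)))) (Case 3 6 (Forb 5 7 [0,1,2,3,6,5,7,8,9,4,11,10]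
     (Forb 2 7 [0,1,9,4,5,6,3,2,7,8,11,10] (Cut [1,4,6,8,10] [[0],[2,3],[5],[7],[9],[11]])))
     (Cut [1,4,8,10] [[0],[2,3],[5,6,7],[9],[11]])))) (Deg 9)) (Deg 9))) (Deg 0))) (Deg
     0))))))))) (Deg 11))))))))) (Case 6 11 (Forb 7 11 [0,1,2,3,4,5,6,11,7,8,9,10] (Forb 5 11
     [0,1,2,3,4,5,11,6,7,8,9,10] (Forb 5 9 [0,1,2,3,4,5,9,8,7,6,11,10] (Forb 2 7
     [0,1,11,6,5,4,3,2,7,8,9,10] (Forb 0 7 [0,1,2,3,4,5,6,11,10,9,8,7] (Forb 0 5
     [0,5,4,3,2,1,11,6,7,8,9,10] (Case 8 11 (Forb 7 9 [0,1,2,3,4,5,6,7,9,8,11,10] (Forb 5 7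
     [0,1,2,3,4,5,7,6,11,8,9,10] (Forb 2 9 [0,1,11,8,7,6,5,4,3,2,9,10] (Case 0 3 (Forb 4 11
     [0,3,2,1,11,4,5,6,7,8,9,10] (Forb 4 9 [0,3,2,1,11,8,7,6,5,4,9,10] (Forb 4 7
     [0,3,2,1,11,6,5,4,7,8,9,10] (Forb 2 5 [0,3,4,5,2,1,11,6,7,8,9,10] (Forb 2 4
     [0,1,11,10,9,8,7,6,5,4,2,3] (Forb 0 4 [0,3,2,1,11,10,9,8,7,6,5,4] (Cut [1,3,6,8,10]
     [[0],[2],[4,5],[7],[9],[11]]))))))) (Case 0 4 (Forb 3 11 [0,1,2,3,11,10,9,8,7,6,5,4] (Forb
     3 9 [0,1,2,3,9,10,11,8,7,6,5,4] (Forb 3 7 [0,1,2,3,7,8,9,10,11,6,5,4] (Forb 3 5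
     [0,4,5,3,2,1,11,6,7,8,9,10] (Forb 2 5 [0,1,11,10,9,8,7,6,5,2,3,4] (Forb 0 3
     [0,3,2,1,11,10,9,8,7,6,5,4] (Cut [1,4,6,8,10] [[0],[2,3],[5],[7],[9],[11]]))))))) (Case 0 6
     (Case 0 8 (Case 3 7 (Forb 4 11 [0,1,2,3,7,6,5,4,11,8,9,10] (Forb 4 9
     [0,1,2,3,7,6,5,4,9,8,11,10] (Forb 4 7 [0,1,2,3,7,4,5,6,11,8,9,10] (Forb 2 5
     [0,1,2,5,4,3,7,6,11,8,9,10] (Forb 2 4 [0,1,11,6,5,4,2,3,7,8,9,10] (Forb 0 4
     [0,1,2,3,7,8,9,10,11,6,5,4] (Cut [1,3,6,8,10] [[0],[2],[4,5],[7],[9],[11]]))))))) (Case 4 7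
     (Forb 3 11 [0,1,2,3,11,6,5,4,7,8,9,10] (Forb 3 9 [0,1,2,3,9,8,7,4,5,6,11,10] (Forb 3 7
     [0,1,2,3,7,4,5,6,11,8,9,10] (Forb 3 5 [0,1,2,3,5,4,7,6,11,8,9,10] (Forb 2 5
     [0,1,11,6,5,2,3,4,7,8,9,10] (Forb 0 3 [0,3,2,1,11,6,5,4,7,8,9,10] (Cut [1,4,6,8,10]
     [[0],[2,3],[5],[7],[9],[11]]))))))) (Case 3 9 (Forb 4 11 [0,1,2,3,9,8,7,6,5,4,11,10] (Forb
     4 9 [0,1,2,3,9,4,5,6,7,8,11,10] (Forb 4 7 [0,1,2,3,9,8,7,4,5,6,11,10] (Forb 2 5
     [0,1,2,5,4,3,9,8,7,6,11,10] (Forb 2 4 [0,1,11,8,7,6,5,4,2,3,9,10] (Forb 0 4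
     [0,1,2,3,9,10,11,8,7,6,5,4] (Cut [1,3,6,8,10] [[0],[2],[4,5],[7],[9],[11]]))))))) (Case 4 9
     (Forb 3 11 [0,1,2,3,11,8,7,6,5,4,9,10] (Forb 3 9 [0,1,2,3,9,4,5,6,7,8,11,10] (Forb 3 7
     [0,1,2,3,7,6,5,4,9,8,11,10] (Forb 3 5 [0,1,2,3,5,4,9,8,7,6,11,10] (Forb 2 5
     [0,1,11,8,7,6,5,2,3,4,9,10] (Forb 0 3 [0,3,2,1,11,8,7,6,5,4,9,10] (Cut [1,4,6,8,10]
     [[0],[2,3],[5],[7],[9],[11]]))))))) (Cut [1,6,8,10] [[0],[2,3,4,5],[7],[9],[11]]))))) (Deg
     0)) (Deg 0))))))) (Deg 11)))))))) (Deg 11)))))) (Case 4 11 (Forb 5 11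
     [0,1,2,3,4,11,5,6,7,8,9,10] (Forb 3 11 [0,1,2,3,11,4,5,6,7,8,9,10] (Forb 3 9
     [0,1,2,3,9,8,7,6,5,4,11,10] (Forb 0 5 [0,1,2,3,4,11,10,9,8,7,6,5] (Case 6 11 (Forb 7 11
     [0,1,2,3,4,5,6,11,7,8,9,10] (Forb 5 9 [0,1,2,3,4,5,9,8,7,6,11,10] (Forb 5 7
     [0,1,2,3,4,11,6,5,7,8,9,10] (Forb 3 5 [0,1,2,3,5,4,11,6,7,8,9,10] (Forb 0 7
     [0,1,2,3,4,5,6,11,10,9,8,7] (Case 8 11 (Forb 7 9 [0,1,2,3,4,5,6,7,9,8,11,10] (Forb 3 7
     [0,1,2,3,7,6,5,4,11,8,9,10] (Forb 0 9 [0,1,2,3,4,5,6,7,8,11,10,9] (Case 1 5 (Forb 2 11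
     [0,1,5,4,3,2,11,6,7,8,9,10] (Forb 2 9 [0,1,5,4,3,2,9,8,7,6,11,10] (Forb 2 7
     [0,1,5,4,3,2,7,6,11,8,9,10] (Forb 2 5 [0,1,5,2,3,4,11,6,7,8,9,10] (Forb 0 3
     [0,3,2,1,5,4,11,6,7,8,9,10] (Forb 0 2 [0,1,5,6,7,8,9,10,11,4,3,2] (Cut [1,4,6,8,10]
     [[0],[2,3],[5],[7],[9],[11]]))))))) (Case 2 5 (Forb 1 11 [0,1,11,4,3,2,5,6,7,8,9,10] (Forb
     1 9 [0,1,9,8,7,6,5,2,3,4,11,10] (Forb 1 7 [0,1,7,6,5,2,3,4,11,8,9,10] (Forb 1 5
     [0,1,5,2,3,4,11,6,7,8,9,10] (Forb 1 3 [0,1,3,2,5,4,11,6,7,8,9,10] (Forb 0 3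
     [0,1,2,5,6,7,8,9,10,11,4,3] (Cut [2,4,6,8,10] [[0,1],[3],[5],[7],[9],[11]]))))))) (Case 5 8
     (Case 5 10 (Case 1 7 (Forb 2 11 [0,1,7,6,5,4,3,2,11,8,9,10] (Forb 2 9
     [0,1,7,6,5,4,3,2,9,8,11,10] (Forb 2 7 [0,1,7,2,3,4,5,6,11,8,9,10] (Forb 2 5
     [0,1,7,6,5,2,3,4,11,8,9,10] (Forb 0 3 [0,3,2,1,7,6,5,4,11,8,9,10] (Forb 0 2
     [0,1,7,6,5,8,9,10,11,4,3,2] (Cut [1,4,6,8,10] [[0],[2,3],[5],[7],[9],[11]]))))))) (Case 2 7
     (Forb 1 11 [0,1,11,4,3,2,7,6,5,8,9,10] (Forb 1 9 [0,1,9,8,5,4,3,2,7,6,11,10] (Forb 1 7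
     [0,1,7,2,3,4,5,6,11,8,9,10] (Forb 1 5 [0,1,5,4,3,2,7,6,11,8,9,10] (Forb 1 3
     [0,1,3,2,7,6,5,4,11,8,9,10] (Forb 0 3 [0,1,2,7,6,5,8,9,10,11,4,3] (Cut [2,4,6,8,10]
     [[0,1],[3],[5],[7],[9],[11]]))))))) (Case 1 9 (Forb 2 11 [0,1,9,8,7,6,5,4,3,2,11,10] (Forb
     2 9 [0,1,9,2,3,4,5,6,7,8,11,10] (Forb 2 7 [0,1,9,8,5,4,3,2,7,6,11,10] (Forb 2 5
     [0,1,9,8,7,6,5,2,3,4,11,10] (Forb 0 3 [0,3,2,1,9,8,7,6,5,4,11,10] (Forb 0 2
     [0,1,9,8,7,6,5,10,11,4,3,2] (Cut [1,4,6,8,10] [[0],[2,3],[5],[7],[9],[11]]))))))) (Case 2 9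
     (Forb 1 11 [0,1,11,4,3,2,9,8,7,6,5,10] (Forb 1 9 [0,1,9,2,3,4,5,6,7,8,11,10] (Forb 1 7
     [0,1,7,6,5,4,3,2,9,8,11,10] (Forb 1 5 [0,1,5,4,3,2,9,8,7,6,11,10] (Forb 1 3
     [0,1,3,2,9,8,7,6,5,4,11,10] (Forb 0 3 [0,1,2,9,8,7,6,5,10,11,4,3] (Cut [2,4,6,8,10]
     [[0,1],[3],[5],[7],[9],[11]]))))))) (Cut [4,6,8,10] [[0,1,2,3],[5],[7],[9],[11]]))))) (Deg
     5)) (Deg 5))))))) (Deg 11))))))) (Deg 11)))))) (Deg 11))))))))]]"

text \<open>Every certificate starts from the chord between \<open>0\<close> and
  \<open>l - 1\<close> alone. The offsets 6 and 5 in the indexing come from \<open>5 \<le> l\<close>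
  and \<open>l < n\<close>. For \<open>n = 6\<close> and \<open>l = 5\<close> the reasoning is: an
  edge between 3 and 5 would give the path \<open>[0,1,2,3,5,4]\<close> whose head is joined to
  position 5, and an edge between 0 and 5 is itself such a chord; so the vertex 5 is left with the
  neighbours 1, 2, 4 at most. No certificates could cover \<open>n = 13\<close>, because the
  extremal graph below is tough, has minimum degree 4 and is not Hamiltonian.\<close>

lemma no_maximal_lollipop:
  assumes "maximal_lollipop n l E" "E 0 (l - 1)" "5 \<le> l" "l < n" "n \<le> 12"
  shows False
proof -
  have "\<forall>n \<in> set [6..<13]. \<forall>l \<in> set [5..<n].
      check n l [(0, l - 1)] [] (certificates ! (n - 6) ! (l - 5))"
    by code_simp
  moreover have "n \<in> set [6..<13]" "l \<in> set [5..<n]"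
    using assms(3-5) unfolding set_upt by auto
  ultimately have "check n l [(0, l - 1)] [] (certificates ! (n - 6) ! (l - 5))" by blast
  then show False
    by (rule maximal_lollipop.check_unsound[OF assms(1)]) (use assms(2) in auto)
qed

theorem tough_imp_hamilton_cycle:
  fixes E :: "'a \<Rightarrow> 'a \<Rightarrow> bool"
  assumes "finite V" "V \<noteq> {}" "symp E" "card V \<le> 12" "tough_on E V"
    and "\<And>v. v \<in> V \<Longrightarrow> 4 \<le> card {w \<in> V. w \<noteq> v \<and> E v w}"
  obtains q where "hamilton_path E V q" "E (last q) (hd q)"
proof (rule ccontr)
  assume "\<not> thesis"
  then have "\<nexists>q. hamilton_path E V q \<and> E (last q) (hd q)" using that by blast
  then obtain l D where "5 \<le> l" "l < card V" "maximal_lollipop (card V) l D" "D 0 (l - 1)"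
    using ex_maximal_lollipop[OF assms(1-3,6,5)] by blast
  then show False using no_maximal_lollipop assms(4) by blast
qed

section \<open>The lower bound\<close>

text \<open>When vertices with equal labels are always connected, one vertex chosen for each label
  meets every component. This is the direction used to prove a graph tough.\<close>

lemma (in sym_digraph) card_components_le:
  assumes "finite (verts G)"
    and "\<And>u v. u \<in> verts G \<Longrightarrow> v \<in> verts G \<Longrightarrow> g u = g v \<Longrightarrow> u \<rightarrow>\<^sup>* v"
  shows "card sccs \<le> card (g ` verts G)"
proof -
  have "sccs_verts \<subseteq> (\<lambda>k. scc_of (SOME x. x \<in> verts G \<and> g x = k)) ` g ` verts G"
  proof
    fix C assume C: "C \<in> sccs_verts"
    then obtain x where x: "x \<in> C" by (auto simp: in_sccs_verts_conv_reachable)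
    then have "x \<rightarrow>\<^sup>* x" using C by (simp add: in_sccs_verts_conv_reachable)
    then have xv: "x \<in> verts G" by (rule reachable_in_verts)
    define y where "y = (SOME y. y \<in> verts G \<and> g y = g x)"
    have y: "y \<in> verts G \<and> g y = g x" unfolding y_def by (rule someI[of _ x]) (use xv in simp)
    then have yx: "y \<rightarrow>\<^sup>* x" "x \<rightarrow>\<^sup>* y" using assms(2) xv by metis+
    have "C = scc_of y"
    proof (intro set_eqI iffI)
      fix z assume "z \<in> C"
      then have "x \<rightarrow>\<^sup>* z" "z \<rightarrow>\<^sup>* x" using C x by (auto simp: in_sccs_verts_conv_reachable)
      then show "z \<in> scc_of y" using yx by (auto simp: scc_of_def intro: reachable_trans)
    next
      fix z assume "z \<in> scc_of y"
      then have "x \<rightarrow>\<^sup>* z" "z \<rightarrow>\<^sup>* x" using yx by (auto simp: scc_of_def intro: reachable_trans)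
      then show "z \<in> C" using C x unfolding in_sccs_verts_conv_reachable by blast
    qed
    then show "C \<in> (\<lambda>k. scc_of (SOME x. x \<in> verts G \<and> g x = k)) ` g ` verts G"
      using xv unfolding y_def by blast
  qed
  then have "card sccs_verts \<le> card (g ` verts G)" using assms(1) by (intro surj_card_le) auto
  then show ?thesis by (simp add: card_sccs_verts)
qed

text \<open>A label that is constant along arcs is constant on components, so one vertex chosen from
  each component already shows every label. This is the direction used to exploit toughness.\<close>

lemma (in sym_digraph) card_components_ge:
  assumes "finite (verts G)" and f: "\<And>u v. u \<rightarrow> v \<Longrightarrow> f u = f v"
  shows "card (f ` verts G) \<le> card sccs"
proof -
  have reach: "f u = f v" if "u \<rightarrow>\<^sup>* v" for u v
    using that by (induction rule: reachable_induct) (use f in auto)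
  have "f ` verts G \<subseteq> (\<lambda>C. f (SOME x. x \<in> C)) ` sccs_verts"
  proof
    fix k assume "k \<in> f ` verts G"
    then obtain v where v: "v \<in> verts G" "k = f v" by blast
    then have vC: "v \<in> scc_of v" by (simp add: scc_of_def)
    have "(SOME x. x \<in> scc_of v) \<in> scc_of v" using vC by (rule someI)
    then have "f (SOME x. x \<in> scc_of v) = k" using reach v(2) by (auto simp: scc_of_def)
    moreover have "scc_of v \<in> sccs_verts"
      unfolding in_sccs_verts_conv_reachable using vC
      by (auto simp: scc_of_def intro: reachable_trans)
    ultimately show "k \<in> (\<lambda>C. f (SOME x. x \<in> C)) ` sccs_verts" by blast
  qed
  moreover have "sccs_verts \<subseteq> Pow (verts G)"
  proof (intro subsetI PowI)
    fix C x assume "C \<in> sccs_verts" "x \<in> C"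
    then have "x \<rightarrow>\<^sup>* x" by (simp add: in_sccs_verts_conv_reachable)
    then show "x \<in> verts G" by (rule reachable_in_verts)
  qed
  then have "finite sccs_verts" using assms(1) finite_subset by blast
  ultimately have "card (f ` verts G) \<le> card sccs_verts" by (intro surj_card_le) auto
  then show ?thesis by (simp add: card_sccs_verts)
qed

section \<open>Passing between graphs and symmetric relations\<close>

context graph
begin

lemma sym_digraph_induce: "sym_digraph (G \<restriction> W)"
proof -
  have "symmetric (G \<restriction> W)"
    using sym_arcs unfolding symmetric_conv by (auto dest!: bspec)
  then show ?thesis by (intro wf_digraph.sym_digraphI wellformed_induce_subgraph)
qed

lemma dominates_induce_iff: "u \<rightarrow>\<^bsub>G \<restriction> W\<^esub> v \<longleftrightarrow> u \<rightarrow> v \<and> u \<in> W \<and> v \<in> W"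
  by (auto simp: arcs_ends_conv)

lemma tough_imp_tough_on:
  assumes "tough G"
  shows "tough_on (dominates G) (verts G)"
  unfolding tough_on_def
proof (intro allI impI, elim conjE)
  fix S and f :: "'a \<Rightarrow> nat"
  assume S: "S \<subseteq> verts G" "S \<noteq> {}"
    and f: "\<forall>a\<in>verts G - S. \<forall>b\<in>verts G - S. a \<rightarrow> b \<longrightarrow> f a = f b"
  interpret H: sym_digraph "G \<restriction> (verts G - S)" by (rule sym_digraph_induce)
  have "card (f ` verts (G \<restriction> (verts G - S))) \<le> card H.sccs"
    by (rule H.card_components_ge) (use f in \<open>auto simp: dominates_induce_iff\<close>)
  also have "\<dots> \<le> card S" using assms S by (simp add: tough_def)
  finally show "card (f ` (verts G - S)) \<le> card S" by simp
qed

text \<open>Without parallel arcs \<open>head G\<close> is injective on the arcs leaving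
  \<open>v\<close>, and without loops it never takes the value \<open>v\<close>.\<close>

lemma degree_eq_card_neighbours: "degree G v = card {w \<in> verts G. w \<noteq> v \<and> v \<rightarrow>\<^bsub>G\<^esub> w}"
proof -
  have "head G ` out_arcs G v = {w \<in> verts G. w \<noteq> v \<and> v \<rightarrow>\<^bsub>G\<^esub> w}"
    using no_loops by (force simp: arcs_ends_conv out_arcs_def)
  moreover have "inj_on (head G) (out_arcs G v)"
    by (rule inj_onI) (auto intro!: no_multi_arcs simp: arc_to_ends_def out_arcs_def)
  ultimately show ?thesis unfolding out_degree_def by (metis card_image)
qed

text \<open>Arcs are objects of their own, not pairs of vertices, so an arc has to be picked for
  each consecutive pair of \<open>q\<close>.\<close>

lemma ex_awalk_of_hamilton_path:
  assumes "q \<noteq> []" "successively (dominates G) q" "set q \<subseteq> verts G"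
  shows "\<exists>p. awalk (hd q) p (last q) \<and> awalk_verts (hd q) p = q"
  using assms
proof (induction q rule: induct_list012)
  case (2 x)
  then show ?case by (intro exI[of _ "[]"]) (auto simp: awalk_Nil_iff)
next
  case (3 x y zs)
  then obtain p where "awalk y p (last (y # zs))" "awalk_verts y p = y # zs" by auto
  moreover obtain e where "e \<in> arcs G" "tail G e = x" "head G e = y"
    using 3 by (auto simp: arcs_ends_conv)
  ultimately show ?case by (intro exI[of _ "e # p"]) (auto simp: awalk_Cons_iff)
qed simp

lemma hamiltonian_of_hamilton_path:
  assumes q: "hamilton_path (dominates G) (verts G) q" "last q \<rightarrow> hd q" and "3 \<le> card (verts G)"
  shows "hamiltonian G"
proof -
  have "distinct q" "set q = verts G" using q(1) by (auto simp: hamilton_path_def)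
  then have len: "length q = card (verts G)" "distinct q" "set q = verts G"
    by (auto dest: distinct_card)
  then have ne: "q \<noteq> []" using assms(3) by auto
  then obtain p where p: "awalk (hd q) p (last q)" "awalk_verts (hd q) p = q"
    using q(1) ex_awalk_of_hamilton_path[of q] by (auto simp: hamilton_path_def)
  obtain e where e: "e \<in> arcs G" "tail G e = last q" "head G e = hd q"
    using q(2) by (auto simp: arcs_ends_conv)
  have w: "awalk (hd q) (p @ [e]) (hd q)" using p(1) e by (auto simp: awalk_Cons_iff awalk_Nil_iff)
  have verts: "awalk_verts (hd q) (p @ [e]) = q @ [hd q]"
    using p e by (subst awalk_verts_append[OF w]) auto
  \<comment> \<open>The tails of the arcs, read in order, are exactly \<open>q\<close>; this gives
    both the length of the cycle and the set of vertices it visits.\<close>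
  have "map (tail G) (p @ [e]) @ [hd q] = q @ [hd q]"
    using verts e(3) by (subst (asm) awalk_verts_conv) simp
  then have tails: "map (tail G) (p @ [e]) = q" by simp
  have "cycle (p @ [e])"
    unfolding cycle_def
  proof (intro exI conjI)
    show "distinct (tl (awalk_verts (hd q) (p @ [e])))"
      unfolding verts using len(2) ne by (cases q) auto
  qed (use w in auto)
  moreover have "length (p @ [e]) = card (verts G)" using len(1) tails by (metis length_map)
  moreover have "tail G ` set (p @ [e]) = verts G" using len(3) tails by (metis set_map)
  ultimately show ?thesis using assms(3) unfolding hamiltonian_def by metis
qed

end

lemma barnacle_free_harris_graph_order:
  assumes "harris_graph G" "barnacle_free G"
  shows "13 \<le> card (verts G)"
proof (rule ccontr)
  assume "\<not> 13 \<le> card (verts G)"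
  have G: "graph G" "tough G" "eulerian G" "\<not> hamiltonian G"
    using assms(1) by (auto simp: harris_graph_def)
  interpret graph G by fact
  have "connected G" using G(2) by (simp add: tough_def)
  then have ne: "verts G \<noteq> {}" by (auto simp: connected_def strongly_connected_def)
  have deg: "4 \<le> degree G v" if v: "v \<in> verts G" for v
  proof -
    have "degree G v \<noteq> 2" using assms(2) v barnacle_free_iff_no_degree_2[OF G(1)] by blast
    moreover have "degree G v \<noteq> 0"
    proof
      assume "degree G v = 0"
      then have iso: "out_arcs G v = {}"
        using finite_out_arcs by (simp add: out_degree_def)
      \<comment> \<open>A single vertex is the one connected graph with a vertex of degree 0; it is
        excluded here by the convention that it counts as Hamiltonian.\<close>
      have "card (verts G) \<noteq> 1" using G(4) by (auto simp: hamiltonian_def)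
      then obtain w where w: "w \<in> verts G" "w \<noteq> v"
        using v by (metis is_singletonI' is_singleton_altdef empty_iff)
      have "strongly_connected G"
        using \<open>connected G\<close> sym_arcs by (intro symmetric_connected_imp_strongly_connected)
      then have "v \<rightarrow>\<^sup>*\<^bsub>G\<^esub> w" using v w by auto
      then obtain x where "v \<rightarrow>\<^bsub>G\<^esub> x" using w(2) by (metis converse_reachable_cases)
      then show False using iso by (auto simp: arcs_ends_conv)
    qed
    moreover have "even (degree G v)" using G(3) v by (simp add: eulerian_def)
    ultimately show ?thesis by presburger
  qed
  have "symp (dominates G)" using graph_symmetric by (auto simp: symp_def)
  then obtain q where "hamilton_path (dominates G) (verts G) q" "last q \<rightarrow>\<^bsub>G\<^esub> hd q"
  proof (rule tough_imp_hamilton_cycle[OF finite_verts ne])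
    show "card (verts G) \<le> 12" using \<open>\<not> 13 \<le> card (verts G)\<close> by simp
    show "tough_on (dominates G) (verts G)" using G(2) by (rule tough_imp_tough_on)
    show "4 \<le> card {w \<in> verts G. w \<noteq> v \<and> v \<rightarrow>\<^bsub>G\<^esub> w}" if "v \<in> verts G" for v
      using deg[OF that] by (simp add: degree_eq_card_neighbours)
  qed
  moreover have "3 \<le> card (verts G)"
  proof -
    obtain v where "v \<in> verts G" using ne by blast
    then have "4 \<le> card {w \<in> verts G. w \<noteq> v \<and> v \<rightarrow>\<^bsub>G\<^esub> w}" using deg degree_eq_card_neighbours by simp
    also have "\<dots> \<le> card (verts G)" by (intro card_mono) auto
    finally show ?thesis by simp
  qed
  ultimately show False using hamiltonian_of_hamilton_path G(4) by blast
qed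

section \<open>The extremal graph\<close>

text \<open>The extremal graph: three universal vertices \<open>0, 1, 2\<close> joined to the net, formed by the
  triangle \<open>3, 4, 5\<close> with pendant vertices \<open>6, 7, 8\<close>, and to the two edges \<open>9 - 10\<close> and \<open>11 - 12\<close>.\<close>

definition inner_edges :: "(nat \<times> nat) set" where
  "inner_edges = {(3, 4), (4, 5), (3, 5), (3, 6), (4, 7), (5, 8), (9, 10), (11, 12)}"

definition extremal_graph :: "(nat, nat \<times> nat) pre_digraph" where
  "extremal_graph = \<lparr>verts = {..<13},
     arcs = {(u, v) \<in> {..<13} \<times> {..<13}. u \<noteq> v \<and> (u < 3 \<or> v < 3)} \<union> inner_edges \<union> inner_edges\<inverse>,
     tail = fst, head = snd\<rparr>"

lemma extremal_graph_simps [simp]: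
  "verts extremal_graph = {..<13}" "tail extremal_graph = fst" "head extremal_graph = snd"
  by (simp_all add: extremal_graph_def)

lemma inner_edges_bounds: "(u, v) \<in> inner_edges \<Longrightarrow> 3 \<le> u \<and> u < v \<and> v < 13"
  by (auto simp: inner_edges_def)

lemma arc_extremal_graph_iff:
  "(u, v) \<in> arcs extremal_graph \<longleftrightarrow>
     u < 13 \<and> v < 13 \<and> u \<noteq> v \<and> (u < 3 \<or> v < 3 \<or> (u, v) \<in> inner_edges \<or> (v, u) \<in> inner_edges)"
  using inner_edges_bounds[of u v] inner_edges_bounds[of v u] by (auto simp: extremal_graph_def)

lemma dominates_extremal_graph_iff:
  "u \<rightarrow>\<^bsub>extremal_graph\<^esub> v \<longleftrightarrow> (u, v) \<in> arcs extremal_graph"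
  by (force simp: arcs_ends_conv)

lemma graph_extremal_graph: "graph extremal_graph"
proof -
  have "finite (arcs extremal_graph)"
    by (rule finite_subset[of _ "{..<13} \<times> {..<13}"]) (auto simp: arc_extremal_graph_iff)
  then interpret digraph extremal_graph
    by unfold_locales (auto simp: arc_extremal_graph_iff arc_to_ends_def)
  show ?thesis by (rule graphI) 
      (auto simp: symmetric_def sym_def dominates_extremal_graph_iff arc_extremal_graph_iff)
qed

section \<open>Degrees and toughness of the extremal graph\<close>

text \<open>Apart from the three universal vertices, a triangle vertex has three neighbours (two in
  the triangle, one pendant), while a pendant vertex or an end of a single edge has one. So all
  degrees are even and none is 2.\<close>

lemma degree_extremal_graph:
  assumes "v < 13"
  shows "degree extremal_graph v = (if v < 3 then 12 else if v < 6 then 6 else 4)"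
proof -
  let ?nbs = "\<lambda>v. filter (\<lambda>w. v \<noteq> w \<and>
    (v < 3 \<or> w < 3 \<or> (v, w) \<in> inner_edges \<or> (w, v) \<in> inner_edges)) [0..<13]"
  have "\<forall>v \<in> set [0..<13]. length (?nbs v) = (if v < 3 then 12 else if v < 6 then 6 else 4)"
    by code_simp
  moreover have "out_arcs extremal_graph v = Pair v ` set (?nbs v)"
    using assms by (auto simp: out_arcs_def arc_extremal_graph_iff)
  then have "out_degree extremal_graph v = length (?nbs v)"
    unfolding out_degree_def by (simp add: card_image inj_on_def distinct_card del: set_filter)
  ultimately show ?thesis using assms by auto
qed

lemma connected_extremal_graph: "connected extremal_graph"
proof -
  interpret graph extremal_graph by (rule graph_extremal_graph)
  have "u \<rightarrow>\<^sup>*\<^bsub>extremal_graph\<^esub> v" if "u < 13" "v < 13" for u v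
  proof -
    have "u \<rightarrow>\<^sup>*\<^bsub>extremal_graph\<^esub> 0" "0 \<rightarrow>\<^sup>*\<^bsub>extremal_graph\<^esub> v"
      using that by (cases "u = 0"; cases "v = 0";
          auto simp: dominates_extremal_graph_iff arc_extremal_graph_iff)+
    then show ?thesis by (rule reachable_trans)
  qed
  then show ?thesis
    by (intro connectedI) (auto intro: reachable_mk_symmetricI simp: lessThan_empty_iff bot_nat_def)
qed

text \<open>A cut that does not separate by a surviving universal vertex contains all three of them. It then
  leaves at most three components meeting \<open>{9, 10}\<close>, \<open>{11, 12}\<close> and the triangle, and one further
  pendant vertex for every triangle vertex it contains.\<close>

lemma card_components_extremal_graph_le:
  assumes S: "S \<subseteq> {..<13}" "S \<noteq> {}"
  shows "card (components (extremal_graph \<restriction> ({..<13} - S))) \<le> card S"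
proof -
  interpret G: graph extremal_graph by (rule graph_extremal_graph)
  define W where "W = {..<13} - S"
  interpret H: sym_digraph "extremal_graph \<restriction> W" by (rule G.sym_digraph_induce)
  have finS: "finite S" using S(1) finite_subset by blast
  have step: "u \<rightarrow>\<^sup>*\<^bsub>extremal_graph \<restriction> W\<^esub> v"
    if "u \<in> W" "v \<in> W" "u = v \<or> (u, v) \<in> arcs extremal_graph" for u v
    using that by (auto simp: G.dominates_induce_iff dominates_extremal_graph_iff intro: H.reachable_adjI)
  have finW: "finite (verts (extremal_graph \<restriction> W))" by (simp add: W_def)
  show ?thesis
  proof (cases "{0, 1, 2} \<subseteq> S")
    case False
    then obtain h where "h \<in> {0, 1, 2}" "h \<notin> S" by blast
    then have h: "h < 3" "h \<in> W" by (auto simp: W_def)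
    \<comment> \<open>The surviving universal vertex \<open>h\<close> is adjacent to all others, so
      what remains is connected and a single label is enough.\<close>
    have "u \<rightarrow>\<^sup>*\<^bsub>extremal_graph \<restriction> W\<^esub> v" if "u \<in> W" "v \<in> W" for u v
      by (rule H.reachable_trans[of _ h]; rule step)
        (use that h in \<open>auto simp: W_def arc_extremal_graph_iff\<close>)
    then have "card H.sccs \<le> card ((\<lambda>_. 0 :: nat) ` verts (extremal_graph \<restriction> W))"
      using finW by (intro H.card_components_le) auto
    also have "\<dots> \<le> card {0 :: nat}" by (intro card_mono) auto
    also have "\<dots> \<le> card S" using S(2) finS by (simp add: Suc_le_eq card_gt_0_iff)
    finally show ?thesis by (simp add: W_def)
  next
    case True
    \<comment> \<open>A pendant vertex 6, 7 or 8 is attached to the triangle vertex three below it;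
      a triangle vertex is its own root.\<close>
    define root where "root v = (if v < 6 \<or> 9 \<le> v then v else v - 3)" for v :: nat
    \<comment> \<open>All labels are chosen inside \<open>S\<close>, which makes the final count
      immediate: 0 for the net vertices whose root survives, 1 and 2 for the two single edges, and
      for a pendant vertex cut off from the triangle its deleted root. The values 0, 1, 2 belong to
      \<open>S\<close> in this case.\<close>
    define g where "g v = (if v < 9 then if root v \<in> S then root v else 0
      else if v < 11 then 1 else 2)" for v :: nat
    have bounds: "3 \<le> x" "x < 13" if "x \<in> W" for x
    proof -
      have "x \<notin> S" using that by (simp add: W_def)
      moreover have "0 \<in> S" "1 \<in> S" "2 \<in> S" using True by simp_all
      ultimately have "x \<noteq> 0" "x \<noteq> 1" "x \<noteq> 2" by metis+
      then show "3 \<le> x" by linarith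
      show "x < 13" using that by (simp add: W_def)
    qed
    have root: "root x \<in> {3, 4, 5}" "x = root x \<or> (x, root x) \<in> arcs extremal_graph \<and>
      (root x, x) \<in> arcs extremal_graph" if "3 \<le> x" "x < 9" for x
    proof -
      have "x \<in> {3, 4, 5, 6, 7, 8}" using that by auto
      then show "root x \<in> {3, 4, 5}" "x = root x \<or> (x, root x) \<in> arcs extremal_graph \<and>
          (root x, x) \<in> arcs extremal_graph"
        by (auto simp: root_def arc_extremal_graph_iff inner_edges_def)
    qed
    have triangle: "x = y \<or> (x, y) \<in> arcs extremal_graph" if "x \<in> {3, 4, 5}" "y \<in> {3, 4, 5}" for x y
      using that by (elim insertE emptyE) (simp_all add: arc_extremal_graph_iff inner_edges_def)
    have "u \<rightarrow>\<^sup>*\<^bsub>extremal_graph \<restriction> W\<^esub> v" if uv: "u \<in> W" "v \<in> W" "g u = g v" for u v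
    proof -
      have range: "3 \<le> root w" "root w < 6" if "w \<in> W" "w < 9" for w
        using bounds[OF that(1)] that(2) by (auto simp: root_def)
      consider "u < 9" "v < 9" "root u \<notin> S" "root v \<notin> S"
        | "u < 9" "v < 9" "root u \<in> S" "root v = root u"
        | "9 \<le> u" "9 \<le> v" "u < 11 \<longleftrightarrow> v < 11"
        using uv(3) range[OF uv(1)] range[OF uv(2)]
        by (cases "u < 9"; cases "v < 9"; cases "root u \<in> S"; cases "root v \<in> S")
          (auto simp: g_def split: if_splits)
      then show ?thesis
      proof cases
        case 1
        have W: "root u \<in> W" "root v \<in> W"
          using 1 range[OF uv(1)] range[OF uv(2)] by (auto simp: W_def)
        note ru = root[OF bounds(1)[OF uv(1)] 1(1)] and rv = root[OF bounds(1)[OF uv(2)] 1(2)]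
        have "u \<rightarrow>\<^sup>*\<^bsub>extremal_graph \<restriction> W\<^esub> root u"
          by (rule step[OF uv(1) W(1)]) (use ru(2) in blast)
        moreover have "root u \<rightarrow>\<^sup>*\<^bsub>extremal_graph \<restriction> W\<^esub> root v"
          by (rule step[OF W triangle[OF ru(1) rv(1)]])
        moreover have "root v \<rightarrow>\<^sup>*\<^bsub>extremal_graph \<restriction> W\<^esub> v"
          by (rule step[OF W(2) uv(2)]) (use rv(2) in metis)
        ultimately show ?thesis by (blast intro: H.reachable_trans)
      next
        case 2
        \<comment> \<open>The common root is deleted while \<open>u\<close> and \<open>v\<close> are
          not, so both are the one pendant vertex attached to it.\<close>
        then have "u \<noteq> root u" "v \<noteq> root v" using uv by (auto simp: W_def)
        then have "u = v" using 2 bounds[OF uv(1)] bounds[OF uv(2)] by (auto simp: root_def split: if_splits)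
        then show ?thesis by (intro step uv disjI1)
      next
        case 3
        then have "u \<in> {9, 10} \<and> v \<in> {9, 10} \<or> u \<in> {11, 12} \<and> v \<in> {11, 12}"
          using bounds[OF uv(1)] bounds[OF uv(2)] by auto
        then have "u = v \<or> (u, v) \<in> arcs extremal_graph"
          by (auto simp: arc_extremal_graph_iff inner_edges_def)
        then show ?thesis by (intro step uv)
      qed
    qed
    then have "card H.sccs \<le> card (g ` verts (extremal_graph \<restriction> W))"
      using finW by (intro H.card_components_le) auto
    also have "\<dots> \<le> card (({0, 1, 2} :: nat set) \<union> (S - {0, 1, 2}))"
      using finS by (intro card_mono) (auto simp: g_def)
    also have "\<dots> = card S" using True by (metis Un_Diff_cancel Un_absorb1)
    finally show ?thesis by (simp add: W_def)
  qed
qed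

section \<open>Arcs of a cycle, and the absence of a Hamiltonian one\<close>

text \<open>The list of heads of a cycle is its list of tails rotated by one place, so a cycle
  leaves and enters each of its vertices exactly once. These facts about the set of arcs, together
  with the exclusion of 2-cycles, are all that the counting argument below uses.\<close>

lemma (in pre_digraph) cycle_arcs:
  assumes "cycle p" "3 \<le> length p"
  shows "inj_on (tail G) (set p)" "inj_on (head G) (set p)" "set p \<subseteq> arcs G"
    "head G ` set p = tail G ` set p"
    "\<And>e f. e \<in> set p \<Longrightarrow> f \<in> set p \<Longrightarrow> head G e = tail G f \<Longrightarrow> head G f \<noteq> tail G e"
proof -
  obtain u where u: "awalk u p u" "distinct (tl (awalk_verts u p))" and ne: "p \<noteq> []"
    using assms(1) by (auto simp: cycle_def)
  then have cas: "cas u p u" and "set p \<subseteq> arcs G" by (auto simp: awalk_def)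
  then show "set p \<subseteq> arcs G" by simp
  \<comment> \<open>The vertex list of the walk is read in two ways: all tails followed by the final
    head, and the initial tail followed by all heads.\<close>
  have eq: "map (tail G) p @ [head G (last p)] = tail G (hd p) # map (head G) p"
    using awalk_verts_conv[of u p] awalk_verts_conv'[OF cas] ne by simp
  have "head G (last r) = y" if "cas x r y" "r \<noteq> []" for x r y
    using that by (induction x r y rule: cas.induct) (auto split: if_splits)
  then have last: "head G (last p) = tail G (hd p)" using cas ne by (cases p) auto
  have heads: "distinct (map (head G) p)" using u(2) awalk_verts_conv'[OF cas] ne by simp
  have rot: "map (head G) p = rotate1 (map (tail G) p)"
    using eq last ne by (cases p) auto
  then have tails: "distinct (map (tail G) p)" using heads by (metis distinct1_rotate)
  show "inj_on (tail G) (set p)" "inj_on (head G) (set p)"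
    using heads tails by (auto simp: distinct_map)
  show "head G ` set p = tail G ` set p"
    using rot by (metis set_map set_rotate1)
  fix e f assume e: "e \<in> set p" and f: "f \<in> set p" and ef: "head G e = tail G f"
  show "head G f \<noteq> tail G e"
  proof
    assume fe: "head G f = tail G e"
    \<comment> \<open>Positions are taken cyclically, the arc after position \<open>i\<close>
      standing at \<open>Suc i mod ?n\<close>. If \<open>f\<close> follows \<open>e\<close> and
      \<open>e\<close> follows \<open>f\<close>, two steps lead back to \<open>i\<close>, which is
      impossible when \<open>3 \<le> ?n\<close>.\<close>
    let ?n = "length p"
    have lt: "Suc i mod ?n < ?n" for i using assms(2) by (intro mod_less_divisor) linarith
    have nxt: "tail G (p ! (Suc i mod ?n)) = head G (p ! i)" if "i < ?n" for i
      using that lt arg_cong[OF rot, of "\<lambda>xs. xs ! i"] by (simp add: nth_rotate1)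
    obtain i where i: "i < ?n" "p ! i = e" using e by (auto simp: in_set_conv_nth)
    have inj: "x = y" if "x \<in> set p" "y \<in> set p" "tail G x = tail G y" for x y
      using that tails by (auto simp: distinct_map inj_on_def)
    have "p ! (Suc i mod ?n) = f"
      by (rule inj) (use nxt[OF i(1)] i f ef nth_mem[OF lt] in auto)
    then have "p ! (Suc (Suc i mod ?n) mod ?n) = p ! i"
      by (intro inj) (use nxt[OF lt] i fe nth_mem[OF lt] in auto)
    moreover have "distinct p" using tails by (simp add: distinct_map)
    ultimately have "Suc (Suc i mod ?n) mod ?n = i"
      using i(1) lt[of "Suc i mod ?n"] by (simp only: nth_eq_iff_index_eq)
    then show False using i(1) assms(2) by (auto simp: mod_Suc split: if_splits)
  qed
qed

text \<open>At most six arcs of a Hamiltonian cycle meet the universal vertices and at most two lie in the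
  two isolated edges, so at least five lie in the net. The degree constraints at the triangle and
  the absence of 2-cycles allow only four.\<close>

lemma not_hamiltonian_extremal_graph: "\<not> hamiltonian extremal_graph"
proof
  assume "hamiltonian extremal_graph"
  then obtain p where p: "pre_digraph.cycle extremal_graph p" "3 \<le> length p"
    "fst ` set p = {..<13}" by (auto simp: hamiltonian_def)
  note cyc = pre_digraph.cycle_arcs[OF p(1,2), simplified]
  define A where "A = set p"
  have A: "inj_on fst A" "inj_on snd A" "A \<subseteq> arcs extremal_graph" "fst ` A = {..<13}" "snd ` A = {..<13}"
    using cyc(1-4) p(3) by (auto simp: A_def)
  have anti: "(v, u) \<notin> A" if "(u, v) \<in> A" for u v
    using cyc(5)[of "(u, v)" "(v, u)"] that by (auto simp: A_def)
  have finA: "finite A" by (simp add: A_def)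
  have out: "card {e \<in> A. fst e \<in> X} \<le> card X" if "finite X" for X
    by (rule card_inj_on_le[of fst]) (use that A(1) in \<open>auto simp: inj_on_def\<close>)
  have into: "card {e \<in> A. snd e \<in> X} \<le> card X" if "finite X" for X
    by (rule card_inj_on_le[of snd]) (use that A(2) in \<open>auto simp: inj_on_def\<close>)
  have pair: "card (A \<inter> {(u, v), (v, u)}) \<le> 1" for u v
    using anti[of u v] by (cases "(u, v) \<in> A") (auto simp: Int_insert_right)
  \<comment> \<open>The arcs within the net are sorted by the triangle degrees they consume: those
    in \<open>TT\<close> and \<open>Pout\<close> start at a triangle vertex, those in
    \<open>TT\<close> and \<open>Pin\<close> end at one.\<close>
  define TT where "TT = {e \<in> A. fst e \<in> {3, 4, 5} \<and> snd e \<in> {3, 4, 5}}"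
  define Pout where "Pout = A \<inter> {(3, 6), (4, 7), (5, 8)}"
  define Pin where "Pin = A \<inter> {(6, 3), (7, 4), (8, 5)}"
  let ?B = "{e \<in> A. fst e \<in> {..<3}} \<union> {e \<in> A. snd e \<in> {..<3}} \<union> A \<inter> {(9, 10), (10, 9)} \<union>
    A \<inter> {(11, 12), (12, 11)} \<union> TT \<union> Pout \<union> Pin"
  have "A \<subseteq> ?B"
  proof
    fix e assume e: "e \<in> A"
    obtain u v where uv: "e = (u, v)" by force
    have "u < 3 \<or> v < 3 \<or> (u, v) \<in> inner_edges \<or> (v, u) \<in> inner_edges"
      using A(3) e uv arc_extremal_graph_iff by blast
    then show "e \<in> ?B"
      using e unfolding uv inner_edges_def
      by (elim disjE) (auto simp: TT_def Pout_def Pin_def)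
  qed
  then have "card A \<le> card ?B"
    using finA by (intro card_mono) (auto simp: TT_def Pout_def Pin_def)
  also have "\<dots> \<le> card {e \<in> A. fst e \<in> {..<3}} + card {e \<in> A. snd e \<in> {..<3}} +
      card (A \<inter> {(9, 10), (10, 9)}) + card (A \<inter> {(11, 12), (12, 11)}) + card TT + card Pout + card Pin"
    by (intro order.trans[OF card_Un_le] add_mono order.refl)
  also have "\<dots> \<le> 3 + 3 + 1 + 1 + card TT + card Pout + card Pin"
    by (intro add_mono order.refl pair order.trans[OF out] order.trans[OF into]) auto
  finally have "card A \<le> 8 + card TT + card Pout + card Pin" by simp
  moreover have "card A = 13" using card_image[OF A(1)] A(4) by simp
  moreover have "card TT + card Pout \<le> 3"
  proof -
    have "card TT + card Pout = card (TT \<union> Pout)"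
      by (rule card_Un_disjoint[symmetric]) (use finA in \<open>auto simp: TT_def Pout_def\<close>)
    also have "\<dots> \<le> card {e \<in> A. fst e \<in> {3, 4, 5}}"
      by (rule card_mono) (use finA in \<open>auto simp: TT_def Pout_def\<close>)
    also have "\<dots> \<le> card {3, 4, 5 :: nat}" by (rule out) simp
    finally show ?thesis by simp
  qed
  moreover have "card TT + card Pin \<le> 3"
  proof -
    have "card TT + card Pin = card (TT \<union> Pin)"
      by (rule card_Un_disjoint[symmetric]) (use finA in \<open>auto simp: TT_def Pin_def\<close>)
    also have "\<dots> \<le> card {e \<in> A. snd e \<in> {3, 4, 5}}"
      by (rule card_mono) (use finA in \<open>auto simp: TT_def Pin_def\<close>)
    also have "\<dots> \<le> card {3, 4, 5 :: nat}" by (rule into) simp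
    finally show ?thesis by simp
  qed
  \<comment> \<open>Each of the three pendant edges is traversed in at most one direction, because
    there are no 2-cycles.\<close>
  moreover have "card Pout + card Pin \<le> 3"
  proof -
    have "card Pout + card Pin = card (Pout \<union> Pin)"
    proof (rule card_Un_disjoint[symmetric])
      have "Pout \<inter> Pin \<subseteq> {(3, 6), (4, 7), (5, 8)} \<inter> {(6, 3), (7, 4), (8, 5)}"
        unfolding Pout_def Pin_def by blast
      then show "Pout \<inter> Pin = {}" by simp
    qed (use finA in \<open>simp_all add: Pout_def Pin_def\<close>)
    also have "Pout \<union> Pin = A \<inter> {(3, 6), (6, 3)} \<union> A \<inter> {(4, 7), (7, 4)} \<union> A \<inter> {(5, 8), (8, 5)}"
      unfolding Pout_def Pin_def by blast
    also have "card \<dots> \<le> card (A \<inter> {(3, 6), (6, 3)}) + card (A \<inter> {(4, 7), (7, 4)}) + card (A \<inter> {(5, 8), (8, 5)})"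
      by (intro order.trans[OF card_Un_le] add_mono order.refl)
    also have "\<dots> \<le> 1 + 1 + 1" by (intro add_mono pair)
    finally show ?thesis by simp
  qed
  \<comment> \<open>The last three bounds add up to
    \<open>2 * (card TT + card Pout + card Pin) \<le> 9\<close>, so the net carries at most 4 arcs,
    while at least \<open>13 - 8 = 5\<close> are required.\<close>
  ultimately show False by linarith
qed

lemma harris_graph_extremal_graph: "harris_graph extremal_graph"
  unfolding harris_graph_def tough_def eulerian_def
  using graph_extremal_graph connected_extremal_graph not_hamiltonian_extremal_graph
    card_components_extremal_graph_le degree_extremal_graph by simp

lemma barnacle_free_extremal_graph: "barnacle_free extremal_graph"
  using degree_extremal_graph by (simp add: barnacle_free_iff_no_degree_2[OF graph_extremal_graph])

theorem theorem3:
  shows "(\<exists>G :: (nat, nat \<times> nat) pre_digraph.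
            harris_graph G \<and> barnacle_free G \<and> card (verts G) = 13) \<and>
         (\<forall>G :: ('a, 'b) pre_digraph.
            harris_graph G \<and> barnacle_free G \<longrightarrow> 13 \<le> card (verts G))"
  using harris_graph_extremal_graph barnacle_free_extremal_graph
    barnacle_free_harris_graph_order
  by (intro conjI exI[of _ extremal_graph]) auto

end
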